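(* Let $n$ be an even positive integer and put $\omega=\exp(2\pi i/n)$. The following is a complete list of the irreducible complex representations of the quantum double $D(D_n)$, up to isomorphism and without repetition (each representation is specified by the matrices representing $\sigma$, $\tau$ and all $g^*$, $g\in D_n$): (1) For $a,b\in\{0,1\}$, the one-dimensional representations $\sigma=(-1)^a$, $\tau=(-1)^b$, $g^*=\delta(g,e)$; and for $1\le k<n/2$, the two-dimensional representations $\sigma=\begin{bmatrix}\omega^k&0\\0&\omega^{-k}\end{bmatrix}$, $\tau=\begin{bmatrix}0&1\\1&0\end{bmatrix}$, $g^*=\delta(g,e)I_2$. (2) For $a,b\in\{0,1\}$, the one-dimensional representations $\sigma=(-1)^a$, $\tau=(-1)^b$, $g^*=\delta(g,\sigma^{n/2})$; and for $1\le k<n/2$, the two-dimensional representations $\sigma=\begin{bmatrix}\omega^k&0\\0&\omega^{-k}\end{bmatrix}$, $\tau=\begin{bmatrix}0&1\\1&0\end{bmatrix}$, $g^*=\delta(g,\sigma^{n/2})I_2$. (3) For $0\le j<n$ and $1\le k<n/2$, the two-dimensional representations $\sigma=\begin{bmatrix}\omega^j&0\\0&\omega^{-j}\end{bmatrix}$, $\tau=\begin{bmatrix}0&1\\1&0\end{bmatrix}$, $(\sigma^k)^*=\begin{bmatrix}1&0\\0&0\end{bmatrix}$, $(\sigma^{-k})^*=\begin{bmatrix}0&0\\0&1\end{bmatrix}$, and $g^*=0$ for all other $g\in D_n$. (4) For $a,b\in\{0,1\}$, the $(n/2)$-dimensional representations $\sigma=A$, $\tau=(-1)^{a+b}B$,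 where for $1\le i,j\le n/2$, $[A]_{ij}=(-1)^{a\,\delta(i,1)}\delta(i,j+1)$ and $[B]_{ij}=(-1)^{a\,\delta(i,1)}\delta(i+j,2)$ (indices compared modulo $n/2$), and $(\sigma^i)^*=0$ for $0\le i<n$, $(\sigma^{2j}\tau)^*=E^{j+1}_{j+1}$, $(\sigma^{2j+1}\tau)^*=0$ for $0\le j<n/2$. (5) For $a,b\in\{0,1\}$, the $(n/2)$-dimensional representations $\sigma=A$, $\tau=(-1)^{a+b}B$, where for $1\le i,j\le n/2$, $[A]_{ij}=(-1)^{a\,\delta(i,1)}\delta(i,j+1)$ and $[B]_{ij}=\delta(i+j,n/2+1)$ (indices compared modulo $n/2$), and $(\sigma^i)^*=0$ for $0\le i<n$, $(\sigma^{2j}\tau)^*=0$, $(\sigma^{2j+1}\tau)^*=E^{j+1}_{j+1}$ for $0\le j<n/2$. Thus the list consists of $8$ one-dimensional representations, $8$ representations of dimension $n/2$ and $(n+2)(n/2-1)$ two-dimensional representations.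
   Context: $D_n$ is the dihedral group of order $2n$ with generators $\sigma,\tau$ satisfying $\sigma^n=e$, $\tau^2=e$, $\tau\sigma=\sigma^{n-1}\tau$. For a finite group $G$, the quantum double $D(G)$ is the $|G|^2$-dimensional complex associative algebra with basis $\{gh^*: g,h\in G\}$, where the elements $g\in G$ multiply as in $G$, the dual elements satisfy $g^*h^*=\delta(g,h)h^*$, and $h^*g=g\,(g^{-1}hg)^*$ for $g,h\in G$. Here $g\in G$ is identified with $\sum_{h\in G}gh^*$ and $h^*$ with $eh^*$; the unit is $e=\sum_{h\in G}h^*$. Thus $D(G)$ is generated by $G$ and the elements $h^*$. $\delta(x,y)$ is $1$ if $x=y$ and $0$ otherwise; $E^i_j$ denotes the elementary matrix with $1$ in position $(i,j)$ and zeros elsewhere; $I_2$ is the $2\times2$ identity matrix. The same symbol is used for an element of the algebra and its representing matrix. *)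

theory Defs
  imports "Jordan_Normal_Form.VS_Connect" "HOL-Algebra.Generated_Groups"
begin

section \<open>The dihedral group\<close>

text \<open>The pair \<open>(i, s)\<close> stands for \<open>\<sigma>\<^sup>i \<tau>\<close> if \<open>s\<close> holds and for \<open>\<sigma>\<^sup>i\<close> otherwise.\<close>

definition dihedral :: "nat \<Rightarrow> (nat \<times> bool) monoid" where
  "dihedral n = \<lparr>carrier = {0..<n} \<times> UNIV,
     mult = (\<lambda>(i, s) (j, t). ((if s then i + (n - j) else i + j) mod n, s \<noteq> t)),
     one = (0, False)\<rparr>"

definition dih_sigma :: "nat \<Rightarrow> nat \<times> bool" where
  "dih_sigma n = (1 mod n, False)"

definition dih_tau :: "nat \<Rightarrow> nat \<times> bool" where
  "dih_tau n = (0, True)"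

lemma dihedral_simps:
  "carrier (dihedral n) = {0..<n} \<times> UNIV"
  "(i, s) \<otimes>\<^bsub>dihedral n\<^esub> (j, t) = ((if s then i + (n - j) else i + j) mod n, s \<noteq> t)"
  "\<one>\<^bsub>dihedral n\<^esub> = (0, False)"
  by (simp_all add: dihedral_def)

lemma group_dihedral:
  assumes "n > 0" shows "group (dihedral n)"
proof (rule groupI)
  fix x y z
  assume x: "x \<in> carrier (dihedral n)" and y: "y \<in> carrier (dihedral n)"
    and z: "z \<in> carrier (dihedral n)"
  obtain i s j t k u where xyz: "x = (i, s)" "y = (j, t)" "z = (k, u)"
    by (metis surj_pair)
  have b: "i < n" "j < n" "k < n"
    using x y z by (auto simp: xyz dihedral_simps)
  have 1: "(i + j) mod n = (if i + j < n then i + j else i + j - n)" if "i < n" "j < n" for i j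
    using that by (simp add: mod_if)
  have 2: "(i + (n - j)) mod n = (if i < j then i + n - j else i - j)" if "i < n" "j < n" for i j
    using that by (simp add: mod_if)
  have 3: "(i + n - j) mod n = (if i < j then i + n - j else i - j)" if "i < n" "j < n" for i j
    using that by (simp add: mod_if)
  have b3: "(if i + j < n then i + j else i + j - n) < n" "(if i < j then i + n - j else i - j) < n"
    if "i < n" "j < n" for i j :: nat
    using that by auto
  show "x \<otimes>\<^bsub>dihedral n\<^esub> y \<otimes>\<^bsub>dihedral n\<^esub> z = x \<otimes>\<^bsub>dihedral n\<^esub> (y \<otimes>\<^bsub>dihedral n\<^esub> z)"
    unfolding xyz dihedral_simps using b
    by (cases s; cases t) (simp_all add: 1 2 3 b3 split del: if_split, auto)
next
  fix x assume x: "x \<in> carrier (dihedral n)"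
  then obtain i s where xi: "x = (i, s)" "i < n" by (auto simp: dihedral_simps)
  show "\<exists>y\<in>carrier (dihedral n). y \<otimes>\<^bsub>dihedral n\<^esub> x = \<one>\<^bsub>dihedral n\<^esub>"
  proof (cases s)
    case True
    then show ?thesis
      by (intro bexI[of _ x]) (use xi in \<open>auto simp: dihedral_simps\<close>)
  next
    case False
    then show ?thesis
      by (intro bexI[of _ "((n - i) mod n, False)"])
        (use xi assms in \<open>auto simp: dihedral_simps mod_simps\<close>)
  qed
qed (use assms in \<open>auto simp: dihedral_simps\<close>)

lemma order_dihedral: "Coset.order (dihedral n) = 2 * n"
  by (simp add: Coset.order_def dihedral_simps card_cartesian_product)

lemma dih_sigma_pow:
  assumes "n > 0" shows "dih_sigma n [^]\<^bsub>dihedral n\<^esub> (i::nat) = (i mod n, False)"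
proof -
  interpret group "dihedral n" by (rule group_dihedral[OF assms])
  show ?thesis
    by (induction i) (simp_all add: dihedral_simps dih_sigma_def mod_simps)
qed

lemma dihedral_normal_form:
  assumes "i < n"
  shows "(i, False) = dih_sigma n [^]\<^bsub>dihedral n\<^esub> i"
    and "(i, True) = dih_sigma n [^]\<^bsub>dihedral n\<^esub> i \<otimes>\<^bsub>dihedral n\<^esub> dih_tau n"
  using assms by (simp_all add: dih_sigma_pow dih_tau_def dihedral_simps)

lemma dihedral_relations:
  assumes "n > 0"
  shows "dih_sigma n [^]\<^bsub>dihedral n\<^esub> n = \<one>\<^bsub>dihedral n\<^esub>"
    and "dih_tau n [^]\<^bsub>dihedral n\<^esub> (2::nat) = \<one>\<^bsub>dihedral n\<^esub>"
    and "dih_tau n \<otimes>\<^bsub>dihedral n\<^esub> dih_sigma n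
           = dih_sigma n [^]\<^bsub>dihedral n\<^esub> (n - 1) \<otimes>\<^bsub>dihedral n\<^esub> dih_tau n"
proof -
  interpret group "dihedral n" by (rule group_dihedral[OF assms])
  show "dih_sigma n [^]\<^bsub>dihedral n\<^esub> n = \<one>\<^bsub>dihedral n\<^esub>"
    using assms by (simp add: dih_sigma_pow dihedral_simps)
  show "dih_tau n [^]\<^bsub>dihedral n\<^esub> (2::nat) = \<one>\<^bsub>dihedral n\<^esub>"
    using assms by (simp add: numeral_2_eq_2 dih_tau_def dihedral_simps)
  show "dih_tau n \<otimes>\<^bsub>dihedral n\<^esub> dih_sigma n
           = dih_sigma n [^]\<^bsub>dihedral n\<^esub> (n - 1) \<otimes>\<^bsub>dihedral n\<^esub> dih_tau n"
    unfolding dih_sigma_pow[OF assms] using assms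
    by (cases "n = 1") (simp_all add: dih_sigma_def dih_tau_def dihedral_simps)
qed

section \<open>The quantum double of a finite group\<close>

text \<open>The element \<open>\<Sum>\<^bsub>g,h\<^esub> x(g,h) g h\<^sup>*\<close> is represented by its coefficient function \<open>x\<close>,
  which vanishes outside \<open>carrier G \<times> carrier G\<close>. The relations of the algebra give
  \<open>(g h\<^sup>*) (k l\<^sup>*) = g k (k\<^sup>-\<^sup>1 h k)\<^sup>* l\<^sup>* = \<delta>(k\<^sup>-\<^sup>1 h k, l) (g k) l\<^sup>*\<close>,
  and the product is the bilinear extension of this.\<close>

definition qd_basis :: "'g \<Rightarrow> 'g \<Rightarrow> 'g \<times> 'g \<Rightarrow> complex" where
  "qd_basis g h = (\<lambda>p. if p = (g, h) then 1 else 0)"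

definition quantum_double :: "('g, 'b) monoid_scheme \<Rightarrow> (complex, 'g \<times> 'g \<Rightarrow> complex) module" where
  "quantum_double G =
    \<lparr>carrier = {x. \<forall>p. p \<notin> carrier G \<times> carrier G \<longrightarrow> x p = 0},
     mult = (\<lambda>x y p. \<Sum>(g, h)\<in>carrier G \<times> carrier G. \<Sum>(k, l)\<in>carrier G \<times> carrier G.
       x (g, h) * y (k, l) *
         (if inv\<^bsub>G\<^esub> k \<otimes>\<^bsub>G\<^esub> h \<otimes>\<^bsub>G\<^esub> k = l then qd_basis (g \<otimes>\<^bsub>G\<^esub> k) l p else 0)),
     one = (\<lambda>p. \<Sum>h\<in>carrier G. qd_basis \<one>\<^bsub>G\<^esub> h p),
     zero = (\<lambda>p. 0),
     add = (\<lambda>x y p. x p + y p),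
     smult = (\<lambda>c x p. c * x p)\<rparr>"

definition qd_group :: "('g, 'b) monoid_scheme \<Rightarrow> 'g \<Rightarrow> 'g \<times> 'g \<Rightarrow> complex" where
  "qd_group G g = (\<lambda>p. \<Sum>h\<in>carrier G. qd_basis g h p)"

definition qd_dual :: "('g, 'b) monoid_scheme \<Rightarrow> 'g \<Rightarrow> 'g \<times> 'g \<Rightarrow> complex" where
  "qd_dual G h = qd_basis \<one>\<^bsub>G\<^esub> h"

lemma quantum_double_simps:
  "x \<in> carrier (quantum_double G) \<longleftrightarrow> (\<forall>p. p \<notin> carrier G \<times> carrier G \<longrightarrow> x p = 0)"
  "\<one>\<^bsub>quantum_double G\<^esub> = qd_group G \<one>\<^bsub>G\<^esub>"
  "\<zero>\<^bsub>quantum_double G\<^esub> = (\<lambda>p. 0)"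
  "x \<oplus>\<^bsub>quantum_double G\<^esub> y = (\<lambda>p. x p + y p)"
  "c \<odot>\<^bsub>quantum_double G\<^esub> x = (\<lambda>p. c * x p)"
  by (auto simp: quantum_double_def qd_group_def)

lemma quantum_double_mult:
  fixes G (structure)
  assumes "group G" and "finite (carrier G)" and "x \<in> carrier (quantum_double G)"
  shows "x \<otimes>\<^bsub>quantum_double G\<^esub> y =
    (\<lambda>(a, l). if a \<in> carrier G \<and> l \<in> carrier G
      then \<Sum>k\<in>carrier G. x (a \<otimes>\<^bsub>G\<^esub> inv\<^bsub>G\<^esub> k, k \<otimes>\<^bsub>G\<^esub> l \<otimes>\<^bsub>G\<^esub> inv\<^bsub>G\<^esub> k) * y (k, l) else 0)"
proof -
  interpret group G by fact
  note fin = assms(2)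
  show ?thesis
  proof (rule ext, clarify)
    fix a l
    let ?C = "carrier G"
    let ?e = "\<lambda>g h k m. if inv k \<otimes> h \<otimes> k = m then qd_basis (g \<otimes> k) m (a, l) else 0"
    have e: "?e g h k m = (if a \<in> ?C \<and> l \<in> ?C \<and> m = l \<and> g = a \<otimes> inv k \<and> h = k \<otimes> l \<otimes> inv k then 1 else 0)"
      if "g \<in> ?C" "h \<in> ?C" "k \<in> ?C" "m \<in> ?C" for g h k m
    proof -
      have "a = g \<otimes> k \<longleftrightarrow> a \<in> ?C \<and> g = a \<otimes> inv k"
        using that by (auto simp: m_assoc)
      moreover have "inv k \<otimes> h \<otimes> k = m \<longleftrightarrow> h = k \<otimes> m \<otimes> inv k"
        using that by (metis inv_closed inv_solve_left' inv_solve_right m_closed m_assoc)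
      ultimately show ?thesis using that by (auto simp: qd_basis_def)
    qed
    have "(x \<otimes>\<^bsub>quantum_double G\<^esub> y) (a, l) =
      (\<Sum>g\<in>?C. \<Sum>h\<in>?C. \<Sum>k\<in>?C. \<Sum>m\<in>?C. x (g, h) * y (k, m) * ?e g h k m)"
      by (simp add: quantum_double_def sum.cartesian_product[symmetric])
    also have "\<dots> = (\<Sum>g\<in>?C. \<Sum>h\<in>?C. \<Sum>k\<in>?C. \<Sum>m\<in>?C.
        if m = l then (if a \<in> ?C \<and> l \<in> ?C \<and> g = a \<otimes> inv k \<and> h = k \<otimes> l \<otimes> inv k
          then x (g, h) * y (k, l) else 0) else 0)"
      by (intro sum.cong refl) (subst e, auto)
    also have "\<dots> = (\<Sum>g\<in>?C. \<Sum>h\<in>?C. \<Sum>k\<in>?C.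
        if a \<in> ?C \<and> l \<in> ?C \<and> g = a \<otimes> inv k \<and> h = k \<otimes> l \<otimes> inv k then x (g, h) * y (k, l) else 0)"
      using fin by (intro sum.cong refl) (auto simp: sum.delta)
    also have "\<dots> = (\<Sum>g\<in>?C. \<Sum>k\<in>?C. \<Sum>h\<in>?C.
        if h = k \<otimes> l \<otimes> inv k then if a \<in> ?C \<and> l \<in> ?C \<and> g = a \<otimes> inv k then x (g, h) * y (k, l) else 0 else 0)"
      by (subst sum.swap[of _ ?C ?C], intro sum.cong refl sum.cong) auto
    also have "\<dots> = (\<Sum>g\<in>?C. \<Sum>k\<in>?C.
        if a \<in> ?C \<and> l \<in> ?C \<and> g = a \<otimes> inv k then x (g, k \<otimes> l \<otimes> inv k) * y (k, l) else 0)"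
      using fin by (intro sum.cong refl) (auto simp: sum.delta)
    also have "\<dots> = (\<Sum>k\<in>?C. \<Sum>g\<in>?C.
        if g = a \<otimes> inv k then if a \<in> ?C \<and> l \<in> ?C then x (g, k \<otimes> l \<otimes> inv k) * y (k, l) else 0 else 0)"
      by (subst sum.swap, intro sum.cong refl) auto
    also have "\<dots> = (\<Sum>k\<in>?C.
        if a \<in> ?C \<and> l \<in> ?C then x (a \<otimes> inv k, k \<otimes> l \<otimes> inv k) * y (k, l) else 0)"
      using fin by (intro sum.cong refl) (auto simp: sum.delta)
    also have "\<dots> = (if a \<in> ?C \<and> l \<in> ?C
      then \<Sum>k\<in>?C. x (a \<otimes> inv k, k \<otimes> l \<otimes> inv k) * y (k, l) else 0)"
      by (cases "a \<in> ?C \<and> l \<in> ?C") auto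
    finally show "(x \<otimes>\<^bsub>quantum_double G\<^esub> y) (a, l) = \<dots>" .
  qed
qed

lemma qd_group_apply:
  assumes "finite (carrier G)"
  shows "qd_group G g = (\<lambda>(a, l). if a = g \<and> l \<in> carrier G then 1 else 0)"
proof (rule ext, clarify)
  fix a l
  have "qd_group G g (a, l) = (\<Sum>h\<in>carrier G. if h = l then (if a = g then 1 else 0) else 0)"
    by (auto simp: qd_group_def qd_basis_def intro!: sum.cong)
  then show "qd_group G g (a, l) = (if a = g \<and> l \<in> carrier G then 1 else 0)"
    using assms by auto
qed

lemma quantum_double_relations:
  fixes G (structure)
  assumes "group G" and "finite (carrier G)" and "g \<in> carrier G" and "h \<in> carrier G"
  shows "qd_group G g \<otimes>\<^bsub>quantum_double G\<^esub> qd_group G h = qd_group G (g \<otimes> h)"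
    and "qd_dual G g \<otimes>\<^bsub>quantum_double G\<^esub> qd_dual G h
           = (if g = h then qd_dual G h else \<zero>\<^bsub>quantum_double G\<^esub>)"
    and "qd_dual G h \<otimes>\<^bsub>quantum_double G\<^esub> qd_group G g
           = qd_group G g \<otimes>\<^bsub>quantum_double G\<^esub> qd_dual G (inv g \<otimes> h \<otimes> g)"
    and "qd_basis g h = qd_group G g \<otimes>\<^bsub>quantum_double G\<^esub> qd_dual G h"
proof -
  interpret group G by fact
  note fin = assms(2)
  note grp = qd_group_apply[OF assms(2)]
  have gc: "qd_group G k \<in> carrier (quantum_double G)" if "k \<in> carrier G" for k
    using that by (auto simp: grp quantum_double_simps)
  have dc: "qd_dual G k \<in> carrier (quantum_double G)" if "k \<in> carrier G" for k
    using that by (auto simp: qd_dual_def qd_basis_def quantum_double_simps)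
  have dl: "qd_dual G k (a, l) = (if a = \<one> \<and> l = k then 1 else 0)" for k a l
    by (auto simp: qd_dual_def qd_basis_def)
  have eq1: "a \<otimes> inv k = g \<longleftrightarrow> a = g \<otimes> k" if "a \<in> carrier G" "k \<in> carrier G" "g \<in> carrier G" for a k g
    using that by (metis inv_solve_right)
  have collapse: "(\<Sum>k\<in>carrier G. f k * (if k = c \<and> P then 1 else 0)) = (if P then f c else 0)"
    if "c \<in> carrier G" for f :: "_ \<Rightarrow> complex" and c P
  proof -
    have "(\<Sum>k\<in>carrier G. f k * (if k = c \<and> P then 1 else 0))
        = (\<Sum>k\<in>carrier G. if k = c then (if P then f c else 0) else 0)"
      by (intro sum.cong) auto
    then show ?thesis using fin that by simp
  qed
  note collapse_True = collapse[where P = True, simplified]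
  show "qd_group G g \<otimes>\<^bsub>quantum_double G\<^esub> qd_group G h = qd_group G (g \<otimes> h)"
    unfolding quantum_double_mult[OF assms(1,2) gc[OF assms(3)]]
    using assms by (auto simp: grp fun_eq_iff collapse collapse_True eq1)
  show "qd_dual G g \<otimes>\<^bsub>quantum_double G\<^esub> qd_dual G h
      = (if g = h then qd_dual G h else \<zero>\<^bsub>quantum_double G\<^esub>)"
    unfolding quantum_double_mult[OF assms(1,2) dc[OF assms(3)]]
    using assms by (auto simp: dl fun_eq_iff collapse collapse_True quantum_double_simps)
  show "qd_basis g h = qd_group G g \<otimes>\<^bsub>quantum_double G\<^esub> qd_dual G h"
    unfolding quantum_double_mult[OF assms(1,2) gc[OF assms(3)]]
    using assms by (auto simp: grp dl fun_eq_iff collapse qd_basis_def)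
  have conj: "g \<otimes> l \<otimes> inv g = h \<longleftrightarrow> l = inv g \<otimes> h \<otimes> g" if "l \<in> carrier G" for l
    using that assms by (metis inv_closed inv_inv inv_solve_left inv_solve_right m_assoc m_closed)
  have conj': "g \<otimes> l = h \<otimes> g \<longleftrightarrow> l = inv g \<otimes> h \<otimes> g" if "l \<in> carrier G" for l
    using that assms by (metis inv_closed inv_solve_left m_assoc m_closed)
  show "qd_dual G h \<otimes>\<^bsub>quantum_double G\<^esub> qd_group G g
      = qd_group G g \<otimes>\<^bsub>quantum_double G\<^esub> qd_dual G (inv g \<otimes> h \<otimes> g)"
    unfolding quantum_double_mult[OF assms(1,2) gc[OF assms(3)]]
      quantum_double_mult[OF assms(1,2) dc[OF assms(4)]]
    using assms by (auto simp: grp dl fun_eq_iff collapse collapse_True conj conj' eq1)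
qed

lemma ring_quantum_double:
  fixes G (structure)
  assumes "group G" and "finite (carrier G)"
  shows "ring (quantum_double G)"
proof -
  interpret group G by fact
  note fin = assms(2)
  note m = quantum_double_mult[OF assms]
  let ?D = "quantum_double G"
  let ?C = "carrier G"
  have closed: "x \<otimes>\<^bsub>?D\<^esub> y \<in> carrier ?D" if "x \<in> carrier ?D" "y \<in> carrier ?D" for x y
    by (subst m) (use that in \<open>auto simp: quantum_double_simps\<close>)
  note grp = qd_group_apply[OF assms(2)]
  have one: "\<one>\<^bsub>?D\<^esub> \<in> carrier ?D"
    by (auto simp: quantum_double_simps grp)
  have zero: "x (a, l) = 0" if "x \<in> carrier ?D" "a \<notin> ?C \<or> l \<notin> ?C" for x a l
    using that by (auto simp: quantum_double_simps)
  have eq1: "a \<otimes> inv k = g \<longleftrightarrow> k = inv g \<otimes> a" if "a \<in> ?C" "k \<in> ?C" "g \<in> ?C" for a k g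
    using that by (metis inv_solve_left inv_solve_right)
  have collapse: "(\<Sum>k\<in>?C. (if k = c then 1 else 0) * f k) = f c"
       "(\<Sum>k\<in>?C. f k * (if k = c then 1 else 0)) = f c"
    if "c \<in> ?C" for f :: "_ \<Rightarrow> complex" and c
    using fin that by (simp_all add: if_distrib if_distribR cong: if_cong)
  have assoc: "x \<otimes>\<^bsub>?D\<^esub> y \<otimes>\<^bsub>?D\<^esub> z = x \<otimes>\<^bsub>?D\<^esub> (y \<otimes>\<^bsub>?D\<^esub> z)"
    if x: "x \<in> carrier ?D" and y: "y \<in> carrier ?D" and z: "z \<in> carrier ?D" for x y z
  proof (rule ext, clarify)
    fix a l
    show "(x \<otimes>\<^bsub>?D\<^esub> y \<otimes>\<^bsub>?D\<^esub> z) (a, l) = (x \<otimes>\<^bsub>?D\<^esub> (y \<otimes>\<^bsub>?D\<^esub> z)) (a, l)"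
    proof (cases "a \<in> ?C \<and> l \<in> ?C")
      case True
      then have al: "a \<in> ?C" "l \<in> ?C" by auto
      let ?f = "\<lambda>d c. x (a \<otimes> inv d, d \<otimes> l \<otimes> inv d) * y (d \<otimes> inv c, c \<otimes> l \<otimes> inv c) * z (c, l)"
      have "(x \<otimes>\<^bsub>?D\<^esub> y \<otimes>\<^bsub>?D\<^esub> z) (a, l) = (\<Sum>c\<in>?C. \<Sum>b\<in>?C. ?f (b \<otimes> c) c)"
        unfolding m[OF closed[OF x y]] using al
        by (simp add: m[OF x] sum_distrib_right m_assoc inv_mult_group
          cong: sum.cong)
      also have "\<dots> = (\<Sum>c\<in>?C. \<Sum>d\<in>?C. ?f d c)"
      proof (rule sum.cong[OF refl])
        fix c assume c: "c \<in> ?C"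
        show "(\<Sum>b\<in>?C. ?f (b \<otimes> c) c) = (\<Sum>d\<in>?C. ?f d c)"
          by (rule sum.reindex_bij_witness[of _ "\<lambda>d. d \<otimes> inv c" "\<lambda>b. b \<otimes> c"])
            (use c in \<open>auto simp: m_assoc\<close>)
      qed
      also have "\<dots> = (\<Sum>d\<in>?C. \<Sum>c\<in>?C. ?f d c)"
        by (rule sum.swap)
      also have "\<dots> = (x \<otimes>\<^bsub>?D\<^esub> (y \<otimes>\<^bsub>?D\<^esub> z)) (a, l)"
        using al by (simp add: m[OF x] m[OF y] sum_distrib_left mult.assoc cong: sum.cong)
      finally show ?thesis .
    qed (auto simp: zero[OF closed[OF closed[OF x y] z]] zero[OF closed[OF x closed[OF y z]]])
  qed
  show ?thesis
  proof (rule ringI)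
    show "abelian_group ?D"
    proof (rule abelian_groupI)
      fix x assume "x \<in> carrier ?D"
      then show "\<exists>y\<in>carrier ?D. y \<oplus>\<^bsub>?D\<^esub> x = \<zero>\<^bsub>?D\<^esub>"
        by (intro bexI[of _ "\<lambda>p. - x p"]) (auto simp: quantum_double_simps)
    qed (auto simp: quantum_double_simps add_ac)
    show "monoid ?D"
    proof (rule monoidI)
      fix x assume x: "x \<in> carrier ?D"
      show "\<one>\<^bsub>?D\<^esub> \<otimes>\<^bsub>?D\<^esub> x = x"
      proof (rule ext, clarify)
        fix a l
        have "(\<Sum>k\<in>?C. (if a \<otimes> inv k = \<one> \<and> k \<otimes> l \<otimes> inv k \<in> ?C then 1 else 0) * x (k, l))
            = (\<Sum>k\<in>?C. (if k = a then 1 else 0) * x (k, l))" if "a \<in> ?C" "l \<in> ?C"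
          using that by (intro sum.cong) (auto simp: eq1)
        then show "(\<one>\<^bsub>?D\<^esub> \<otimes>\<^bsub>?D\<^esub> x) (a, l) = x (a, l)"
          using zero[OF x, of a l] unfolding m[OF one]
          by (auto simp: quantum_double_simps(2) grp collapse)
      qed
      show "x \<otimes>\<^bsub>?D\<^esub> \<one>\<^bsub>?D\<^esub> = x"
        using zero[OF x] unfolding m[OF x]
        by (auto simp: fun_eq_iff quantum_double_simps(2) grp collapse)
    qed (use closed one assoc in auto)
    fix x y z
    assume x: "x \<in> carrier ?D" and y: "y \<in> carrier ?D" and z: "z \<in> carrier ?D"
    have xy: "x \<oplus>\<^bsub>?D\<^esub> y \<in> carrier ?D"
      using x y by (auto simp: quantum_double_simps)
    show "(x \<oplus>\<^bsub>?D\<^esub> y) \<otimes>\<^bsub>?D\<^esub> z = x \<otimes>\<^bsub>?D\<^esub> z \<oplus>\<^bsub>?D\<^esub> y \<otimes>\<^bsub>?D\<^esub> z"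
      unfolding m[OF xy] m[OF x] m[OF y]
      by (auto simp: fun_eq_iff quantum_double_simps sum.distrib ring_distribs)
    show "z \<otimes>\<^bsub>?D\<^esub> (x \<oplus>\<^bsub>?D\<^esub> y) = z \<otimes>\<^bsub>?D\<^esub> x \<oplus>\<^bsub>?D\<^esub> z \<otimes>\<^bsub>?D\<^esub> y"
      unfolding m[OF z]
      by (auto simp: fun_eq_iff quantum_double_simps sum.distrib ring_distribs)
  qed
qed

section \<open>Matrix representations of complex algebras\<close>

definition matrix_rep :: "(complex, 'x) module \<Rightarrow> nat \<Rightarrow> ('x \<Rightarrow> complex mat) \<Rightarrow> bool" where
  "matrix_rep A d \<rho> \<longleftrightarrow>
     (\<forall>x\<in>carrier A. \<rho> x \<in> carrier_mat d d) \<and>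
     (\<forall>x\<in>carrier A. \<forall>y\<in>carrier A. \<rho> (x \<oplus>\<^bsub>A\<^esub> y) = \<rho> x + \<rho> y) \<and>
     (\<forall>c. \<forall>x\<in>carrier A. \<rho> (c \<odot>\<^bsub>A\<^esub> x) = c \<cdot>\<^sub>m \<rho> x) \<and>
     (\<forall>x\<in>carrier A. \<forall>y\<in>carrier A. \<rho> (x \<otimes>\<^bsub>A\<^esub> y) = \<rho> x * \<rho> y) \<and>
     \<rho> \<one>\<^bsub>A\<^esub> = 1\<^sub>m d"

definition irreducible_rep :: "(complex, 'x) module \<Rightarrow> nat \<Rightarrow> ('x \<Rightarrow> complex mat) \<Rightarrow> bool" where
  "irreducible_rep A d \<rho> \<longleftrightarrow>
     matrix_rep A d \<rho> \<and> d > 0 \<and>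
     (\<forall>W. subspace class_ring W (module_vec TYPE(complex) d) \<and>
          (\<forall>x\<in>carrier A. \<forall>w\<in>W. \<rho> x *\<^sub>v w \<in> W) \<longrightarrow>
          W = {0\<^sub>v d} \<or> W = carrier_vec d)"

definition isomorphic_reps ::
  "(complex, 'x) module \<Rightarrow> nat \<Rightarrow> ('x \<Rightarrow> complex mat) \<Rightarrow> nat \<Rightarrow> ('x \<Rightarrow> complex mat) \<Rightarrow> bool" where
  "isomorphic_reps A d \<rho> d' \<rho>' \<longleftrightarrow>
     d = d' \<and> (\<exists>P\<in>carrier_mat d d. invertible_mat P \<and> (\<forall>x\<in>carrier A. P * \<rho> x = \<rho>' x * P))"

section \<open>The list of representations\<close>

definition delta :: "'a \<Rightarrow> 'a \<Rightarrow> complex" where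
  "delta x y = (if x = y then 1 else 0)"

text \<open>\<open>mat1 d f\<close> has entries \<open>f i j\<close> with rows and columns numbered from 1.\<close>

definition mat1 :: "nat \<Rightarrow> (nat \<Rightarrow> nat \<Rightarrow> complex) \<Rightarrow> complex mat" where
  "mat1 d f = mat d d (\<lambda>(i, j). f (Suc i) (Suc j))"

definition elem_mat :: "nat \<Rightarrow> nat \<Rightarrow> nat \<Rightarrow> complex mat" where
  "elem_mat d p q = mat1 d (\<lambda>i j. delta i p * delta j q)"

definition omega :: "nat \<Rightarrow> complex" where
  "omega n = exp (2 * of_real pi * \<i> / of_nat n)"

definition rot_mat :: "nat \<Rightarrow> nat \<Rightarrow> complex mat" where
  "rot_mat n k = mat_of_rows_list 2 [[omega n ^ k, 0], [0, omega n powi (- int k)]]"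

definition swap_mat :: "complex mat" where
  "swap_mat = mat_of_rows_list 2 [[0, 1], [1, 0]]"

definition A_mat :: "nat \<Rightarrow> nat \<Rightarrow> complex mat" where
  "A_mat m a = mat1 m (\<lambda>i j.
     (if i mod m = 1 mod m then (-1) ^ a else 1) * delta (i mod m) ((j + 1) mod m))"

definition B_even_mat :: "nat \<Rightarrow> nat \<Rightarrow> complex mat" where
  "B_even_mat m a = mat1 m (\<lambda>i j.
     (if i mod m = 1 mod m then (-1) ^ a else 1) * delta ((i + j) mod m) (2 mod m))"

definition B_odd_mat :: "nat \<Rightarrow> complex mat" where
  "B_odd_mat m = mat1 m (\<lambda>i j. delta ((i + j) mod m) ((m + 1) mod m))"

text \<open>The families of the list, in order: one- and two-dimensional representations on which
  only \<open>e\<^sup>*\<close>, respectively only \<open>(\<sigma>\<^bsup>n/2\<^esup>)\<^sup>*\<close>, is nonzero; those on which \<open>(\<sigma>\<^sup>k)\<^sup>*\<close> and \<open>(\<sigma>\<^sup>-\<^sup>k)\<^sup>*\<close>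
  are nonzero, with arguments \<open>j\<close> and \<open>k\<close>; those on which the \<open>(\<sigma>\<^sup>i\<tau>)\<^sup>*\<close> with \<open>i\<close> even,
  respectively odd, are nonzero.\<close>

datatype irrep_label =
    Id_One nat nat | Id_Two nat
  | Mid_One nat nat | Mid_Two nat
  | Rot nat nat
  | Refl_Even nat nat
  | Refl_Odd nat nat

definition one_dim_labels :: "irrep_label set" where
  "one_dim_labels = {Id_One a b | a b. a \<in> {0, 1} \<and> b \<in> {0, 1}}
                  \<union> {Mid_One a b | a b. a \<in> {0, 1} \<and> b \<in> {0, 1}}"

definition two_dim_labels :: "nat \<Rightarrow> irrep_label set" where
  "two_dim_labels n = {Id_Two k | k. 1 \<le> k \<and> k < n div 2}
                    \<union> {Mid_Two k | k. 1 \<le> k \<and> k < n div 2}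
                    \<union> {Rot j k | j k. j < n \<and> 1 \<le> k \<and> k < n div 2}"

definition half_dim_labels :: "irrep_label set" where
  "half_dim_labels = {Refl_Even a b | a b. a \<in> {0, 1} \<and> b \<in> {0, 1}}
                   \<union> {Refl_Odd a b | a b. a \<in> {0, 1} \<and> b \<in> {0, 1}}"

definition irrep_labels :: "nat \<Rightarrow> irrep_label set" where
  "irrep_labels n = one_dim_labels \<union> half_dim_labels \<union> two_dim_labels n"

fun label_dim :: "nat \<Rightarrow> irrep_label \<Rightarrow> nat" where
  "label_dim n (Id_One a b) = 1"
| "label_dim n (Id_Two k) = 2"
| "label_dim n (Mid_One a b) = 1"
| "label_dim n (Mid_Two k) = 2"
| "label_dim n (Rot j k) = 2"
| "label_dim n (Refl_Even a b) = n div 2"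
| "label_dim n (Refl_Odd a b) = n div 2"

fun label_sigma :: "nat \<Rightarrow> irrep_label \<Rightarrow> complex mat" where
  "label_sigma n (Id_One a b) = (-1) ^ a \<cdot>\<^sub>m 1\<^sub>m 1"
| "label_sigma n (Id_Two k) = rot_mat n k"
| "label_sigma n (Mid_One a b) = (-1) ^ a \<cdot>\<^sub>m 1\<^sub>m 1"
| "label_sigma n (Mid_Two k) = rot_mat n k"
| "label_sigma n (Rot j k) = rot_mat n j"
| "label_sigma n (Refl_Even a b) = A_mat (n div 2) a"
| "label_sigma n (Refl_Odd a b) = A_mat (n div 2) a"

fun label_tau :: "nat \<Rightarrow> irrep_label \<Rightarrow> complex mat" where
  "label_tau n (Id_One a b) = (-1) ^ b \<cdot>\<^sub>m 1\<^sub>m 1"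
| "label_tau n (Id_Two k) = swap_mat"
| "label_tau n (Mid_One a b) = (-1) ^ b \<cdot>\<^sub>m 1\<^sub>m 1"
| "label_tau n (Mid_Two k) = swap_mat"
| "label_tau n (Rot j k) = swap_mat"
| "label_tau n (Refl_Even a b) = (-1) ^ (a + b) \<cdot>\<^sub>m B_even_mat (n div 2) a"
| "label_tau n (Refl_Odd a b) = (-1) ^ (a + b) \<cdot>\<^sub>m B_odd_mat (n div 2)"

text \<open>\<open>label_dual n l P\<close>: the family \<open>P g\<close> consists of the matrices prescribed for \<open>g\<^sup>*\<close>.\<close>

fun label_dual :: "nat \<Rightarrow> irrep_label \<Rightarrow> (nat \<times> bool \<Rightarrow> complex mat) \<Rightarrow> bool" where
  "label_dual n (Id_One a b) P \<longleftrightarrow>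
     (\<forall>g\<in>carrier (dihedral n). P g = delta g \<one>\<^bsub>dihedral n\<^esub> \<cdot>\<^sub>m 1\<^sub>m 1)"
| "label_dual n (Id_Two k) P \<longleftrightarrow>
     (\<forall>g\<in>carrier (dihedral n). P g = delta g \<one>\<^bsub>dihedral n\<^esub> \<cdot>\<^sub>m 1\<^sub>m 2)"
| "label_dual n (Mid_One a b) P \<longleftrightarrow>
     (\<forall>g\<in>carrier (dihedral n).
        P g = delta g (dih_sigma n [^]\<^bsub>dihedral n\<^esub> (n div 2)) \<cdot>\<^sub>m 1\<^sub>m 1)"
| "label_dual n (Mid_Two k) P \<longleftrightarrow>
     (\<forall>g\<in>carrier (dihedral n).
        P g = delta g (dih_sigma n [^]\<^bsub>dihedral n\<^esub> (n div 2)) \<cdot>\<^sub>m 1\<^sub>m 2)"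
| "label_dual n (Rot j k) P \<longleftrightarrow>
     (let g\<^sub>1 = dih_sigma n [^]\<^bsub>dihedral n\<^esub> k; g\<^sub>2 = inv\<^bsub>dihedral n\<^esub> g\<^sub>1
      in P g\<^sub>1 = elem_mat 2 1 1 \<and> P g\<^sub>2 = elem_mat 2 2 2 \<and>
         (\<forall>g\<in>carrier (dihedral n) - {g\<^sub>1, g\<^sub>2}. P g = 0\<^sub>m 2 2))"
| "label_dual n (Refl_Even a b) P \<longleftrightarrow>
     (\<forall>i<n. P (dih_sigma n [^]\<^bsub>dihedral n\<^esub> i) = 0\<^sub>m (n div 2) (n div 2)) \<and>
     (\<forall>j<n div 2.
        P (dih_sigma n [^]\<^bsub>dihedral n\<^esub> (2 * j) \<otimes>\<^bsub>dihedral n\<^esub> dih_tau n)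
          = elem_mat (n div 2) (j + 1) (j + 1) \<and>
        P (dih_sigma n [^]\<^bsub>dihedral n\<^esub> (2 * j + 1) \<otimes>\<^bsub>dihedral n\<^esub> dih_tau n)
          = 0\<^sub>m (n div 2) (n div 2))"
| "label_dual n (Refl_Odd a b) P \<longleftrightarrow>
     (\<forall>i<n. P (dih_sigma n [^]\<^bsub>dihedral n\<^esub> i) = 0\<^sub>m (n div 2) (n div 2)) \<and>
     (\<forall>j<n div 2.
        P (dih_sigma n [^]\<^bsub>dihedral n\<^esub> (2 * j) \<otimes>\<^bsub>dihedral n\<^esub> dih_tau n)
          = 0\<^sub>m (n div 2) (n div 2) \<and>
        P (dih_sigma n [^]\<^bsub>dihedral n\<^esub> (2 * j + 1) \<otimes>\<^bsub>dihedral n\<^esub> dih_tau n)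
          = elem_mat (n div 2) (j + 1) (j + 1))"

definition listed_rep ::
  "nat \<Rightarrow> irrep_label \<Rightarrow> (((nat \<times> bool) \<times> (nat \<times> bool) \<Rightarrow> complex) \<Rightarrow> complex mat) \<Rightarrow> bool" where
  "listed_rep n l \<rho> \<longleftrightarrow>
     matrix_rep (quantum_double (dihedral n)) (label_dim n l) \<rho> \<and>
     \<rho> (qd_group (dihedral n) (dih_sigma n)) = label_sigma n l \<and>
     \<rho> (qd_group (dihedral n) (dih_tau n)) = label_tau n l \<and>
     label_dual n l (\<lambda>g. \<rho> (qd_dual (dihedral n) g))"

end

theory Submission
  imports Defs
begin

text \<open>
A representation of the quantum double is a vector space graded by the group, with \<open>h\<^sup>*\<close> projecting
onto the vectors of degree \<open>h\<close>, on which the group acts so that \<open>g\<close> sends degree \<open>h\<close> to degree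
\<open>g h g\<^sup>-\<^sup>1\<close>. The degrees occurring in an irreducible representation therefore form one conjugacy class,
and the vectors of one fixed degree carry an irreducible representation of its centraliser. For
\<open>n = 2 m\<close> the dihedral group has the central classes of \<open>e\<close> and \<open>\<sigma>\<^sup>m\<close>, the classes
\<open>{\<sigma>\<^sup>k, \<sigma>\<^sup>-\<^sup>k}\<close> with \<open>1 \<le> k < m\<close>, and two classes of reflections; the centralisers are the whole group,
the cyclic group of rotations, and groups generated by two commuting involutions. This explains the
five families.

The proof replaces the general theory of induced representations by one explicit notion. In every
listed representation the first coordinate vector has a fixed degree and satisfies a few eigenvector
equations under the centraliser of that degree; a nonzero vector of any representation with these
properties is called a weight vector of the label. Four facts carry the argument.

\<^item> The orbit of a weight vector under \<open>\<sigma>\<close> and \<open>\<tau>\<close> transforms like the coordinate vectors of the listed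
  representation, hence gives a nonzero intertwiner from it (\<open>weight_vector_intertwiner\<close>).

\<^item> Every representation of positive dimension contains a weight vector of some label
  (\<open>weight_vector_exists\<close>): start with a homogeneous vector and split it into eigenvectors of commuting
  matrices of finite order (\<open>cyclic_eigenvector\<close>), moving its degree to the chosen representative
  of the conjugacy class.

\<^item> A listed representation is irreducible (\<open>listed_rep_irreducible\<close>): projections onto degrees, or onto
  eigenspaces of \<open>\<sigma>\<close>, produce a coordinate vector in every nonzero invariant subspace, and \<open>\<sigma>\<close> and
  \<open>\<tau>\<close> permute the coordinate vectors transitively up to scalars.

\<^item> Among listed representations of the same dimension, a weight vector of a label occurs only in the
  representation with that label (\<open>weight_label_unique\<close>).

By Schur's lemma the first three facts show that every irreducible representation is isomorphic to a
listed one, and the last one excludes repetitions, because isomorphisms preserve weight vectors. That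
the listed matrices define representations (\<open>listed_rep_exists\<close>) is checked on generators: a group
representation and a compatible system of projections extend to the quantum double
(\<open>matrix_rep_of_system\<close>), and all listed matrices are monomial, which turns the relations into
statements about indices and signs.
\<close>

section \<open>Matrices acting on coordinate vectors\<close>

lemma subspace_module_vec_iff:
  "subspace class_ring W (module_vec TYPE('a::field) d) \<longleftrightarrow>
     W \<subseteq> carrier_vec d \<and> 0\<^sub>v d \<in> W \<and>
     (\<forall>v\<in>W. \<forall>w\<in>W. v + w \<in> W) \<and> (\<forall>c. \<forall>v\<in>W. c \<cdot>\<^sub>v v \<in> W)"
  using vec_vs[of d, where 'a = 'a] vec_module[of d, where 'a = 'a]
  by (auto simp: VectorSpace.subspace_def submodule_def module_vec_simps)

lemma mult_unit_vec_eq_col: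
  assumes "(A :: 'a::semiring_1 mat) \<in> carrier_mat r c" and "j < c"
  shows "A *\<^sub>v unit_vec c j = col A j"
  using assms by (intro eq_vecI) (auto simp: scalar_prod_right_unit)

lemma mat_eq_if_eq_on_unit_vec:
  assumes "(A :: 'a::semiring_1 mat) \<in> carrier_mat r c" and "B \<in> carrier_mat r c"
    and "\<And>j. j < c \<Longrightarrow> A *\<^sub>v unit_vec c j = B *\<^sub>v unit_vec c j"
  shows "A = B"
  using assms by (intro mat_col_eqI) (auto simp: mult_unit_vec_eq_col)

lemma pow_mat_mult_add:
  assumes "(A :: 'a::semiring_1 mat) \<in> carrier_mat d d"
  shows "A ^\<^sub>m (i + j) = A ^\<^sub>m i * A ^\<^sub>m j"
  using assms
  by (induction j) (auto simp: assoc_mult_mat[of _ d d _ d _ d])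

lemma one_smult_vec_id [simp]: "(1::'a::monoid_mult) \<cdot>\<^sub>v v = v"
  by (auto simp: vec_eq_iff)

lemma mult_mat_zero_vec:
  "(A :: 'a::semiring_0 mat) \<in> carrier_mat r c \<Longrightarrow> A *\<^sub>v 0\<^sub>v c = 0\<^sub>v r"
  by (intro eq_vecI) auto

lemma zero_mat_mult_vec:
  "v \<in> carrier_vec c \<Longrightarrow> (0\<^sub>m r c :: 'a::semiring_0 mat) *\<^sub>v v = 0\<^sub>v r"
  by (intro eq_vecI) (auto simp: scalar_prod_def)

lemma smult_vec_cancel_left:
  "c \<noteq> 0 \<Longrightarrow> c \<cdot>\<^sub>v v = c \<cdot>\<^sub>v w \<longleftrightarrow> v = (w :: complex vec)"
  by (auto simp: vec_eq_iff)

lemma mat_mult_vec_assoc: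
  assumes "A \<in> carrier_mat d d" "B \<in> carrier_mat d d" "v \<in> carrier_vec d"
  shows "A * B *\<^sub>v v = A *\<^sub>v (B *\<^sub>v (v :: complex vec))"
  using assms by (rule assoc_mult_mat_vec)

lemma intertwines_pow:
  assumes Q: "Q \<in> carrier_mat q p" and A: "A \<in> carrier_mat p p" and B: "B \<in> carrier_mat q q"
    and QA: "Q * A = B * Q"
  shows "Q * A ^\<^sub>m k = B ^\<^sub>m k * (Q :: complex mat)"
proof (induction k)
  case 0
  then show ?case using Q A B by simp
next
  case (Suc k)
  have "Q * A ^\<^sub>m Suc k = (Q * A ^\<^sub>m k) * A"
    using Q A by (simp add: assoc_mult_mat[of _ q p _ p _ p])
  also have "\<dots> = B ^\<^sub>m k * (Q * A)"
    using Q A B by (simp add: Suc assoc_mult_mat[of _ q q _ p _ p])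
  also have "\<dots> = B ^\<^sub>m Suc k * Q"
    using Q A B by (simp add: QA assoc_mult_mat[of _ q q _ q _ p])
  finally show ?case .
qed

lemma subspace_common_eigenvectors:
  assumes A: "A \<in> carrier_mat d d" and B: "B \<in> carrier_mat d d"
  shows "subspace class_ring {v \<in> carrier_vec d. A *\<^sub>v v = a \<cdot>\<^sub>v v \<and> B *\<^sub>v v = b \<cdot>\<^sub>v v}
     (module_vec TYPE(complex) d)"
proof -
  have "c \<cdot>\<^sub>v 0\<^sub>v d = 0\<^sub>v d" for c :: complex by auto
  then show ?thesis
    unfolding subspace_module_vec_iff
    by (auto simp: mult_mat_zero_vec[OF A] mult_mat_zero_vec[OF B] mult_add_distrib_mat_vec[OF A]
        mult_add_distrib_mat_vec[OF B] mult_mat_vec[OF A] mult_mat_vec[OF B]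
        smult_add_distrib_vec[of _ d] smult_smult_assoc mult.commute)
qed

lemma subspace_eq_carrier_vecI:
  assumes W: "subspace class_ring W (module_vec TYPE(complex) d)"
    and e: "\<And>j. j < d \<Longrightarrow> unit_vec d j \<in> W"
  shows "W = carrier_vec d"
proof -
  have W': "W \<subseteq> carrier_vec d" "0\<^sub>v d \<in> W" "\<And>v w. v \<in> W \<Longrightarrow> w \<in> W \<Longrightarrow> v + w \<in> W"
    "\<And>c v. v \<in> W \<Longrightarrow> c \<cdot>\<^sub>v v \<in> W"
    using W by (auto simp: subspace_module_vec_iff)
  have "v \<in> W" if v: "v \<in> carrier_vec d" for v
  proof -
    have "vec d (\<lambda>i. if i < k then v $ i else 0) \<in> W" if "k \<le> d" for k
      using that
    proof (induction k)
      case 0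
      have "vec d (\<lambda>i. if i < 0 then v $ i else 0) = 0\<^sub>v d" by auto
      then show ?case using W' by simp
    next
      case (Suc k)
      have "vec d (\<lambda>i. if i < Suc k then v $ i else 0) =
          vec d (\<lambda>i. if i < k then v $ i else 0) + v $ k \<cdot>\<^sub>v unit_vec d k"
        using Suc.prems by (intro eq_vecI) (auto simp: less_Suc_eq)
      then show ?case using Suc W' e[of k] by simp
    qed
    from this[of d] have "vec d (\<lambda>i. if i < d then v $ i else 0) \<in> W" by simp
    moreover have "vec d (\<lambda>i. if i < d then v $ i else 0) = v" using v by (intro eq_vecI) auto
    ultimately show ?thesis by simp
  qed
  then show ?thesis using W' by auto
qed

text \<open>The traces of \<open>Q * R\<close> and \<open>R * Q\<close> agree.\<close>

lemma dim_eq_if_inverse_mats: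
  fixes Q :: "complex mat"
  assumes Q: "Q \<in> carrier_mat p q" and R: "R \<in> carrier_mat q p"
    and QR: "Q * R = 1\<^sub>m p" and RQ: "R * Q = 1\<^sub>m q"
  shows "p = q"
proof -
  have "of_nat p = (\<Sum>i<p. (Q * R) $$ (i, i))"
    by (simp add: QR)
  also have "\<dots> = (\<Sum>i<p. \<Sum>j<q. Q $$ (i, j) * R $$ (j, i))"
    using Q R by (intro sum.cong) (auto simp: scalar_prod_def atLeast0LessThan)
  also have "\<dots> = (\<Sum>j<q. \<Sum>i<p. R $$ (j, i) * Q $$ (i, j))"
    by (subst sum.swap) (simp add: mult.commute)
  also have "\<dots> = (\<Sum>j<q. (R * Q) $$ (j, j))"
    using Q R by (intro sum.cong) (auto simp: scalar_prod_def atLeast0LessThan)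
  also have "\<dots> = of_nat q"
    by (simp add: RQ)
  finally have "(of_nat p :: complex) = of_nat q" .
  then show ?thesis using of_nat_eq_iff by blast
qed

section \<open>Representations of the quantum double of a finite group\<close>

lemma qd_group_in_carrier:
  assumes "finite (carrier G)" "g \<in> carrier G"
  shows "qd_group G g \<in> carrier (quantum_double G)"
  using assms by (auto simp: qd_group_apply quantum_double_simps)

lemma qd_basis_in_carrier:
  assumes "g \<in> carrier G" "h \<in> carrier G"
  shows "qd_basis g h \<in> carrier (quantum_double G)"
  using assms by (auto simp: qd_basis_def quantum_double_simps)

lemma qd_dual_in_carrier:
  assumes "group G" "h \<in> carrier G"
  shows "qd_dual G h \<in> carrier (quantum_double G)"
  using assms by (simp add: qd_dual_def qd_basis_in_carrier group.is_monoid monoid.one_closed)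

lemma qd_one_eq_sum_dual:
  "\<one>\<^bsub>quantum_double G\<^esub> = (\<lambda>p. \<Sum>h\<in>carrier G. qd_dual G h p)"
  by (simp add: quantum_double_def qd_dual_def)

text \<open>Every element is a combination of the basis elements \<open>g h\<^sup>*\<close>, and each of these is the product
  of a group element and a dual element; so a property that is stable under the algebra operations
  has to be checked on these two kinds of generators only.\<close>

lemma quantum_double_induct:
  fixes G (structure)
  assumes G: "group G" and fin: "finite (carrier G)"
    and x: "x \<in> carrier (quantum_double G)"
    and add: "\<And>x y. x \<in> carrier (quantum_double G) \<Longrightarrow> y \<in> carrier (quantum_double G) \<Longrightarrow> 
        Q x \<Longrightarrow> Q y \<Longrightarrow> Q (x \<oplus>\<^bsub>quantum_double G\<^esub> y)"
    and smult: "\<And>c x. x \<in> carrier (quantum_double G) \<Longrightarrow> Q x \<Longrightarrow> Q (c \<odot>\<^bsub>quantum_double G\<^esub> x)"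
    and mult: "\<And>x y. x \<in> carrier (quantum_double G) \<Longrightarrow> y \<in> carrier (quantum_double G) \<Longrightarrow> 
        Q x \<Longrightarrow> Q y \<Longrightarrow> Q (x \<otimes>\<^bsub>quantum_double G\<^esub> y)"
    and grp: "\<And>g. g \<in> carrier G \<Longrightarrow> Q (qd_group G g)"
    and dual: "\<And>h. h \<in> carrier G \<Longrightarrow> Q (qd_dual G h)"
  shows "Q x"
proof -
  interpret group G by fact
  let ?D = "quantum_double G"
  have basis: "Q (qd_basis g h)" if "g \<in> carrier G" "h \<in> carrier G" for g h
    unfolding quantum_double_relations(4)[OF G fin that]
    using that by (intro mult grp dual qd_group_in_carrier qd_dual_in_carrier fin G)
  have zero: "Q (\<lambda>p. 0)"
    using smult[of "qd_basis \<one> \<one>" 0] basis[of \<one> \<one>] 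
    by (simp add: quantum_double_simps(5) qd_basis_in_carrier)
  have supp: "finite F \<Longrightarrow> F \<subseteq> carrier G \<times> carrier G \<Longrightarrow> (\<And>p. p \<notin> F \<Longrightarrow> y p = 0) \<Longrightarrow> Q y" for F y
  proof (induction F arbitrary: y rule: finite_induct)
    case empty
    then have "y = (\<lambda>p. 0)" by auto
    then show ?case using zero by simp
  next
    case (insert q F)
    obtain g h where q: "q = (g, h)" by force
    have gh: "g \<in> carrier G" "h \<in> carrier G" using insert.prems q by auto
    let ?z = "\<lambda>p. if p = q then 0 else y p"
    have "Q ?z" using insert.prems by (intro insert.IH) auto
    moreover have "?z \<in> carrier ?D"
      using insert.prems by (force simp: quantum_double_simps)
    moreover have "y q \<odot>\<^bsub>?D\<^esub> qd_basis g h \<in> carrier ?D"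
      using gh by (auto simp: quantum_double_simps qd_basis_def)
    moreover have "Q (y q \<odot>\<^bsub>?D\<^esub> qd_basis g h)"
      using gh by (intro smult basis qd_basis_in_carrier)
    ultimately have "Q (?z \<oplus>\<^bsub>?D\<^esub> (y q \<odot>\<^bsub>?D\<^esub> qd_basis g h))"
      using add by blast
    moreover have "?z \<oplus>\<^bsub>?D\<^esub> (y q \<odot>\<^bsub>?D\<^esub> qd_basis g h) = y"
      by (auto simp: quantum_double_simps qd_basis_def q)
    ultimately show ?case by simp
  qed
  show ?thesis
    by (rule supp[of "carrier G \<times> carrier G"]) (use x fin in \<open>auto simp: quantum_double_simps\<close>)
qed

lemma matrix_rep_sum_dual:
  assumes fin: "finite (carrier G)" and G: "group G"
    and \<rho>: "matrix_rep (quantum_double G) d \<rho>" and ij: "i < d" "j < d"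
  shows "(\<Sum>h\<in>carrier G. \<rho> (qd_dual G h) $$ (i, j)) = (if i = j then 1 else 0)"
proof -
  let ?D = "quantum_double G"
  have *: "F \<subseteq> carrier G \<Longrightarrow> finite F \<Longrightarrow>
     (\<lambda>p. \<Sum>h\<in>F. qd_dual G h p) \<in> carrier ?D \<and>
     \<rho> (\<lambda>p. \<Sum>h\<in>F. qd_dual G h p) $$ (i, j) = (\<Sum>h\<in>F. \<rho> (qd_dual G h) $$ (i, j))" for F
  proof (induction F rule: infinite_finite_induct)
    case empty
    have z: "\<zero>\<^bsub>?D\<^esub> \<in> carrier ?D" by (auto simp: quantum_double_simps)
    have zz: "0 \<odot>\<^bsub>?D\<^esub> \<zero>\<^bsub>?D\<^esub> = \<zero>\<^bsub>?D\<^esub>" by (auto simp: quantum_double_simps)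
    have "\<rho> (0 \<odot>\<^bsub>?D\<^esub> \<zero>\<^bsub>?D\<^esub>) = 0 \<cdot>\<^sub>m \<rho> \<zero>\<^bsub>?D\<^esub>" "\<rho> \<zero>\<^bsub>?D\<^esub> \<in> carrier_mat d d"
      using \<rho> z by (auto simp: matrix_rep_def)
    then have "\<rho> \<zero>\<^bsub>?D\<^esub> $$ (i, j) = (0 \<cdot>\<^sub>m \<rho> \<zero>\<^bsub>?D\<^esub>) $$ (i, j)" "\<rho> \<zero>\<^bsub>?D\<^esub> \<in> carrier_mat d d"
      unfolding zz by simp_all
    then have "\<rho> \<zero>\<^bsub>?D\<^esub> $$ (i, j) = 0" using ij by simp
    then show ?case using z by (simp add: quantum_double_simps(3))
  next
    case (insert h F)
    have h: "qd_dual G h \<in> carrier ?D" using insert qd_dual_in_carrier[OF G] by auto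
    let ?s = "\<lambda>p. \<Sum>h\<in>F. qd_dual G h p"
    have s: "?s \<in> carrier ?D" using insert by auto
    have eq: "(\<lambda>p. \<Sum>h\<in>insert h F. qd_dual G h p) = qd_dual G h \<oplus>\<^bsub>?D\<^esub> ?s"
      using insert by (simp add: quantum_double_simps)
    have "\<rho> (qd_dual G h \<oplus>\<^bsub>?D\<^esub> ?s) = \<rho> (qd_dual G h) + \<rho> ?s"
         "\<rho> (qd_dual G h) \<in> carrier_mat d d" "\<rho> ?s \<in> carrier_mat d d"
      using h s \<rho> by (auto simp: matrix_rep_def)
    moreover have "qd_dual G h \<oplus>\<^bsub>?D\<^esub> ?s \<in> carrier ?D"
      using h s by (auto simp: quantum_double_simps)
    ultimately show ?case using insert ij unfolding eq by auto
  qed auto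
  have "\<rho> \<one>\<^bsub>?D\<^esub> = 1\<^sub>m d" using \<rho> by (simp add: matrix_rep_def)
  then show ?thesis using *[OF order_refl fin] ij by (simp add: qd_one_eq_sum_dual)
qed

text \<open>A representation amounts to a representation \<open>R\<close> of the group together with a resolution of the
  identity \<open>P\<close> that \<open>R\<close> permutes by conjugation: on the basis it must be \<open>g h\<^sup>* \<mapsto> R g * P h\<close>, and
  the product of two such matrices is given by the multiplication rule of the basis. The linear
  extension is defined entry by entry, so that only sums of complex numbers occur.\<close>

lemma matrix_rep_of_system:
  fixes G (structure) and R P :: "'g \<Rightarrow> complex mat"
  assumes G: "group G" and fin: "finite (carrier G)"
    and R: "\<And>g. g \<in> carrier G \<Longrightarrow> R g \<in> carrier_mat d d"
    and R_one: "R \<one> = 1\<^sub>m d"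
    and R_mult: "\<And>g h. g \<in> carrier G \<Longrightarrow> h \<in> carrier G \<Longrightarrow> R (g \<otimes> h) = R g * R h"
    and P: "\<And>h. h \<in> carrier G \<Longrightarrow> P h \<in> carrier_mat d d"
    and P_mult: "\<And>g h. g \<in> carrier G \<Longrightarrow> h \<in> carrier G \<Longrightarrow>
        P g * P h = (if g = h then P h else 0\<^sub>m d d)"
    and P_sum: "\<And>i j. i < d \<Longrightarrow> j < d \<Longrightarrow>
        (\<Sum>h\<in>carrier G. P h $$ (i, j)) = (if i = j then 1 else 0)"
    and PR: "\<And>g h. g \<in> carrier G \<Longrightarrow> h \<in> carrier G \<Longrightarrow> P h * R g = R g * P (inv g \<otimes> h \<otimes> g)"
  obtains \<rho> where "matrix_rep (quantum_double G) d \<rho>"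
    and "\<And>g. g \<in> carrier G \<Longrightarrow> \<rho> (qd_group G g) = R g"
    and "\<And>h. h \<in> carrier G \<Longrightarrow> \<rho> (qd_dual G h) = P h"
proof -
  interpret group G by fact
  let ?C = "carrier G" and ?D = "quantum_double G"
  let ?CC = "?C \<times> ?C"
  define M where "M = (\<lambda>(g, h). R g * P h)"
  have M: "M p \<in> carrier_mat d d" if "p \<in> ?CC" for p
    using that by (auto simp: M_def intro!: mult_carrier_mat[OF R P])
  have M_mult: "M (g, h) * M (k, l) = (if inv k \<otimes> h \<otimes> k = l then M (g \<otimes> k, l) else 0\<^sub>m d d)"
    if "g \<in> ?C" "h \<in> ?C" "k \<in> ?C" "l \<in> ?C" for g h k l
  proof -
    let ?h = "inv k \<otimes> h \<otimes> k"
    have h: "?h \<in> ?C" using that by auto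
    have c: "R g \<in> carrier_mat d d" "R k \<in> carrier_mat d d" "P h \<in> carrier_mat d d"
      "P l \<in> carrier_mat d d" "P ?h \<in> carrier_mat d d"
      using that h R P by auto
    have "M (g, h) * M (k, l) = R g * (P h * R k) * P l"
      using c by (simp add: M_def assoc_mult_mat[of _ d d _ d _ d])
    also have "\<dots> = R g * R k * (P ?h * P l)"
      using c PR[OF that(3,2)] by (simp add: assoc_mult_mat[of _ d d _ d _ d])
    also have "\<dots> = (if ?h = l then M (g \<otimes> k, l) else 0\<^sub>m d d)"
      using c h that by (auto simp: P_mult M_def R_mult)
    finally show ?thesis .
  qed
  define \<rho> where "\<rho> = (\<lambda>x. mat d d (\<lambda>(i, j). \<Sum>p\<in>?CC. x p * M p $$ (i, j)))"
  have \<rho>: "\<rho> x \<in> carrier_mat d d" for x by (simp add: \<rho>_def)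
  have entry: "\<rho> x $$ (i, j) = (\<Sum>p\<in>?CC. x p * M p $$ (i, j))" if "i < d" "j < d" for x i j
    using that by (simp add: \<rho>_def)
  have basis: "\<rho> (qd_basis g h) = R g * P h" if "g \<in> ?C" "h \<in> ?C" for g h
  proof (rule eq_matI)
    fix i j assume "i < dim_row (R g * P h)" "j < dim_col (R g * P h)"
    then have ij: "i < d" "j < d" using R[OF that(1)] P[OF that(2)] by auto
    have "\<rho> (qd_basis g h) $$ (i, j) = (\<Sum>p\<in>?CC. if p = (g, h) then M p $$ (i, j) else 0)"
      unfolding entry[OF ij] by (intro sum.cong) (auto simp: qd_basis_def)
    also have "\<dots> = (R g * P h) $$ (i, j)"
      using that fin by (simp add: M_def)
    finally show "\<rho> (qd_basis g h) $$ (i, j) = (R g * P h) $$ (i, j)" .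
  qed (use R[OF that(1)] P[OF that(2)] \<rho> in auto)
  have grp: "\<rho> (qd_group G g) = R g" if g: "g \<in> ?C" for g
  proof (rule eq_matI)
    fix i j assume "i < dim_row (R g)" "j < dim_col (R g)"
    then have ij: "i < d" "j < d" using R[OF g] by auto
    have "\<rho> (qd_group G g) $$ (i, j) = (\<Sum>(k, h)\<in>?CC. if k = g then M (k, h) $$ (i, j) else 0)"
      unfolding entry[OF ij] by (intro sum.cong) (auto simp: qd_group_apply[OF fin])
    also have "\<dots> = (\<Sum>k\<in>?C. \<Sum>h\<in>?C. if k = g then M (k, h) $$ (i, j) else 0)"
      by (simp add: sum.cartesian_product)
    also have "\<dots> = (\<Sum>k\<in>?C. if k = g then \<Sum>h\<in>?C. M (g, h) $$ (i, j) else 0)"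
      by (intro sum.cong) auto
    also have "\<dots> = (\<Sum>h\<in>?C. M (g, h) $$ (i, j))"
      using g fin by simp
    also have "\<dots> = (\<Sum>h\<in>?C. \<Sum>r<d. R g $$ (i, r) * P h $$ (r, j))"
    proof (intro sum.cong refl)
      fix h assume "h \<in> ?C"
      then show "M (g, h) $$ (i, j) = (\<Sum>r<d. R g $$ (i, r) * P h $$ (r, j))"
        using R[OF g] P[of h] ij by (auto simp: M_def scalar_prod_def atLeast0LessThan)
    qed
    also have "\<dots> = (\<Sum>r<d. R g $$ (i, r) * (\<Sum>h\<in>?C. P h $$ (r, j)))"
      by (subst sum.swap) (simp add: sum_distrib_left)
    also have "\<dots> = (\<Sum>r<d. if r = j then R g $$ (i, r) else 0)"
      using ij by (intro sum.cong) (auto simp: P_sum)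
    also have "\<dots> = R g $$ (i, j)" using ij by simp
    finally show "\<rho> (qd_group G g) $$ (i, j) = R g $$ (i, j)" .
  qed (use R[OF g] \<rho> in auto)
  have dual: "\<rho> (qd_dual G h) = P h" if "h \<in> ?C" for h
    using basis[of \<one> h] that P[OF that] by (simp add: qd_dual_def R_one)
  have mult: "\<rho> (x \<otimes>\<^bsub>?D\<^esub> y) = \<rho> x * \<rho> y" for x y
  proof (rule eq_matI)
    fix i j assume "i < dim_row (\<rho> x * \<rho> y)" "j < dim_col (\<rho> x * \<rho> y)"
    then have ij: "i < d" "j < d" using \<rho>[of x] \<rho>[of y] by auto
    have "\<rho> (x \<otimes>\<^bsub>?D\<^esub> y) $$ (i, j) =
      (\<Sum>s\<in>?CC. \<Sum>(g, h)\<in>?CC. \<Sum>(k, l)\<in>?CC. x (g, h) * y (k, l) *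
         ((if inv k \<otimes> h \<otimes> k = l then qd_basis (g \<otimes> k) l s else 0) * M s $$ (i, j)))"
      unfolding entry[OF ij]
      by (simp add: quantum_double_def sum_distrib_right split_def mult.assoc)
    also have "\<dots> = (\<Sum>(g, h)\<in>?CC. \<Sum>(k, l)\<in>?CC. \<Sum>s\<in>?CC. x (g, h) * y (k, l) *
         ((if inv k \<otimes> h \<otimes> k = l then qd_basis (g \<otimes> k) l s else 0) * M s $$ (i, j)))"
      by (subst sum.swap, intro sum.cong refl, simp only: split_def, subst sum.swap, rule refl)
    also have "\<dots> = (\<Sum>(g, h)\<in>?CC. \<Sum>(k, l)\<in>?CC. x (g, h) * y (k, l) * (M (g, h) * M (k, l)) $$ (i, j))"
    proof (intro sum.cong refl, clarify, intro sum.cong refl, clarify)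
      fix g h k l assume c: "g \<in> ?C" "h \<in> ?C" "k \<in> ?C" "l \<in> ?C"
      have "(\<Sum>s\<in>?CC. (if inv k \<otimes> h \<otimes> k = l then qd_basis (g \<otimes> k) l s else 0) * M s $$ (i, j))
          = (\<Sum>s\<in>?CC. if s = (g \<otimes> k, l) then (if inv k \<otimes> h \<otimes> k = l then M s $$ (i, j) else 0) else 0)"
        by (intro sum.cong) (auto simp: qd_basis_def)
      also have "\<dots> = (M (g, h) * M (k, l)) $$ (i, j)"
        using c fin ij by (auto simp: M_mult)
      finally show "(\<Sum>s\<in>?CC. x (g, h) * y (k, l) *
         ((if inv k \<otimes> h \<otimes> k = l then qd_basis (g \<otimes> k) l s else 0) * M s $$ (i, j)))
         = x (g, h) * y (k, l) * (M (g, h) * M (k, l)) $$ (i, j)"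
        by (simp only: sum_distrib_left[symmetric])
    qed
    also have "\<dots> = (\<Sum>p\<in>?CC. \<Sum>q\<in>?CC. x p * y q * (\<Sum>r<d. M p $$ (i, r) * M q $$ (r, j)))"
    proof (simp only: split_def prod.collapse, intro sum.cong refl)
      fix p q assume "p \<in> ?CC" "q \<in> ?CC"
      then show "x p * y q * (M p * M q) $$ (i, j) = x p * y q * (\<Sum>r<d. M p $$ (i, r) * M q $$ (r, j))"
        using M[of p] M[of q] ij by (auto simp: scalar_prod_def atLeast0LessThan)
    qed
    also have "\<dots> = (\<Sum>r<d. \<Sum>p\<in>?CC. \<Sum>q\<in>?CC. (x p * M p $$ (i, r)) * (y q * M q $$ (r, j)))"
      by (simp only: sum_distrib_left sum.swap[of _ "{..<d}"]) (simp add: mult_ac)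
    also have "\<dots> = (\<Sum>r<d. \<rho> x $$ (i, r) * \<rho> y $$ (r, j))"
      using ij by (intro sum.cong) (auto simp: entry sum_product)
    also have "\<dots> = (\<rho> x * \<rho> y) $$ (i, j)"
      using \<rho>[of x] \<rho>[of y] ij by (auto simp: scalar_prod_def atLeast0LessThan)
    finally show "\<rho> (x \<otimes>\<^bsub>?D\<^esub> y) $$ (i, j) = (\<rho> x * \<rho> y) $$ (i, j)" .
  qed (use \<rho> in \<open>auto simp: carrier_matD[OF \<rho>]\<close>)
  have "matrix_rep ?D d \<rho>"
    unfolding matrix_rep_def
  proof (intro conjI ballI allI)
    show "\<rho> \<one>\<^bsub>?D\<^esub> = 1\<^sub>m d"
      by (simp add: quantum_double_simps(2) grp R_one)
    fix x y show "\<rho> (x \<otimes>\<^bsub>?D\<^esub> y) = \<rho> x * \<rho> y" by (rule mult)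
  qed (auto simp: \<rho> quantum_double_simps(4,5) \<rho>_def ring_distribs sum.distrib
         sum_distrib_left mult.assoc)
  from that[OF this grp dual] show ?thesis .
qed

lemma matrix_repD:
  assumes "matrix_rep A d \<rho>"
  shows "x \<in> carrier A \<Longrightarrow> \<rho> x \<in> carrier_mat d d"
    and "x \<in> carrier A \<Longrightarrow> y \<in> carrier A \<Longrightarrow> \<rho> (x \<oplus>\<^bsub>A\<^esub> y) = \<rho> x + \<rho> y"
    and "x \<in> carrier A \<Longrightarrow> \<rho> (c \<odot>\<^bsub>A\<^esub> x) = c \<cdot>\<^sub>m \<rho> x"
    and "x \<in> carrier A \<Longrightarrow> y \<in> carrier A \<Longrightarrow> \<rho> (x \<otimes>\<^bsub>A\<^esub> y) = \<rho> x * \<rho> y"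
    and "\<rho> \<one>\<^bsub>A\<^esub> = 1\<^sub>m d"
  using assms by (auto simp: matrix_rep_def)

section \<open>Schur's lemma\<close>

text \<open>Kernel and image of an intertwiner are invariant, so a nonzero intertwiner between irreducible
  representations is bijective. The isomorphism stated here is its inverse, assembled from
  preimages of the coordinate vectors.\<close>

lemma schur:
  assumes \<rho>: "irreducible_rep A p \<rho>" and \<rho>': "irreducible_rep A q \<rho>'"
    and Q: "Q \<in> carrier_mat q p" and Q0: "Q \<noteq> 0\<^sub>m q p"
    and QR: "\<And>x. x \<in> carrier A \<Longrightarrow> Q * \<rho> x = \<rho>' x * Q"
  shows "isomorphic_reps A q \<rho>' p \<rho>"
proof -
  have rep: "matrix_rep A p \<rho>" and rep': "matrix_rep A q \<rho>'"
    using \<rho> \<rho>' by (auto simp: irreducible_rep_def)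
  note c = matrix_repD(1)[OF rep] and c' = matrix_repD(1)[OF rep']
  have QR_vec: "Q *\<^sub>v (\<rho> x *\<^sub>v v) = \<rho>' x *\<^sub>v (Q *\<^sub>v v)" if "x \<in> carrier A" "v \<in> carrier_vec p" for x v
    using assoc_mult_mat_vec[OF Q c[OF that(1)] that(2)]
      assoc_mult_mat_vec[OF c'[OF that(1)] Q that(2)] QR[OF that(1)] by metis
  let ?K = "{v \<in> carrier_vec p. Q *\<^sub>v v = 0\<^sub>v q}"
  have "subspace class_ring ?K (module_vec TYPE(complex) p)"
    using Q by (auto simp: subspace_module_vec_iff mult_add_distrib_mat_vec mult_mat_vec[OF Q])
  moreover have "\<rho> x *\<^sub>v v \<in> ?K" if "x \<in> carrier A" "v \<in> ?K" for x v
    using that QR_vec[of x v] c[of x] c'[of x] by auto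
  ultimately have "?K = {0\<^sub>v p} \<or> ?K = carrier_vec p"
    using \<rho> by (simp add: irreducible_rep_def)
  moreover have "?K \<noteq> carrier_vec p"
  proof
    assume K: "?K = carrier_vec p"
    have "Q = 0\<^sub>m q p"
    proof (rule mat_eq_if_eq_on_unit_vec[OF Q])
      fix j assume "j < p"
      have "unit_vec p j \<in> ?K" unfolding K by simp
      then show "Q *\<^sub>v unit_vec p j = 0\<^sub>m q p *\<^sub>v unit_vec p j"
        by (simp add: zero_mat_mult_vec)
    qed simp
    then show False using Q0 by simp
  qed
  ultimately have inj: "v = 0\<^sub>v p" if "v \<in> carrier_vec p" "Q *\<^sub>v v = 0\<^sub>v q" for v
    using that by blast
  let ?I = "(\<lambda>v. Q *\<^sub>v v) ` carrier_vec p"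
  have "subspace class_ring ?I (module_vec TYPE(complex) q)"
    unfolding subspace_module_vec_iff
  proof (intro conjI ballI allI)
    show "0\<^sub>v q \<in> ?I" using Q by (intro image_eqI[of _ _ "0\<^sub>v p"]) auto
    fix v w assume "v \<in> ?I" "w \<in> ?I"
    then show "v + w \<in> ?I"
      using mult_add_distrib_mat_vec[OF Q] by (auto simp flip: mult_add_distrib_mat_vec[OF Q])
  next
    fix v :: "complex vec" and c :: complex assume "v \<in> ?I"
    then show "c \<cdot>\<^sub>v v \<in> ?I" by (auto simp flip: mult_mat_vec[OF Q])
  qed (use Q in auto)
  moreover have "\<rho>' x *\<^sub>v v \<in> ?I" if "x \<in> carrier A" "v \<in> ?I" for x v
    using that QR_vec[of x] c[of x] by (auto intro!: imageI simp flip: QR_vec)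
  ultimately have "?I = {0\<^sub>v q} \<or> ?I = carrier_vec q"
    using \<rho>' by (simp add: irreducible_rep_def)
  moreover have "?I \<noteq> {0\<^sub>v q}"
  proof
    assume "?I = {0\<^sub>v q}"
    then have "?K = carrier_vec p" by auto
    then show False using \<open>?K \<noteq> carrier_vec p\<close> by simp
  qed
  ultimately have surj: "?I = carrier_vec q" by simp
  have "\<exists>u. u \<in> carrier_vec p \<and> Q *\<^sub>v u = unit_vec q j" if "j < q" for j
  proof -
    have "unit_vec q j \<in> ?I" unfolding surj by simp
    then show ?thesis by (metis imageE)
  qed
  then obtain u where u: "\<And>j. j < q \<Longrightarrow> u j \<in> carrier_vec p \<and> Q *\<^sub>v u j = unit_vec q j"
    by metis
  define R where "R = mat p q (\<lambda>(i, j). u j $ i)"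
  have R: "R \<in> carrier_mat p q" by (simp add: R_def)
  have Ru: "R *\<^sub>v unit_vec q j = u j" if "j < q" for j
  proof -
    have "dim_vec (u j) = p" using u[OF that] by auto
    then show ?thesis
      using that by (intro eq_vecI) (auto simp: mult_unit_vec_eq_col[OF R] R_def)
  qed
  have QR1: "Q * R = 1\<^sub>m q"
    by (rule mat_eq_if_eq_on_unit_vec[of _ q q]) (use Q R u Ru in \<open>auto simp: assoc_mult_mat_vec[OF Q R]\<close>)
  have RQ1: "R * Q = 1\<^sub>m p"
  proof (rule mat_eq_if_eq_on_unit_vec[of _ p p])
    fix j assume "j < p"
    let ?e = "unit_vec p j :: complex vec"
    have "Q *\<^sub>v (R *\<^sub>v (Q *\<^sub>v ?e)) = Q *\<^sub>v ?e"
      using assoc_mult_mat_vec[OF Q R, of "Q *\<^sub>v ?e"] Q QR1 by simp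
    moreover have "R *\<^sub>v (Q *\<^sub>v ?e) - ?e \<in> carrier_vec p"
      using Q R by (intro minus_carrier_vec mult_mat_vec_carrier[OF R]) auto
    moreover have "Q *\<^sub>v (R *\<^sub>v (Q *\<^sub>v ?e) - ?e) = Q *\<^sub>v (R *\<^sub>v (Q *\<^sub>v ?e)) - Q *\<^sub>v ?e"
      using Q R by (intro mult_minus_distrib_mat_vec) auto
    ultimately have "R *\<^sub>v (Q *\<^sub>v ?e) - ?e = 0\<^sub>v p"
      using inj Q by simp
    then have "R *\<^sub>v (Q *\<^sub>v ?e) = ?e"
      using R by (auto simp: vec_eq_iff)
    then show "R * Q *\<^sub>v ?e = 1\<^sub>m p *\<^sub>v ?e"
      using assoc_mult_mat_vec[OF R Q, of ?e] by simp
  qed (use Q R in auto)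
  have pq: "q = p" using dim_eq_if_inverse_mats[OF Q R QR1 RQ1] .
  have "R * \<rho>' x = \<rho> x * R" if x: "x \<in> carrier A" for x
  proof -
    have "R * \<rho>' x = R * (\<rho>' x * Q) * R"
      using Q R c'[OF x] QR1 by (simp add: assoc_mult_mat[of _ p q _ p _ q] assoc_mult_mat[of _ q q _ p _ q])
    also have "\<dots> = R * Q * \<rho> x * R"
      using Q R c[OF x] by (simp add: QR[OF x, symmetric] assoc_mult_mat[of _ p q _ p _ p])
    also have "\<dots> = \<rho> x * R" using c[OF x] by (simp add: RQ1)
    finally show ?thesis .
  qed
  moreover have "invertible_mat R"
    unfolding invertible_mat_def inverts_mat_def
    using Q R QR1 RQ1 pq by auto
  ultimately show ?thesis
    unfolding isomorphic_reps_def using R pq by auto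
qed

section \<open>Monomial matrices\<close>

text \<open>All matrices of the list send coordinate vectors to multiples of coordinate vectors. Recording
  where (\<open>f\<close>) and with which factor (\<open>\<alpha>\<close>) reduces identities between them to identities between
  index functions and between factors.\<close>

definition monomial_mat :: "nat \<Rightarrow> (nat \<Rightarrow> nat) \<Rightarrow> (nat \<Rightarrow> complex) \<Rightarrow> complex mat" where
  "monomial_mat d f \<alpha> = mat d d (\<lambda>(i, j). if i = f j then \<alpha> j else 0)"

lemma monomial_mat_carrier [simp]: "monomial_mat d f \<alpha> \<in> carrier_mat d d"
  by (simp add: monomial_mat_def)

lemma monomial_mat_dim [simp]:
  "dim_row (monomial_mat d f \<alpha>) = d" "dim_col (monomial_mat d f \<alpha>) = d"
  by (simp_all add: monomial_mat_def)

lemma monomial_mat_index [simp]: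
  "i < d \<Longrightarrow> j < d \<Longrightarrow> monomial_mat d f \<alpha> $$ (i, j) = (if i = f j then \<alpha> j else 0)"
  by (simp add: monomial_mat_def)

lemma monomial_mat_cong:
  assumes "\<And>j. j < d \<Longrightarrow> \<alpha> j = \<beta> j" and "\<And>j. j < d \<Longrightarrow> \<alpha> j \<noteq> 0 \<Longrightarrow> f j = g j"
  shows "monomial_mat d f \<alpha> = monomial_mat d g \<beta>"
proof (rule eq_matI)
  fix i j assume "i < dim_row (monomial_mat d g \<beta>)" "j < dim_col (monomial_mat d g \<beta>)"
  then show "monomial_mat d f \<alpha> $$ (i, j) = monomial_mat d g \<beta> $$ (i, j)"
    using assms[of j] by (cases "\<alpha> j = 0") auto
qed auto

lemma monomial_mat_mult:
  assumes "\<And>j. j < d \<Longrightarrow> g j < d"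
  shows "monomial_mat d f \<alpha> * monomial_mat d g \<beta> = monomial_mat d (f \<circ> g) (\<lambda>j. \<alpha> (g j) * \<beta> j)"
proof (rule eq_matI)
  fix i j
  assume "i < dim_row (monomial_mat d (f \<circ> g) (\<lambda>j. \<alpha> (g j) * \<beta> j))"
    and "j < dim_col (monomial_mat d (f \<circ> g) (\<lambda>j. \<alpha> (g j) * \<beta> j))"
  then have ij: "i < d" "j < d" by auto
  have "(monomial_mat d f \<alpha> * monomial_mat d g \<beta>) $$ (i, j) =
      (\<Sum>r<d. (if i = f r then \<alpha> r else 0) * (if r = g j then \<beta> j else 0))"
    using ij by (auto simp: scalar_prod_def atLeast0LessThan intro!: sum.cong)
  also have "\<dots> = (\<Sum>r<d. if r = g j then (if i = f r then \<alpha> r else 0) * \<beta> j else 0)"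
    by (intro sum.cong) auto
  also have "\<dots> = (if i = f (g j) then \<alpha> (g j) else 0) * \<beta> j"
    using assms[OF ij(2)] by simp
  finally show "(monomial_mat d f \<alpha> * monomial_mat d g \<beta>) $$ (i, j) =
      monomial_mat d (f \<circ> g) (\<lambda>j. \<alpha> (g j) * \<beta> j) $$ (i, j)"
    using ij by auto
qed auto

lemma one_mat_eq_monomial: "1\<^sub>m d = monomial_mat d (\<lambda>j. j) (\<lambda>j. 1)"
  by (auto intro!: eq_matI)

lemma zero_mat_eq_monomial: "0\<^sub>m d d = monomial_mat d f (\<lambda>j. 0)"
  by (auto intro!: eq_matI)

lemma monomial_mat_unit_vec:
  assumes "j < d" "f j < d"
  shows "monomial_mat d f \<alpha> *\<^sub>v unit_vec d j = \<alpha> j \<cdot>\<^sub>v unit_vec d (f j)"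
  using assms by (subst mult_unit_vec_eq_col[of _ d]) auto

lemma diag_mult_vec_index:
  assumes "v \<in> carrier_vec d" "i < d"
  shows "(monomial_mat d (\<lambda>j. j) \<alpha> *\<^sub>v v) $ i = \<alpha> i * v $ i"
proof -
  have "(monomial_mat d (\<lambda>j. j) \<alpha> *\<^sub>v v) $ i = (\<Sum>j<d. (if i = j then \<alpha> j else 0) * v $ j)"
    using assms by (auto simp: scalar_prod_def atLeast0LessThan intro!: sum.cong)
  also have "\<dots> = (\<Sum>j<d. if i = j then \<alpha> j * v $ j else 0)"
    by (intro sum.cong) auto
  finally show ?thesis using assms by simp
qed

lemma intertwines_monomial:
  assumes Q: "Q \<in> carrier_mat d p" and M: "M \<in> carrier_mat d d" and f: "\<And>j. j < p \<Longrightarrow> f j < p"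
    and eq: "\<And>j. j < p \<Longrightarrow> M *\<^sub>v (Q *\<^sub>v unit_vec p j) = \<alpha> j \<cdot>\<^sub>v (Q *\<^sub>v unit_vec p (f j))"
  shows "Q * monomial_mat p f \<alpha> = M * Q"
proof (rule mat_eq_if_eq_on_unit_vec[of _ d p])
  fix j assume j: "j < p"
  have "Q * monomial_mat p f \<alpha> *\<^sub>v unit_vec p j = Q *\<^sub>v (monomial_mat p f \<alpha> *\<^sub>v unit_vec p j)"
    using assoc_mult_mat_vec[OF Q monomial_mat_carrier unit_vec_carrier] .
  also have "\<dots> = M *\<^sub>v (Q *\<^sub>v unit_vec p j)"
    using j f[OF j] by (simp add: monomial_mat_unit_vec mult_mat_vec[OF Q] eq)
  also have "\<dots> = M * Q *\<^sub>v unit_vec p j"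
    using assoc_mult_mat_vec[OF M Q unit_vec_carrier] by simp
  finally show "Q * monomial_mat p f \<alpha> *\<^sub>v unit_vec p j = M * Q *\<^sub>v unit_vec p j" .
qed (use Q M in auto)

lemma diag_pow: "monomial_mat d (\<lambda>j. j) \<alpha> ^\<^sub>m k = monomial_mat d (\<lambda>j. j) (\<lambda>j. \<alpha> j ^ k)"
  by (induction k) (auto simp: one_mat_eq_monomial monomial_mat_mult comp_def)

section \<open>Eigenvectors of matrices of finite order\<close>

lemma omega_pow_eq_cis: "omega n ^ k = cis (2 * pi * real k / real n)"
proof -
  have "omega n = cis (2 * pi / real n)"
    by (simp add: omega_def cis_conv_exp mult_ac)
  then show ?thesis by (simp add: DeMoivre mult_ac)
qed

lemma omega_nonzero [simp]: "omega n \<noteq> 0"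
  by (simp add: omega_def)

lemma omega_pow_n: "n > 0 \<Longrightarrow> omega n ^ n = 1"
  by (simp add: omega_pow_eq_cis)

lemma omega_pow_inject:
  assumes "j < n" "k < n" "omega n ^ j = omega n ^ k"
  shows "j = k"
  using bij_betw_roots_unity[of n] assms
  by (auto simp: omega_pow_eq_cis bij_betw_def dest: inj_onD)

lemma omega_2: "omega 2 = -1"
  by (simp add: omega_def)

text \<open>Fourier inversion on the cyclic group generated by \<open>A\<close>: a vector fixed by \<open>A ^\<^sub>m N\<close> is the sum of
  its components in the eigenspaces of the \<open>N\<close>-th roots of unity, and each component is a
  combination of the iterates \<open>A ^\<^sub>m t *\<^sub>v w\<close>, hence stays in every \<open>A\<close>-invariant subspace containing \<open>w\<close>.
  Working inside a subspace allows the lemma to be iterated for commuting matrices.\<close>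

lemma cyclic_eigenvector:
  assumes A: "A \<in> carrier_mat d d" and N: "N > 0"
    and W: "subspace class_ring W (module_vec TYPE(complex) d)"
    and AW: "\<And>v. v \<in> W \<Longrightarrow> A *\<^sub>v v \<in> W"
    and w: "w \<in> W" "w \<noteq> 0\<^sub>v d" and order: "A ^\<^sub>m N *\<^sub>v w = w"
  obtains j v where "j < N" "v \<in> W" "v \<noteq> 0\<^sub>v d" "A *\<^sub>v v = omega N ^ j \<cdot>\<^sub>v v"
proof -
  have W': "W \<subseteq> carrier_vec d" "0\<^sub>v d \<in> W" "\<And>v w. v \<in> W \<Longrightarrow> w \<in> W \<Longrightarrow> v + w \<in> W"
    "\<And>c v. v \<in> W \<Longrightarrow> c \<cdot>\<^sub>v v \<in> W"
    using W by (auto simp: subspace_module_vec_iff)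
  have wc: "w \<in> carrier_vec d" using w W' by auto
  let ?z = "inverse (omega N)"
  define u where "u t = A ^\<^sub>m t *\<^sub>v w" for t
  have u0: "u 0 = w" using A wc by (simp add: u_def)
  have uN: "u N = w" using order by (simp add: u_def)
  have uSuc: "u (Suc t) = A *\<^sub>v u t" for t
    using pow_mat_mult_add[OF A, of 1 t] A wc assoc_mult_mat_vec[of A d d "A ^\<^sub>m t" d w]
    by (simp add: u_def)
  have uW: "u t \<in> W" for t
    by (induction t) (auto simp: u0 uSuc w AW)
  then have uc: "u t \<in> carrier_vec d" for t using W' by auto
  \<comment> \<open>Up to the factor \<open>N\<close>, the vector \<open>s j N\<close> is the component of \<open>w\<close> in the eigenspace
    of \<open>omega N ^ j\<close>; these components add up to \<open>w\<close>.\<close>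
  define s where "s j M = vec d (\<lambda>i. \<Sum>t<M. ?z ^ (j * t) * u t $ i)" for j M
  have s0: "s j 0 = 0\<^sub>v d" for j by (auto simp: s_def)
  have sSuc: "s j (Suc M) = s j M + ?z ^ (j * M) \<cdot>\<^sub>v u M" for j M
    using uc[of M] by (auto simp: s_def)
  have sW: "s j M \<in> W" for j M
    by (induction M) (auto simp: s0 sSuc W' uW)
  then have sc: "s j M \<in> carrier_vec d" for j M using W' by auto
  \<comment> \<open>Applying \<open>A\<close> shifts the partial sum by one index; the two boundary terms cancel for \<open>M = N\<close>.\<close>
  have shift: "A *\<^sub>v s j M + omega N ^ j \<cdot>\<^sub>v w = omega N ^ j \<cdot>\<^sub>v s j M + omega N ^ j \<cdot>\<^sub>v (?z ^ (j * M) \<cdot>\<^sub>v u M)" for j M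
  proof (induction M)
    case 0
    have "c \<cdot>\<^sub>v 0\<^sub>v d = 0\<^sub>v d" for c :: complex by auto
    then show ?case using A wc by (simp add: s0 u0 mult_mat_zero_vec)
  next
    case (Suc M)
    have "A *\<^sub>v s j (Suc M) = A *\<^sub>v s j M + ?z ^ (j * M) \<cdot>\<^sub>v u (Suc M)"
      using A sc[of j M] uc[of M] uSuc[of M]
      by (simp add: sSuc mult_add_distrib_mat_vec mult_mat_vec)
    moreover have "omega N ^ j * ?z ^ (j * Suc M) = ?z ^ (j * M)"
      by (simp add: power_add power_inverse field_simps)
    ultimately show ?case
      using Suc sc[of j M] uc[of M] uc[of "Suc M"] wc A mult_mat_vec_carrier[OF A sc[of j M]]
      by (simp add: vec_eq_iff sSuc smult_smult_assoc del: index_mult_mat_vec)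
        (simp add: algebra_simps del: index_mult_mat_vec)
  qed
  have eig: "A *\<^sub>v s j N = omega N ^ j \<cdot>\<^sub>v s j N" for j
  proof -
    have "?z ^ (j * N) = 1"
      using omega_pow_n[OF N] by (simp add: power_inverse mult.commute[of j] power_mult)
    then have "A *\<^sub>v s j N + omega N ^ j \<cdot>\<^sub>v w = omega N ^ j \<cdot>\<^sub>v s j N + omega N ^ j \<cdot>\<^sub>v w"
      using shift[of j N] by (simp add: uN)
    then show ?thesis
      using A sc[of j N] wc mult_mat_vec_carrier[OF A sc[of j N]]
      by (simp add: vec_eq_iff del: index_mult_mat_vec)
  qed
  have "\<exists>j<N. s j N \<noteq> 0\<^sub>v d"
  proof (rule ccontr)
    assume "\<not> ?thesis"
    then have zero: "s j N $ i = 0" if "j < N" "i < d" for i j using that by auto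
    have roots: "(\<Sum>j<N. ?z ^ (j * t)) = (if t = 0 then of_nat N else 0)" if "t < N" for t
    proof (cases "t = 0")
      case False
      have "?z ^ t \<noteq> 1"
        using omega_pow_inject[of t N 0] that N False by (auto simp: power_inverse)
      moreover have "(?z ^ t) ^ N = 1"
        using omega_pow_n[OF N]
        by (simp add: power_inverse power_mult[symmetric] mult.commute[of t]) (simp add: power_mult)
      ultimately have "(\<Sum>j<N. (?z ^ t) ^ j) = 0"
        by (simp add: sum_gp_strict)
      then show ?thesis using False by (simp add: power_mult[symmetric] mult.commute)
    qed simp
    have "w $ i = 0" if i: "i < d" for i
    proof -
      have "0 = (\<Sum>j<N. s j N $ i)" using i by (simp add: zero)
      also have "\<dots> = (\<Sum>t<N. (\<Sum>j<N. ?z ^ (j * t)) * u t $ i)"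
        using i by (simp add: s_def sum_distrib_right) (rule sum.swap)
      also have "\<dots> = (\<Sum>t<N. if t = 0 then of_nat N * u t $ i else 0)"
        by (intro sum.cong) (auto simp: roots)
      also have "\<dots> = of_nat N * w $ i" using N by (simp add: u0)
      finally show "w $ i = 0" using N by simp
    qed
    then show False using w wc by (auto simp: vec_eq_iff)
  qed
  then show ?thesis using that eig sW by blast
qed

section \<open>Generators and relations for the dihedral group\<close>

text \<open>The conjugates of \<open>g\<close> by \<open>\<sigma>\<close> and by \<open>\<tau>\<close>. As \<open>\<tau> \<sigma>\<^sup>-\<^sup>1 = \<sigma> \<tau>\<close>, conjugation by \<open>\<sigma>\<close> moves the reflection
  \<open>\<sigma>\<^sup>i \<tau>\<close> by two steps, so for even \<open>n\<close> reflections with even and with odd \<open>i\<close> are not conjugate.\<close>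

definition sigma_conj :: "nat \<Rightarrow> nat \<times> bool \<Rightarrow> nat \<times> bool" where
  "sigma_conj n = (\<lambda>(i, s). (if s then (i + 2) mod n else i, s))"

definition tau_conj :: "nat \<Rightarrow> nat \<times> bool \<Rightarrow> nat \<times> bool" where
  "tau_conj n = (\<lambda>(i, s). ((n - i) mod n, s))"

lemma finite_dihedral [simp]: "finite (carrier (dihedral n))"
  by (simp add: dihedral_simps)

lemma dih_generators_in_carrier:
  assumes "n > 0"
  shows "dih_sigma n \<in> carrier (dihedral n)" "dih_tau n \<in> carrier (dihedral n)"
  using assms by (auto simp: dih_sigma_def dih_tau_def dihedral_simps)

lemma conj_in_carrier:
  assumes "n > 0" "g \<in> carrier (dihedral n)"
  shows "sigma_conj n g \<in> carrier (dihedral n)" "tau_conj n g \<in> carrier (dihedral n)"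
  using assms by (auto simp: sigma_conj_def tau_conj_def dihedral_simps)

lemma sigma_conj_mult:
  assumes "n > 0" "g \<in> carrier (dihedral n)"
  shows "sigma_conj n g \<otimes>\<^bsub>dihedral n\<^esub> dih_sigma n = dih_sigma n \<otimes>\<^bsub>dihedral n\<^esub> g"
proof -
  obtain i s where g: "g = (i, s)" "i < n" using assms by (auto simp: dihedral_simps)
  have "((i + 2) mod n + (n - 1 mod n)) mod n = (1 mod n + i) mod n"
  proof (cases "n = 1")
    case False
    then have "n > 1" using assms by simp
    then have "((i + 2) mod n + (n - 1 mod n)) mod n = ((i + 2) + (n - 1)) mod n"
      using mod_add_left_eq[of "i + 2" n "n - 1"] by simp
    also have "(i + 2) + (n - 1) = (1 + i) + n" using \<open>n > 1\<close> by simp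
    also have "\<dots> mod n = (1 + i) mod n" by (rule mod_add_self2)
    finally show ?thesis using \<open>n > 1\<close> by simp
  qed simp
  then show ?thesis using g
    by (cases s) (simp_all add: sigma_conj_def dih_sigma_def dihedral_simps add.commute)
qed

lemma tau_conj_mult:
  assumes "n > 0" "g \<in> carrier (dihedral n)"
  shows "tau_conj n g \<otimes>\<^bsub>dihedral n\<^esub> dih_tau n = dih_tau n \<otimes>\<^bsub>dihedral n\<^esub> g"
proof -
  obtain i s where g: "g = (i, s)" "i < n" using assms by (auto simp: dihedral_simps)
  then show ?thesis
    by (cases s) (simp_all add: tau_conj_def dih_tau_def dihedral_simps)
qed

lemma inv_conj:
  assumes "n > 0" "g \<in> carrier (dihedral n)"
  shows "inv\<^bsub>dihedral n\<^esub> dih_sigma n \<otimes>\<^bsub>dihedral n\<^esub> sigma_conj n g \<otimes>\<^bsub>dihedral n\<^esub> dih_sigma n = g"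
    and "inv\<^bsub>dihedral n\<^esub> dih_tau n \<otimes>\<^bsub>dihedral n\<^esub> tau_conj n g \<otimes>\<^bsub>dihedral n\<^esub> dih_tau n = g"
proof -
  interpret group "dihedral n" using assms by (rule_tac group_dihedral)
  note c = dih_generators_in_carrier[OF assms(1)] conj_in_carrier[OF assms]
  show "inv\<^bsub>dihedral n\<^esub> dih_sigma n \<otimes>\<^bsub>dihedral n\<^esub> sigma_conj n g \<otimes>\<^bsub>dihedral n\<^esub> dih_sigma n = g"
    using c assms by (simp add: m_assoc sigma_conj_mult) (simp add: m_assoc[symmetric])
  show "inv\<^bsub>dihedral n\<^esub> dih_tau n \<otimes>\<^bsub>dihedral n\<^esub> tau_conj n g \<otimes>\<^bsub>dihedral n\<^esub> dih_tau n = g"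
    using c assms by (simp add: m_assoc tau_conj_mult) (simp add: m_assoc[symmetric])
qed

lemma quantum_double_dihedral_induct:
  assumes n: "n > 0" and x: "x \<in> carrier (quantum_double (dihedral n))"
    and add: "\<And>x y. x \<in> carrier (quantum_double (dihedral n)) \<Longrightarrow>
        y \<in> carrier (quantum_double (dihedral n)) \<Longrightarrow>
        Q x \<Longrightarrow> Q y \<Longrightarrow> Q (x \<oplus>\<^bsub>quantum_double (dihedral n)\<^esub> y)"
    and smult: "\<And>c x. x \<in> carrier (quantum_double (dihedral n)) \<Longrightarrow> Q x \<Longrightarrow>
        Q (c \<odot>\<^bsub>quantum_double (dihedral n)\<^esub> x)"
    and mult: "\<And>x y. x \<in> carrier (quantum_double (dihedral n)) \<Longrightarrow>
        y \<in> carrier (quantum_double (dihedral n)) \<Longrightarrow>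
        Q x \<Longrightarrow> Q y \<Longrightarrow> Q (x \<otimes>\<^bsub>quantum_double (dihedral n)\<^esub> y)"
    and sigma: "Q (qd_group (dihedral n) (dih_sigma n))"
    and tau: "Q (qd_group (dihedral n) (dih_tau n))"
    and dual: "\<And>h. h \<in> carrier (dihedral n) \<Longrightarrow> Q (qd_dual (dihedral n) h)"
  shows "Q x"
proof (rule quantum_double_induct[OF group_dihedral[OF n] finite_dihedral x add smult mult _ dual])
  interpret group "dihedral n" by (rule group_dihedral[OF n])
  note c = dih_generators_in_carrier[OF n]
  have prod: "Q (qd_group (dihedral n) (g \<otimes>\<^bsub>dihedral n\<^esub> h))"
    if "Q (qd_group (dihedral n) g)" "Q (qd_group (dihedral n) h)"
      "g \<in> carrier (dihedral n)" "h \<in> carrier (dihedral n)" for g h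
    using mult[OF _ _ that(1,2)] that(3,4)
    by (simp add: quantum_double_relations(1)[OF is_group] qd_group_in_carrier)
  have "dih_tau n \<otimes>\<^bsub>dihedral n\<^esub> dih_tau n = \<one>\<^bsub>dihedral n\<^esub>"
    using n by (simp add: dih_tau_def dihedral_simps)
  then have one: "Q (qd_group (dihedral n) \<one>\<^bsub>dihedral n\<^esub>)"
    using prod[OF tau tau] c by simp
  have pow: "Q (qd_group (dihedral n) (dih_sigma n [^]\<^bsub>dihedral n\<^esub> i))" for i :: nat
    by (induction i) (auto intro!: one prod sigma simp: c)
  fix g assume g: "g \<in> carrier (dihedral n)"
  then obtain i s where "g = (i, s)" "i < n" by (auto simp: dihedral_simps)
  then show "Q (qd_group (dihedral n) g)"
    using dihedral_normal_form[of i n] prod[OF pow tau] pow[of i] c by (cases s) auto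
qed

lemma intertwines_if_on_generators:
  assumes n: "n > 0"
    and \<rho>: "matrix_rep (quantum_double (dihedral n)) p \<rho>"
    and \<rho>': "matrix_rep (quantum_double (dihedral n)) q \<rho>'"
    and Q: "Q \<in> carrier_mat q p"
    and sigma: "Q * \<rho> (qd_group (dihedral n) (dih_sigma n)) = \<rho>' (qd_group (dihedral n) (dih_sigma n)) * Q"
    and tau: "Q * \<rho> (qd_group (dihedral n) (dih_tau n)) = \<rho>' (qd_group (dihedral n) (dih_tau n)) * Q"
    and dual: "\<And>h. h \<in> carrier (dihedral n) \<Longrightarrow>
        Q * \<rho> (qd_dual (dihedral n) h) = \<rho>' (qd_dual (dihedral n) h) * Q"
    and x: "x \<in> carrier (quantum_double (dihedral n))"
  shows "Q * \<rho> x = \<rho>' x * Q"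
proof (rule quantum_double_dihedral_induct[OF n x])
  let ?D = "quantum_double (dihedral n)"
  note r = matrix_repD[OF \<rho>] and r' = matrix_repD[OF \<rho>']
  fix x assume x: "x \<in> carrier ?D" and Qx: "Q * \<rho> x = \<rho>' x * Q"
  have "Q * (c \<cdot>\<^sub>m \<rho> x) = c \<cdot>\<^sub>m (Q * \<rho> x)" "(c \<cdot>\<^sub>m \<rho>' x) * Q = c \<cdot>\<^sub>m (\<rho>' x * Q)" for c
    using mult_smult_distrib[OF Q r(1)[OF x]] mult_smult_assoc_mat[OF r'(1)[OF x] Q] by auto
  then show "Q * \<rho> (c \<odot>\<^bsub>?D\<^esub> x) = \<rho>' (c \<odot>\<^bsub>?D\<^esub> x) * Q" for c
    using x Qx by (simp add: r(3) r'(3))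
  fix y assume y: "y \<in> carrier ?D" and Qy: "Q * \<rho> y = \<rho>' y * Q"
  show "Q * \<rho> (x \<oplus>\<^bsub>?D\<^esub> y) = \<rho>' (x \<oplus>\<^bsub>?D\<^esub> y) * Q"
    using x y Qx Qy mult_add_distrib_mat[OF Q r(1)[OF x] r(1)[OF y]]
      add_mult_distrib_mat[OF r'(1)[OF x] r'(1)[OF y] Q] by (simp add: r(2) r'(2))
  have "Q * (\<rho> x * \<rho> y) = Q * \<rho> x * \<rho> y"
    using assoc_mult_mat[OF Q r(1)[OF x] r(1)[OF y]] by simp
  also have "\<dots> = \<rho>' x * (Q * \<rho> y)"
    using assoc_mult_mat[OF r'(1)[OF x] Q r(1)[OF y]] Qx by simp
  also have "\<dots> = \<rho>' x * \<rho>' y * Q"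
    using assoc_mult_mat[OF r'(1)[OF x] r'(1)[OF y] Q] Qy by simp
  finally show "Q * \<rho> (x \<otimes>\<^bsub>?D\<^esub> y) = \<rho>' (x \<otimes>\<^bsub>?D\<^esub> y) * Q"
    using x y by (simp add: r(4) r'(4))
qed (use sigma tau dual in auto)

text \<open>The images of \<open>\<sigma>\<close>, \<open>\<tau>\<close> and of the dual elements, with the relations that characterise a
  representation. The relation \<open>\<tau> \<sigma> = \<sigma>\<^bsup>n-1\<^esup> \<tau>\<close> appears in the form \<open>\<sigma> \<tau> \<sigma> = \<tau>\<close>, which needs no powers,
  and the commutation of dual and group elements is required for the two generators only.\<close>

locale dihedral_system =
  fixes n d :: nat and S T :: "complex mat" and P :: "nat \<times> bool \<Rightarrow> complex mat"
  assumes order_pos: "n > 0"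
    and S: "S \<in> carrier_mat d d" and T: "T \<in> carrier_mat d d"
    and P: "\<And>g. g \<in> carrier (dihedral n) \<Longrightarrow> P g \<in> carrier_mat d d"
    and S_pow_n: "S ^\<^sub>m n = 1\<^sub>m d" and T_sq: "T * T = 1\<^sub>m d" and STS: "S * T * S = T"
    and P_mult: "\<And>g h. g \<in> carrier (dihedral n) \<Longrightarrow> h \<in> carrier (dihedral n) \<Longrightarrow>
        P g * P h = (if g = h then P h else 0\<^sub>m d d)"
    and P_sum: "\<And>i j. i < d \<Longrightarrow> j < d \<Longrightarrow>
        (\<Sum>h\<in>carrier (dihedral n). P h $$ (i, j)) = (if i = j then 1 else 0)"
    and PS: "\<And>g. g \<in> carrier (dihedral n) \<Longrightarrow> P (sigma_conj n g) * S = S * P g"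
    and PT: "\<And>g. g \<in> carrier (dihedral n) \<Longrightarrow> P (tau_conj n g) * T = T * P g"

lemma dihedral_system_of_rep:
  assumes n: "n > 0" and \<rho>: "matrix_rep (quantum_double (dihedral n)) d \<rho>"
  shows "dihedral_system n d (\<rho> (qd_group (dihedral n) (dih_sigma n)))
     (\<rho> (qd_group (dihedral n) (dih_tau n))) (\<lambda>g. \<rho> (qd_dual (dihedral n) g))"
proof -
  let ?G = "dihedral n" and ?D = "quantum_double (dihedral n)"
  interpret group ?G by (rule group_dihedral[OF n])
  note r = matrix_repD[OF \<rho>]
  note c = dih_generators_in_carrier[OF n]
  note rel = quantum_double_relations[OF is_group finite_dihedral]
  have gc: "qd_group ?G g \<in> carrier ?D" if "g \<in> carrier ?G" for g
    using that by (rule qd_group_in_carrier[OF finite_dihedral])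
  have dc: "qd_dual ?G g \<in> carrier ?D" if "g \<in> carrier ?G" for g
    using that by (rule qd_dual_in_carrier[OF is_group])
  have mult: "\<rho> (qd_group ?G g) * \<rho> (qd_group ?G h) = \<rho> (qd_group ?G (g \<otimes>\<^bsub>?G\<^esub> h))"
    if "g \<in> carrier ?G" "h \<in> carrier ?G" for g h
    using r(4)[OF gc[OF that(1)] gc[OF that(2)]] rel(1)[OF that] by simp
  have one: "\<rho> (qd_group ?G \<one>\<^bsub>?G\<^esub>) = 1\<^sub>m d"
    using r(5) by (simp add: quantum_double_simps(2))
  have pow: "\<rho> (qd_group ?G (dih_sigma n)) ^\<^sub>m k = \<rho> (qd_group ?G (dih_sigma n [^]\<^bsub>?G\<^esub> k))" for k :: nat
  proof (induction k)
    case 0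
    then show ?case using r(1)[OF gc[OF c(1)]] by (simp add: one)
  next
    case (Suc k)
    then show ?case using c by (simp add: mult)
  qed
  have cov: "\<rho> (qd_dual ?G h) * \<rho> (qd_group ?G g) =
      \<rho> (qd_group ?G g) * \<rho> (qd_dual ?G (inv\<^bsub>?G\<^esub> g \<otimes>\<^bsub>?G\<^esub> h \<otimes>\<^bsub>?G\<^esub> g))"
    if "g \<in> carrier ?G" "h \<in> carrier ?G" for g h
    using r(4)[OF dc gc, of h g] r(4)[OF gc dc, of g "inv\<^bsub>?G\<^esub> g \<otimes>\<^bsub>?G\<^esub> h \<otimes>\<^bsub>?G\<^esub> g"]
      rel(3)[OF that] that by simp
  have sts: "dih_sigma n \<otimes>\<^bsub>?G\<^esub> dih_tau n \<otimes>\<^bsub>?G\<^esub> dih_sigma n = dih_tau n"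
  proof (cases "n = 1")
    case False
    then have "n > 1" using n by simp
    then show ?thesis using n by (simp add: dih_sigma_def dih_tau_def dihedral_simps)
  qed (simp add: dih_sigma_def dih_tau_def dihedral_simps)
  show ?thesis
  proof
    show "\<rho> (qd_group ?G (dih_sigma n)) ^\<^sub>m n = 1\<^sub>m d"
      using dihedral_relations(1)[OF n] by (simp add: pow one)
    show "\<rho> (qd_group ?G (dih_tau n)) * \<rho> (qd_group ?G (dih_tau n)) = 1\<^sub>m d"
      using dihedral_relations(2)[OF n] c by (simp add: mult one numeral_2_eq_2)
    show "\<rho> (qd_group ?G (dih_sigma n)) * \<rho> (qd_group ?G (dih_tau n)) * \<rho> (qd_group ?G (dih_sigma n))
       = \<rho> (qd_group ?G (dih_tau n))"
      using c by (simp add: mult sts)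
  next
    fix g h assume gh: "g \<in> carrier ?G" "h \<in> carrier ?G"
    show "\<rho> (qd_dual ?G g) * \<rho> (qd_dual ?G h) = (if g = h then \<rho> (qd_dual ?G h) else 0\<^sub>m d d)"
    proof -
      have z: "\<zero>\<^bsub>?D\<^esub> \<in> carrier ?D" by (simp add: quantum_double_simps)
      have "0 \<odot>\<^bsub>?D\<^esub> \<zero>\<^bsub>?D\<^esub> = \<zero>\<^bsub>?D\<^esub>" by (simp add: quantum_double_simps)
      moreover have "0 \<cdot>\<^sub>m \<rho> \<zero>\<^bsub>?D\<^esub> = 0\<^sub>m d d"
        using r(1)[OF z] by (intro eq_matI) auto
      ultimately have "\<rho> \<zero>\<^bsub>?D\<^esub> = 0\<^sub>m d d"
        using r(3)[OF z, of 0] by simp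
      then show ?thesis using r(4)[OF dc dc, of g h] rel(2)[OF gh] gh by auto
    qed
  next
    fix g assume g: "g \<in> carrier ?G"
    show "\<rho> (qd_dual ?G (sigma_conj n g)) * \<rho> (qd_group ?G (dih_sigma n)) =
        \<rho> (qd_group ?G (dih_sigma n)) * \<rho> (qd_dual ?G g)"
      using cov[OF c(1) conj_in_carrier(1)[OF n g]] by (simp add: inv_conj[OF n g])
    show "\<rho> (qd_dual ?G (tau_conj n g)) * \<rho> (qd_group ?G (dih_tau n)) =
        \<rho> (qd_group ?G (dih_tau n)) * \<rho> (qd_dual ?G g)"
      using cov[OF c(2) conj_in_carrier(2)[OF n g]] by (simp add: inv_conj[OF n g])
  next
    fix i j assume "i < d" "j < d"
    then show "(\<Sum>h\<in>carrier ?G. \<rho> (qd_dual ?G h) $$ (i, j)) = (if i = j then 1 else 0)"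
      by (rule matrix_rep_sum_dual[OF finite_dihedral is_group \<rho>])
  qed (use n gc dc c r(1) in auto)
qed

context dihedral_system
begin

lemmas assoc_sq = assoc_mult_mat[of _ d d _ d _ d]

lemma mult_sq [simp]:
  "(A :: complex mat) \<in> carrier_mat d d \<Longrightarrow> B \<in> carrier_mat d d \<Longrightarrow> A * B \<in> carrier_mat d d"
  by (rule mult_carrier_mat)

lemma S_pow: "S ^\<^sub>m k \<in> carrier_mat d d"
  using S by simp

lemma S_pow_add: "S ^\<^sub>m (i + j) = S ^\<^sub>m i * S ^\<^sub>m j"
  by (rule pow_mat_mult_add[OF S])

lemma S_pow_mod: "S ^\<^sub>m (k mod n) = S ^\<^sub>m k"
proof -
  have "S ^\<^sub>m (n * q + r) = S ^\<^sub>m r" for q r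
    by (induction q) (use S in \<open>simp_all add: S_pow_add S_pow_n assoc_sq\<close>)
  from this[of "k div n" "k mod n"] show ?thesis by simp
qed

lemma S_pow_T_S_pow: "S ^\<^sub>m k * T * S ^\<^sub>m k = T"
proof (induction k)
  case (Suc k)
  have "S ^\<^sub>m Suc k * T * S ^\<^sub>m Suc k = S ^\<^sub>m k * S * T * (S * S ^\<^sub>m k)"
    using S_pow_add[of 1 k] S by simp
  also have "\<dots> = S ^\<^sub>m k * (S * T * S) * S ^\<^sub>m k"
    using S T by (simp add: assoc_sq)
  finally show ?case using Suc by (simp add: STS)
qed (use S T in simp)

lemma T_S_pow:
  assumes "j \<le> n" shows "T * S ^\<^sub>m j = S ^\<^sub>m (n - j) * T"
proof -
  have "S ^\<^sub>m (n - j) * T = S ^\<^sub>m (n - j) * (S ^\<^sub>m j * T * S ^\<^sub>m j)"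
    by (simp add: S_pow_T_S_pow)
  also have "\<dots> = S ^\<^sub>m (n - j + j) * T * S ^\<^sub>m j"
    using S T unfolding S_pow_add by (simp add: assoc_sq)
  finally show ?thesis using assms S T by (simp add: S_pow_n)
qed

definition group_op :: "nat \<times> bool \<Rightarrow> complex mat" where
  "group_op = (\<lambda>(i, s). S ^\<^sub>m i * (if s then T else 1\<^sub>m d))"

lemma group_op_carrier: "group_op g \<in> carrier_mat d d"
  using S T by (auto simp: group_op_def split: prod.split)

lemma group_op_mult:
  assumes "g \<in> carrier (dihedral n)" "h \<in> carrier (dihedral n)"
  shows "group_op (g \<otimes>\<^bsub>dihedral n\<^esub> h) = group_op g * group_op h"
proof -
  obtain i s j t where gh: "g = (i, s)" "h = (j, t)" "i < n" "j < n"
    using assms by (auto simp: dihedral_simps)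
  let ?t = "if t then T else 1\<^sub>m d"
  have t: "?t \<in> carrier_mat d d" using T by simp
  show ?thesis
  proof (cases s)
    case False
    have "group_op g * group_op h = S ^\<^sub>m (i + j) * ?t"
      using False gh S t by (simp add: group_op_def S_pow_add assoc_sq del: if_split)
    then show ?thesis using False gh by (simp add: group_op_def dihedral_simps S_pow_mod)
  next
    case True
    have "group_op g * group_op h = S ^\<^sub>m i * (T * S ^\<^sub>m j) * ?t"
      using True gh S T t by (simp add: group_op_def assoc_sq del: if_split)
    also have "\<dots> = S ^\<^sub>m i * S ^\<^sub>m (n - j) * (T * ?t)"
      using gh S T t T_S_pow[of j] by (simp add: assoc_sq del: if_split)
    also have "\<dots> = S ^\<^sub>m (i + (n - j)) * (T * ?t)"
      by (simp only: S_pow_add)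
    also have "T * ?t = (if \<not> t then T else 1\<^sub>m d)"
      using T by (simp add: T_sq)
    finally show ?thesis using True gh by (simp add: group_op_def dihedral_simps S_pow_mod)
  qed
qed

lemma group_op_generators:
  "group_op (dih_sigma n) = S" "group_op (dih_tau n) = T" "group_op \<one>\<^bsub>dihedral n\<^esub> = 1\<^sub>m d"
  using S T S_pow_mod[of 1] by (auto simp: group_op_def dih_sigma_def dih_tau_def dihedral_simps)

text \<open>The group elements for which the commutation relation holds are closed under products and contain
  \<open>\<sigma>\<close> and \<open>\<tau>\<close>.\<close>

lemma P_group_op:
  assumes "g \<in> carrier (dihedral n)" "h \<in> carrier (dihedral n)"
  shows "P h * group_op g = group_op g * P (inv\<^bsub>dihedral n\<^esub> g \<otimes>\<^bsub>dihedral n\<^esub> h \<otimes>\<^bsub>dihedral n\<^esub> g)"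
proof -
  interpret G: group "dihedral n" by (rule group_dihedral[OF order_pos])
  let ?cov = "\<lambda>g. \<forall>h\<in>carrier (dihedral n).
      P h * group_op g = group_op g * P (inv\<^bsub>dihedral n\<^esub> g \<otimes>\<^bsub>dihedral n\<^esub> h \<otimes>\<^bsub>dihedral n\<^esub> g)"
  note c = dih_generators_in_carrier[OF order_pos]
  have conj: "conj (inv\<^bsub>dihedral n\<^esub> k \<otimes>\<^bsub>dihedral n\<^esub> h \<otimes>\<^bsub>dihedral n\<^esub> k) = h"
    if k: "k \<in> carrier (dihedral n)" and h: "h \<in> carrier (dihedral n)"
      and conj: "\<And>g. g \<in> carrier (dihedral n) \<Longrightarrow>
        conj g \<in> carrier (dihedral n) \<and> conj g \<otimes>\<^bsub>dihedral n\<^esub> k = k \<otimes>\<^bsub>dihedral n\<^esub> g" for conj k h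
  proof -
    let ?g = "inv\<^bsub>dihedral n\<^esub> k \<otimes>\<^bsub>dihedral n\<^esub> h \<otimes>\<^bsub>dihedral n\<^esub> k"
    have "conj ?g \<otimes>\<^bsub>dihedral n\<^esub> k = k \<otimes>\<^bsub>dihedral n\<^esub> ?g" "conj ?g \<in> carrier (dihedral n)"
      using conj[of ?g] k h by auto
    moreover have "k \<otimes>\<^bsub>dihedral n\<^esub> ?g = h \<otimes>\<^bsub>dihedral n\<^esub> k"
      using k h by (simp add: G.m_assoc[symmetric])
    ultimately show ?thesis using G.right_cancel k h by metis
  qed
  have sigma: "?cov (dih_sigma n)"
  proof
    fix h assume h: "h \<in> carrier (dihedral n)"
    let ?g = "inv\<^bsub>dihedral n\<^esub> dih_sigma n \<otimes>\<^bsub>dihedral n\<^esub> h \<otimes>\<^bsub>dihedral n\<^esub> dih_sigma n"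
    have "sigma_conj n ?g = h"
      using c h by (intro conj) (auto simp: conj_in_carrier order_pos sigma_conj_mult)
    then show "P h * group_op (dih_sigma n) = group_op (dih_sigma n) * P ?g"
      using PS[of ?g] h c by (simp add: group_op_generators)
  qed
  have tau: "?cov (dih_tau n)"
  proof
    fix h assume h: "h \<in> carrier (dihedral n)"
    let ?g = "inv\<^bsub>dihedral n\<^esub> dih_tau n \<otimes>\<^bsub>dihedral n\<^esub> h \<otimes>\<^bsub>dihedral n\<^esub> dih_tau n"
    have "tau_conj n ?g = h"
      using c h by (intro conj) (auto simp: conj_in_carrier order_pos tau_conj_mult)
    then show "P h * group_op (dih_tau n) = group_op (dih_tau n) * P ?g"
      using PT[of ?g] h c by (simp add: group_op_generators)
  qed
  have prod: "?cov (a \<otimes>\<^bsub>dihedral n\<^esub> b)"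
    if "?cov a" "?cov b" "a \<in> carrier (dihedral n)" "b \<in> carrier (dihedral n)" for a b
  proof
    fix h assume h: "h \<in> carrier (dihedral n)"
    let ?h = "inv\<^bsub>dihedral n\<^esub> a \<otimes>\<^bsub>dihedral n\<^esub> h \<otimes>\<^bsub>dihedral n\<^esub> a"
    let ?k = "inv\<^bsub>dihedral n\<^esub> b \<otimes>\<^bsub>dihedral n\<^esub> ?h \<otimes>\<^bsub>dihedral n\<^esub> b"
    have hk: "?h \<in> carrier (dihedral n)" "?k \<in> carrier (dihedral n)" using that h by auto
    note cc = group_op_carrier[of a] group_op_carrier[of b] P[OF h] P[OF hk(1)] P[OF hk(2)]
    have "P h * group_op (a \<otimes>\<^bsub>dihedral n\<^esub> b) = P h * group_op a * group_op b"
      using that cc by (simp add: group_op_mult assoc_sq)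
    also have "\<dots> = group_op a * (P ?h * group_op b)"
      using that h cc by (simp add: assoc_sq)
    also have "\<dots> = group_op a * group_op b * P ?k"
      using that hk cc by (simp add: assoc_sq)
    also have "?k = inv\<^bsub>dihedral n\<^esub> (a \<otimes>\<^bsub>dihedral n\<^esub> b) \<otimes>\<^bsub>dihedral n\<^esub> h \<otimes>\<^bsub>dihedral n\<^esub> (a \<otimes>\<^bsub>dihedral n\<^esub> b)"
      using that h by (simp add: G.inv_mult_group G.m_assoc)
    finally show "P h * group_op (a \<otimes>\<^bsub>dihedral n\<^esub> b) = group_op (a \<otimes>\<^bsub>dihedral n\<^esub> b) *
        P (inv\<^bsub>dihedral n\<^esub> (a \<otimes>\<^bsub>dihedral n\<^esub> b) \<otimes>\<^bsub>dihedral n\<^esub> h \<otimes>\<^bsub>dihedral n\<^esub> (a \<otimes>\<^bsub>dihedral n\<^esub> b))"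
      using that by (simp add: group_op_mult)
  qed
  have one: "?cov \<one>\<^bsub>dihedral n\<^esub>"
  proof
    fix h assume "h \<in> carrier (dihedral n)"
    then show "P h * group_op \<one>\<^bsub>dihedral n\<^esub> = group_op \<one>\<^bsub>dihedral n\<^esub> *
       P (inv\<^bsub>dihedral n\<^esub> \<one>\<^bsub>dihedral n\<^esub> \<otimes>\<^bsub>dihedral n\<^esub> h \<otimes>\<^bsub>dihedral n\<^esub> \<one>\<^bsub>dihedral n\<^esub>)"
      using P[of h] by (simp add: group_op_generators)
  qed
  have pow: "?cov (dih_sigma n [^]\<^bsub>dihedral n\<^esub> i)" for i :: nat
  proof (induction i)
    case (Suc i)
    show ?case unfolding G.nat_pow_Suc by (rule prod[OF Suc sigma]) (use c in auto)
  qed (use one in simp)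
  obtain i s where g: "g = (i, s)" "i < n" using assms by (auto simp: dihedral_simps)
  have "?cov g"
  proof (cases s)
    case True
    show ?thesis unfolding g(1) using True dihedral_normal_form(2)[OF g(2)]
      prod[OF pow tau, of i] c by simp
  next
    case False
    then show ?thesis unfolding g(1) using dihedral_normal_form(1)[OF g(2)] pow[of i] by simp
  qed
  then show ?thesis using assms by blast
qed

lemma rep_of_dihedral_system:
  obtains \<rho> where "matrix_rep (quantum_double (dihedral n)) d \<rho>"
    and "\<rho> (qd_group (dihedral n) (dih_sigma n)) = S"
    and "\<rho> (qd_group (dihedral n) (dih_tau n)) = T"
    and "\<And>g. g \<in> carrier (dihedral n) \<Longrightarrow> \<rho> (qd_dual (dihedral n) g) = P g"
proof -
  obtain \<rho> where "matrix_rep (quantum_double (dihedral n)) d \<rho>"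
    and "\<And>g. g \<in> carrier (dihedral n) \<Longrightarrow> \<rho> (qd_group (dihedral n) g) = group_op g"
    and "\<And>g. g \<in> carrier (dihedral n) \<Longrightarrow> \<rho> (qd_dual (dihedral n) g) = P g"
    by (rule matrix_rep_of_system[OF group_dihedral[OF order_pos] finite_dihedral, of group_op d P])
      (use group_op_carrier group_op_generators group_op_mult P P_mult P_sum P_group_op in auto)
  then show ?thesis
    using that[of \<rho>] dih_generators_in_carrier[OF order_pos] by (simp add: group_op_generators)
qed

end

section \<open>The listed matrices are monomial\<close>

text \<open>In each listed representation the coordinate vectors are homogeneous: exactly one dual element fixes
  the \<open>j\<close>-th of them, that of \<open>label_degree n l j\<close>, and the others annihilate it. Coordinates are
  numbered from 0 here, so the signs of the displayed matrices sit in row 0.\<close>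

fun label_degree :: "nat \<Rightarrow> irrep_label \<Rightarrow> nat \<Rightarrow> nat \<times> bool" where
  "label_degree n (Id_One a b) j = (0, False)"
| "label_degree n (Id_Two k) j = (0, False)"
| "label_degree n (Mid_One a b) j = (n div 2, False)"
| "label_degree n (Mid_Two k) j = (n div 2, False)"
| "label_degree n (Rot i k) j = (if j = 0 then k else n - k, False)"
| "label_degree n (Refl_Even a b) j = (2 * j, True)"
| "label_degree n (Refl_Odd a b) j = (2 * j + 1, True)"

fun sigma_pos :: "nat \<Rightarrow> irrep_label \<Rightarrow> nat \<Rightarrow> nat" where
  "sigma_pos n (Refl_Even a b) j = (if Suc j = n div 2 then 0 else Suc j)"
| "sigma_pos n (Refl_Odd a b) j = (if Suc j = n div 2 then 0 else Suc j)"
| "sigma_pos n _ j = j"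

fun sigma_coef :: "nat \<Rightarrow> irrep_label \<Rightarrow> nat \<Rightarrow> complex" where
  "sigma_coef n (Id_One a b) j = (-1) ^ a"
| "sigma_coef n (Id_Two k) j = (if j = 0 then omega n ^ k else inverse (omega n ^ k))"
| "sigma_coef n (Mid_One a b) j = (-1) ^ a"
| "sigma_coef n (Mid_Two k) j = (if j = 0 then omega n ^ k else inverse (omega n ^ k))"
| "sigma_coef n (Rot i k) j = (if j = 0 then omega n ^ i else inverse (omega n ^ i))"
| "sigma_coef n (Refl_Even a b) j = (if Suc j = n div 2 then (-1) ^ a else 1)"
| "sigma_coef n (Refl_Odd a b) j = (if Suc j = n div 2 then (-1) ^ a else 1)"

fun tau_pos :: "nat \<Rightarrow> irrep_label \<Rightarrow> nat \<Rightarrow> nat" where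
  "tau_pos n (Id_One a b) j = j"
| "tau_pos n (Mid_One a b) j = j"
| "tau_pos n (Refl_Even a b) j = (if j = 0 then 0 else n div 2 - j)"
| "tau_pos n (Refl_Odd a b) j = n div 2 - Suc j"
| "tau_pos n _ j = 1 - j"

fun tau_coef :: "nat \<Rightarrow> irrep_label \<Rightarrow> nat \<Rightarrow> complex" where
  "tau_coef n (Id_One a b) j = (-1) ^ b"
| "tau_coef n (Mid_One a b) j = (-1) ^ b"
| "tau_coef n (Refl_Even a b) j = (-1) ^ (a + b) * (if j = 0 then (-1) ^ a else 1)"
| "tau_coef n (Refl_Odd a b) j = (-1) ^ (a + b)"
| "tau_coef n _ j = 1"

definition degree_proj :: "nat \<Rightarrow> irrep_label \<Rightarrow> nat \<times> bool \<Rightarrow> complex mat" where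
  "degree_proj n l g =
     monomial_mat (label_dim n l) (\<lambda>j. j) (\<lambda>j. if label_degree n l j = g then 1 else 0)"

lemma irrep_label_cases [consumes 1, case_names Id_One Id_Two Mid_One Mid_Two Rot Refl_Even Refl_Odd]:
  assumes "l \<in> irrep_labels n"
  obtains a b where "l = Id_One a b" "a \<in> {0, 1}" "b \<in> {0, 1}"
  | k where "l = Id_Two k" "1 \<le> k" "k < n div 2"
  | a b where "l = Mid_One a b" "a \<in> {0, 1}" "b \<in> {0, 1}"
  | k where "l = Mid_Two k" "1 \<le> k" "k < n div 2"
  | i k where "l = Rot i k" "i < n" "1 \<le> k" "k < n div 2"
  | a b where "l = Refl_Even a b" "a \<in> {0, 1}" "b \<in> {0, 1}"
  | a b where "l = Refl_Odd a b" "a \<in> {0, 1}" "b \<in> {0, 1}"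
  using assms
  unfolding irrep_labels_def one_dim_labels_def half_dim_labels_def two_dim_labels_def by blast

lemma rot_mat_eq_monomial:
  "rot_mat n k = monomial_mat 2 (\<lambda>j. j) (\<lambda>j. if j = 0 then omega n ^ k else inverse (omega n ^ k))"
  by (intro eq_matI)
    (auto simp: rot_mat_def mat_of_rows_list_def less_2_cases_iff power_int_minus)

lemma swap_mat_eq_monomial: "swap_mat = monomial_mat 2 (\<lambda>j. 1 - j) (\<lambda>j. 1)"
  by (intro eq_matI) (auto simp: swap_mat_def mat_of_rows_list_def less_2_cases_iff)

lemma scalar_mat_eq_monomial: "c \<cdot>\<^sub>m 1\<^sub>m d = monomial_mat d (\<lambda>j. j) (\<lambda>j. c)"
  by (intro eq_matI) auto

lemma elem_mat_eq_monomial: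
  "elem_mat d (Suc i) (Suc i) = monomial_mat d (\<lambda>j. j) (\<lambda>j. if j = i then 1 else 0)"
  by (intro eq_matI) (auto simp: elem_mat_def mat1_def delta_def)

lemma smult_monomial_mat: "c \<cdot>\<^sub>m monomial_mat d f \<alpha> = monomial_mat d f (\<lambda>j. c * \<alpha> j)"
  by (intro eq_matI) auto

lemma dvd_less_double_iff:
  assumes "x < 2 * (m :: nat)" shows "m dvd x \<longleftrightarrow> x = 0 \<or> x = m"
proof
  assume "m dvd x"
  then obtain q where "x = m * q" by auto
  then show "x = 0 \<or> x = m" using assms by (cases q; cases "q - 1") auto
qed auto

lemma minus_one_power_cancel:
  "(-1) ^ k * (-1) ^ k = (1::complex)" "(-1) ^ k * ((-1) ^ k * x) = (x::complex)"
proof -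
  show "(-1) ^ k * (-1) ^ k = (1::complex)" by (simp flip: power_mult_distrib)
  then show "(-1) ^ k * ((-1) ^ k * x) = (x::complex)" by (simp flip: mult.assoc)
qed

locale even_dihedral =
  fixes n m :: nat
  assumes n_eq: "n = 2 * m" and m_pos: "m > 0"
begin

lemma n_pos: "n > 0" using n_eq m_pos by simp

lemma half_n [simp]: "n div 2 = m" using n_eq by simp

lemma A_mat_eq_monomial:
  "A_mat m a = monomial_mat m (\<lambda>j. if Suc j = m then 0 else Suc j)
     (\<lambda>j. if Suc j = m then (-1) ^ a else 1)"
proof (rule eq_matI)
  fix i j
  assume "i < dim_row (monomial_mat m (\<lambda>j. if Suc j = m then 0 else Suc j)
     (\<lambda>j. if Suc j = m then (-1) ^ a else 1))"
    and "j < dim_col (monomial_mat m (\<lambda>j. if Suc j = m then 0 else Suc j)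
     (\<lambda>j. if Suc j = m then (-1) ^ a else 1))"
  then have ij: "i < m" "j < m" by auto
  have row: "Suc i mod m = 1 mod m \<longleftrightarrow> i = 0"
    using mod_eq_dvd_iff_nat[of 1 "Suc i" m] dvd_less_double_iff[of i m] ij by auto
  have pos: "Suc i mod m = (Suc j + 1) mod m \<longleftrightarrow> i = (if Suc j = m then 0 else Suc j)"
  proof (cases "Suc j = m")
    case True
    then have "(Suc j + 1) mod m = 1 mod m" by (simp only: mod_add_self1)
    then show ?thesis using row True by simp
  next
    case False
    consider "i \<ge> Suc j" | "i < Suc j" by linarith
    then show ?thesis
    proof cases
      case 1
      then show ?thesis
        using mod_eq_dvd_iff_nat[of "Suc j + 1" "Suc i" m] dvd_less_double_iff[of "i - Suc j" m] ij False
        by auto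
    next
      case 2
      then show ?thesis
        using mod_eq_dvd_iff_nat[of "Suc i" "Suc j + 1" m] dvd_less_double_iff[of "Suc j - i" m] ij False
        by auto
    qed
  qed
  show "A_mat m a $$ (i, j) = monomial_mat m (\<lambda>j. if Suc j = m then 0 else Suc j)
     (\<lambda>j. if Suc j = m then (-1) ^ a else 1) $$ (i, j)"
  proof -
    have "A_mat m a $$ (i, j) =
        (if Suc i mod m = 1 mod m then (-1) ^ a else 1) * delta (Suc i mod m) ((Suc j + 1) mod m)"
      using ij by (simp add: A_mat_def mat1_def)
    also have "\<dots> = (if i = 0 then (-1) ^ a else 1) * (if i = (if Suc j = m then 0 else Suc j) then 1 else 0)"
      by (simp only: row pos delta_def)
    finally show ?thesis using ij by simp
  qed
qed (auto simp: A_mat_def mat1_def)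

lemma B_even_mat_eq_monomial:
  "B_even_mat m a = monomial_mat m (\<lambda>j. if j = 0 then 0 else m - j) (\<lambda>j. if j = 0 then (-1) ^ a else 1)"
proof (rule eq_matI)
  fix i j
  assume "i < dim_row (monomial_mat m (\<lambda>j. if j = 0 then 0 else m - j) (\<lambda>j. if j = 0 then (-1) ^ a else 1))"
    and "j < dim_col (monomial_mat m (\<lambda>j. if j = 0 then 0 else m - j) (\<lambda>j. if j = 0 then (-1) ^ a else 1))"
  then have ij: "i < m" "j < m" by auto
  have row: "Suc i mod m = 1 mod m \<longleftrightarrow> i = 0"
    using mod_eq_dvd_iff_nat[of 1 "Suc i" m] dvd_less_double_iff[of i m] ij by auto
  have pos: "(Suc i + Suc j) mod m = 2 mod m \<longleftrightarrow> i = (if j = 0 then 0 else m - j)"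
    using mod_eq_dvd_iff_nat[of 2 "Suc i + Suc j" m] dvd_less_double_iff[of "i + j" m] ij by auto
  show "B_even_mat m a $$ (i, j) =
      monomial_mat m (\<lambda>j. if j = 0 then 0 else m - j) (\<lambda>j. if j = 0 then (-1) ^ a else 1) $$ (i, j)"
  proof -
    have "B_even_mat m a $$ (i, j) =
        (if Suc i mod m = 1 mod m then (-1) ^ a else 1) * delta ((Suc i + Suc j) mod m) (2 mod m)"
      using ij by (simp add: B_even_mat_def mat1_def)
    also have "\<dots> = (if i = 0 then (-1) ^ a else 1) * (if i = (if j = 0 then 0 else m - j) then 1 else 0)"
      by (simp only: row pos delta_def)
    finally show ?thesis using ij by simp
  qed
qed (auto simp: B_even_mat_def mat1_def)

lemma B_odd_mat_eq_monomial: "B_odd_mat m = monomial_mat m (\<lambda>j. m - Suc j) (\<lambda>j. 1)"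
proof (rule eq_matI)
  fix i j
  assume "i < dim_row (monomial_mat m (\<lambda>j. m - Suc j) (\<lambda>j. 1))"
    and "j < dim_col (monomial_mat m (\<lambda>j. m - Suc j) (\<lambda>j. 1))"
  then have ij: "i < m" "j < m" by auto
  have pos: "(Suc i + Suc j) mod m = (m + 1) mod m \<longleftrightarrow> i = m - Suc j"
  proof -
    have "(Suc i + Suc j) mod m = (m + 1) mod m \<longleftrightarrow> (Suc i + Suc j) mod m = 1 mod m"
      by (simp only: mod_add_self1)
    also have "\<dots> \<longleftrightarrow> m dvd Suc (i + j)"
      using mod_eq_dvd_iff_nat[of 1 "Suc i + Suc j" m] by (simp del: One_nat_def)
    also have "\<dots> \<longleftrightarrow> i = m - Suc j"
      using dvd_less_double_iff[of "Suc (i + j)" m] ij by auto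
    finally show ?thesis .
  qed
  show "B_odd_mat m $$ (i, j) = monomial_mat m (\<lambda>j. m - Suc j) (\<lambda>j. 1) $$ (i, j)"
  proof -
    have "B_odd_mat m $$ (i, j) = delta ((Suc i + Suc j) mod m) ((m + 1) mod m)"
      using ij by (simp add: B_odd_mat_def mat1_def)
    also have "\<dots> = (if i = m - Suc j then 1 else 0)"
      by (simp only: pos delta_def)
    finally show ?thesis using ij by simp
  qed
qed (auto simp: B_odd_mat_def mat1_def)

lemma label_sigma_eq_monomial:
  "label_sigma n l = monomial_mat (label_dim n l) (sigma_pos n l) (sigma_coef n l)"
  by (cases l) (auto simp: scalar_mat_eq_monomial rot_mat_eq_monomial A_mat_eq_monomial
      intro!: monomial_mat_cong)

lemma label_tau_eq_monomial:
  "label_tau n l = monomial_mat (label_dim n l) (tau_pos n l) (tau_coef n l)"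
  by (cases l) (auto simp: scalar_mat_eq_monomial swap_mat_eq_monomial B_even_mat_eq_monomial
      B_odd_mat_eq_monomial smult_monomial_mat intro!: monomial_mat_cong)

lemma inv_dih_sigma_pow:
  assumes "1 \<le> k" "k < n"
  shows "inv\<^bsub>dihedral n\<^esub> (k, False) = (n - k, False)"
proof -
  interpret group "dihedral n" by (rule group_dihedral[OF n_pos])
  show ?thesis
    using assms by (intro inv_equality) (auto simp: dihedral_simps)
qed

text \<open>The prescriptions for the dual elements, which the list words differently for each family, all say
  that they act as the projections onto the homogeneous coordinates.\<close>

lemma label_dual_iff:
  assumes "l \<in> irrep_labels n"
  shows "label_dual n l P \<longleftrightarrow> (\<forall>g\<in>carrier (dihedral n). P g = degree_proj n l g)"
proof -
  have delta_eq: "delta g h = (if h = g then 1 else 0)" for g h :: "nat \<times> bool"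
    by (auto simp: delta_def)
  have pow: "dih_sigma n [^]\<^bsub>dihedral n\<^esub> i = (i, False)" if "i < n" for i
    using that by (simp add: dih_sigma_pow n_pos)
  have powt: "(i, False) \<otimes>\<^bsub>dihedral n\<^esub> dih_tau n = (i, True)" if "i < n" for i
    using that by (simp add: dih_tau_def dihedral_simps)
  have double_less: "2 * j < n" "2 * j + 1 < n" if "j < m" for j using that n_eq by auto
  have m_less: "m < n" using n_eq m_pos by simp
  have refl: "(\<forall>g\<in>carrier (dihedral n). P g = D g) \<longleftrightarrow>
      (\<forall>i<n. P (i, False) = D (i, False)) \<and>
      (\<forall>j<m. P (2 * j, True) = D (2 * j, True) \<and> P (2 * j + 1, True) = D (2 * j + 1, True))"
    for D
  proof (intro iffI conjI allI impI ballI; (elim conjE)?)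
    fix g assume even: "\<forall>i<n. P (i, False) = D (i, False)"
      and odd: "\<forall>j<m. P (2 * j, True) = D (2 * j, True) \<and> P (2 * j + 1, True) = D (2 * j + 1, True)"
      and "g \<in> carrier (dihedral n)"
    then obtain i s where g: "g = (i, s)" "i < n" by (auto simp: dihedral_simps)
    have "i div 2 < m" using g n_eq by simp
    moreover have "i = 2 * (i div 2) \<or> i = 2 * (i div 2) + 1" by presburger
    ultimately show "P g = D g" using even odd g by (cases s) metis+
  qed (use n_eq in \<open>auto simp: dihedral_simps\<close>)
  show ?thesis
    using assms
  proof (cases rule: irrep_label_cases)
    case (Rot i k)
    have k: "k < n" "n - k < n" "k \<noteq> n - k" using Rot n_eq by auto
    have in_G: "(k, False) \<in> carrier (dihedral n)" "(n - k, False) \<in> carrier (dihedral n)"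
      using k by (auto simp: dihedral_simps)
    have D: "degree_proj n l (k, False) = elem_mat 2 1 1"
      "degree_proj n l (n - k, False) = elem_mat 2 2 2"
      using k Rot elem_mat_eq_monomial[of 2 0] elem_mat_eq_monomial[of 2 1]
      by (auto simp: degree_proj_def numeral_2_eq_2 intro!: monomial_mat_cong)
    have D0: "degree_proj n l g = 0\<^sub>m 2 2" if "g \<noteq> (k, False)" "g \<noteq> (n - k, False)" for g
      using that Rot zero_mat_eq_monomial[of 2 "\<lambda>j. j"]
      by (auto simp: degree_proj_def intro!: monomial_mat_cong)
    have "label_dual n l P \<longleftrightarrow> P (k, False) = elem_mat 2 1 1 \<and> P (n - k, False) = elem_mat 2 2 2 \<and>
        (\<forall>g\<in>carrier (dihedral n) - {(k, False), (n - k, False)}. P g = 0\<^sub>m 2 2)"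
      using Rot k by (simp add: pow inv_dih_sigma_pow Let_def)
    also have "\<dots> \<longleftrightarrow> (\<forall>g\<in>carrier (dihedral n). P g = degree_proj n l g)"
    proof (intro iffI ballI conjI)
      fix g assume P: "P (k, False) = elem_mat 2 1 1 \<and> P (n - k, False) = elem_mat 2 2 2 \<and>
        (\<forall>g\<in>carrier (dihedral n) - {(k, False), (n - k, False)}. P g = 0\<^sub>m 2 2)"
        and "g \<in> carrier (dihedral n)"
      then show "P g = degree_proj n l g"
        by (cases "g = (k, False) \<or> g = (n - k, False)") (use D D0 in auto)
    qed (use D D0 in_G in auto)
    finally show ?thesis .
  next
    case (Refl_Even a b)
    have D: "degree_proj n l (i, False) = 0\<^sub>m m m" "degree_proj n l (2 * j, True) = elem_mat m (j + 1) (j + 1)"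
      "degree_proj n l (2 * j + 1, True) = 0\<^sub>m m m" for i j
      using Refl_Even zero_mat_eq_monomial[of m "\<lambda>j. j"]
      by (auto simp: degree_proj_def elem_mat_eq_monomial intro!: monomial_mat_cong) presburger+
    show ?thesis
      unfolding refl[of "degree_proj n l"] D using Refl_Even
      by (simp only: label_dual.simps half_n pow powt double_less cong: imp_cong)
  next
    case (Refl_Odd a b)
    have D: "degree_proj n l (i, False) = 0\<^sub>m m m" "degree_proj n l (2 * j, True) = 0\<^sub>m m m"
      "degree_proj n l (2 * j + 1, True) = elem_mat m (j + 1) (j + 1)" for i j
      using Refl_Odd zero_mat_eq_monomial[of m "\<lambda>j. j"]
      by (auto simp: degree_proj_def elem_mat_eq_monomial intro!: monomial_mat_cong) presburger+
    show ?thesis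
      unfolding refl[of "degree_proj n l"] D using Refl_Odd
      by (simp only: label_dual.simps half_n pow powt double_less cong: imp_cong)
  qed (simp_all add: degree_proj_def scalar_mat_eq_monomial delta_eq pow m_less dihedral_simps(3))
qed

lemma label_dim_pos: "label_dim n l > 0"
  using m_pos by (cases l) auto

lemma label_pos_less:
  assumes "j < label_dim n l"
  shows "sigma_pos n l j < label_dim n l" "tau_pos n l j < label_dim n l"
  using assms by (cases l; auto)+

lemma label_degree_in_carrier:
  assumes "l \<in> irrep_labels n" "j < label_dim n l"
  shows "label_degree n l j \<in> carrier (dihedral n)"
  using assms(1) by (cases rule: irrep_label_cases) (use assms(2) n_eq m_pos in \<open>auto simp: dihedral_simps\<close>)

lemma label_degree_conj:
  assumes "l \<in> irrep_labels n" "j < label_dim n l"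
  shows "label_degree n l (sigma_pos n l j) = sigma_conj n (label_degree n l j)"
    and "label_degree n l (tau_pos n l j) = tau_conj n (label_degree n l j)"
proof -
  have r: "(2 * m - Suc (2 * j)) mod (2 * m) = 2 * m - Suc (2 * j)"
    using m_pos by simp
  have s: "Suc (2 * m) mod (2 * m) = 1" using m_pos by (simp add: mod_Suc)
  show "label_degree n l (sigma_pos n l j) = sigma_conj n (label_degree n l j)"
    using assms(1) by (cases rule: irrep_label_cases)
      (use assms(2) n_eq m_pos s in \<open>auto simp: sigma_conj_def less_2_cases_iff\<close>)
  show "label_degree n l (tau_pos n l j) = tau_conj n (label_degree n l j)"
    using assms(1) by (cases rule: irrep_label_cases)
      (use assms(2) n_eq m_pos r in \<open>auto simp: tau_conj_def less_2_cases_iff\<close>)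
qed

lemma label_sigma_tau_sigma:
  "label_sigma n l * label_tau n l * label_sigma n l = label_tau n l"
proof -
  have pos: "sigma_pos n l (tau_pos n l (sigma_pos n l j)) = tau_pos n l j"
    and coef: "sigma_coef n l (tau_pos n l (sigma_pos n l j)) * tau_coef n l (sigma_pos n l j) *
      sigma_coef n l j = tau_coef n l j" if "j < label_dim n l" for j
    using that m_pos by (cases l; auto simp: less_2_cases_iff Suc_diff_Suc power_add
      simp flip: power_mult_distrib)+
  show ?thesis
    unfolding label_sigma_eq_monomial label_tau_eq_monomial
    by (simp add: monomial_mat_mult label_pos_less, rule monomial_mat_cong) (auto simp: pos coef)
qed

lemma label_tau_square:
  "label_tau n l * label_tau n l = 1\<^sub>m (label_dim n l)"
proof -
  have pos: "tau_pos n l (tau_pos n l j) = j"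
    and coef: "tau_coef n l (tau_pos n l j) * tau_coef n l j = 1" if "j < label_dim n l" for j
    using that m_pos by (cases l; auto simp: less_2_cases_iff mult_ac minus_one_power_cancel)+
  show ?thesis
    unfolding label_tau_eq_monomial one_mat_eq_monomial
    by (simp add: monomial_mat_mult label_pos_less, rule monomial_mat_cong) (auto simp: pos coef)
qed

lemma A_pow_unit_vec_0: "k < m \<Longrightarrow> A_mat m a ^\<^sub>m k *\<^sub>v unit_vec m 0 = unit_vec m k"
proof (induction k)
  case (Suc k)
  have A: "A_mat m a \<in> carrier_mat m m" by (simp add: A_mat_def mat1_def)
  have "A_mat m a ^\<^sub>m Suc k *\<^sub>v unit_vec m 0 = A_mat m a *\<^sub>v (A_mat m a ^\<^sub>m k *\<^sub>v unit_vec m 0)"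
    using pow_mat_mult_add[OF A, of 1 k] A by (simp add: assoc_mult_mat_vec[of _ m m _ m])
  also have "\<dots> = unit_vec m (Suc k)"
    using Suc by (simp add: A_mat_eq_monomial monomial_mat_unit_vec)
  finally show ?case .
qed (auto simp: A_mat_def mat1_def)

text \<open>The powers of \<open>A\<close> carry the first coordinate vector through all others, and one full turn
  multiplies it by the sign at the wrap-around. Since \<open>A\<close> commutes with its powers, the same holds
  for every coordinate vector.\<close>

lemma A_pow_m: "A_mat m a ^\<^sub>m m = (-1) ^ a \<cdot>\<^sub>m 1\<^sub>m m"
proof (rule mat_eq_if_eq_on_unit_vec[of _ m m])
  let ?A = "A_mat m a" and ?e = "unit_vec m :: nat \<Rightarrow> complex vec"
  have A: "?A \<in> carrier_mat m m" by (simp add: A_mat_def mat1_def)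
  show "?A ^\<^sub>m m \<in> carrier_mat m m" using A by simp
  have add: "?A ^\<^sub>m i *\<^sub>v (?A ^\<^sub>m j *\<^sub>v v) = ?A ^\<^sub>m (i + j) *\<^sub>v v" if "v \<in> carrier_vec m" for i j v
    using A that by (simp add: pow_mat_mult_add[OF A] assoc_mult_mat_vec[of _ m m _ m])
  obtain r where r: "m = Suc r" using m_pos by (cases m) auto
  have "?A ^\<^sub>m m *\<^sub>v ?e 0 = ?A *\<^sub>v (?A ^\<^sub>m r *\<^sub>v ?e 0)"
    using add[of "?e 0" 1 r] A r by simp
  also have "?A ^\<^sub>m r *\<^sub>v ?e 0 = ?e r"
    using A_pow_unit_vec_0[of r a] r by simp
  also have "?A *\<^sub>v ?e r = (-1) ^ a \<cdot>\<^sub>v ?e 0"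
    unfolding A_mat_eq_monomial by (subst monomial_mat_unit_vec) (use r in auto)
  finally have A0: "?A ^\<^sub>m m *\<^sub>v ?e 0 = (-1) ^ a \<cdot>\<^sub>v ?e 0" .
  fix j assume j: "j < m"
  have "?A ^\<^sub>m m *\<^sub>v ?e j = ?A ^\<^sub>m m *\<^sub>v (?A ^\<^sub>m j *\<^sub>v ?e 0)"
    using j by (simp add: A_pow_unit_vec_0)
  also have "\<dots> = ?A ^\<^sub>m j *\<^sub>v (?A ^\<^sub>m m *\<^sub>v ?e 0)"
    by (simp add: add add.commute)
  also have "\<dots> = (-1) ^ a \<cdot>\<^sub>v ?e j"
    using A j by (simp add: A0 mult_mat_vec[of _ m m] A_pow_unit_vec_0)
  also have "\<dots> = ((-1) ^ a \<cdot>\<^sub>m 1\<^sub>m m) *\<^sub>v ?e j"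
    using j by (simp add: scalar_mat_eq_monomial monomial_mat_unit_vec)
  finally show "?A ^\<^sub>m m *\<^sub>v ?e j = ((-1) ^ a \<cdot>\<^sub>m 1\<^sub>m m) *\<^sub>v ?e j" .
qed simp

lemma label_sigma_pow_n: "label_sigma n l ^\<^sub>m n = 1\<^sub>m (label_dim n l)"
proof -
  have A: "A_mat m a ^\<^sub>m n = 1\<^sub>m m" for a
  proof -
    have "A_mat m a ^\<^sub>m n = A_mat m a ^\<^sub>m m * A_mat m a ^\<^sub>m m"
      by (subst pow_mat_mult_add[symmetric]) (auto simp: n_eq mult_2 A_mat_def mat1_def)
    also have "\<dots> = monomial_mat m (\<lambda>j. j) (\<lambda>j. (-1) ^ a * (-1) ^ a)"
      by (simp add: A_pow_m scalar_mat_eq_monomial monomial_mat_mult comp_def)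
    also have "\<dots> = 1\<^sub>m m"
      by (simp add: one_mat_eq_monomial flip: power_mult_distrib)
    finally show ?thesis .
  qed
  have one: "((-1) ^ a) ^ n = (1::complex)" for a
    by (simp add: n_eq power_mult[symmetric] mult.commute[of a])
  have om: "(omega n ^ k) ^ n = 1" for k
    using omega_pow_n[OF n_pos] by (simp add: power_mult[symmetric] mult.commute[of k]) (simp add: power_mult)
  show ?thesis
    by (cases l) (auto simp: A smult_monomial_mat rot_mat_eq_monomial diag_pow
        one_mat_eq_monomial one om power_inverse intro!: monomial_mat_cong)
qed

lemma dihedral_system_of_label:
  assumes l: "l \<in> irrep_labels n"
  shows "dihedral_system n (label_dim n l) (label_sigma n l) (label_tau n l) (degree_proj n l)"
proof
  note mono = label_sigma_eq_monomial label_tau_eq_monomial degree_proj_def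
  show "label_sigma n l \<in> carrier_mat (label_dim n l) (label_dim n l)"
    "label_tau n l \<in> carrier_mat (label_dim n l) (label_dim n l)"
    "\<And>g. degree_proj n l g \<in> carrier_mat (label_dim n l) (label_dim n l)"
    by (auto simp: mono)
  fix g h assume gh: "g \<in> carrier (dihedral n)" "h \<in> carrier (dihedral n)"
  show "degree_proj n l g * degree_proj n l h =
      (if g = h then degree_proj n l h else 0\<^sub>m (label_dim n l) (label_dim n l))"
    by (auto simp: mono monomial_mat_mult comp_def zero_mat_eq_monomial[of _ "\<lambda>j. j"]
        intro!: monomial_mat_cong)
next
  fix i j assume ij: "i < label_dim n l" "j < label_dim n l"
  have "(\<Sum>h\<in>carrier (dihedral n). degree_proj n l h $$ (i, j)) =
      (\<Sum>h\<in>carrier (dihedral n). if h = label_degree n l j then (if i = j then 1 else 0) else 0)"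
    using ij by (intro sum.cong) (auto simp: degree_proj_def)
  then show "(\<Sum>h\<in>carrier (dihedral n). degree_proj n l h $$ (i, j)) = (if i = j then 1 else 0)"
    using label_degree_in_carrier[OF l ij(2)] by simp
next
  have inj: "sigma_conj n g = sigma_conj n h \<longleftrightarrow> g = h" "tau_conj n g = tau_conj n h \<longleftrightarrow> g = h"
    if "g \<in> carrier (dihedral n)" "h \<in> carrier (dihedral n)" for g h
    using inv_conj[OF n_pos that(1)] inv_conj[OF n_pos that(2)] by metis+
  fix g assume g: "g \<in> carrier (dihedral n)"
  note mono = label_sigma_eq_monomial label_tau_eq_monomial degree_proj_def
  show "degree_proj n l (sigma_conj n g) * label_sigma n l = label_sigma n l * degree_proj n l g"
    unfolding mono using l label_degree_in_carrier[OF l] g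
    by (simp add: monomial_mat_mult label_pos_less, intro monomial_mat_cong)
      (auto simp: label_degree_conj inj)
  show "degree_proj n l (tau_conj n g) * label_tau n l = label_tau n l * degree_proj n l g"
    unfolding mono using l label_degree_in_carrier[OF l] g
    by (simp add: monomial_mat_mult label_pos_less, intro monomial_mat_cong)
      (auto simp: label_degree_conj inj)
qed (use n_pos l in \<open>auto simp: label_sigma_pow_n label_tau_square label_sigma_tau_sigma\<close>)

lemma listed_rep_iff:
  assumes "l \<in> irrep_labels n"
  shows "listed_rep n l \<rho> \<longleftrightarrow>
     matrix_rep (quantum_double (dihedral n)) (label_dim n l) \<rho> \<and>
     \<rho> (qd_group (dihedral n) (dih_sigma n)) = label_sigma n l \<and>
     \<rho> (qd_group (dihedral n) (dih_tau n)) = label_tau n l \<and>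
     (\<forall>g\<in>carrier (dihedral n). \<rho> (qd_dual (dihedral n) g) = degree_proj n l g)"
  unfolding listed_rep_def label_dual_iff[OF assms] ..

lemma listed_rep_exists:
  assumes "l \<in> irrep_labels n"
  shows "\<exists>\<rho>. listed_rep n l \<rho>"
proof -
  interpret dihedral_system n "label_dim n l" "label_sigma n l" "label_tau n l" "degree_proj n l"
    by (rule dihedral_system_of_label[OF assms])
  show ?thesis
    by (rule rep_of_dihedral_system) (auto simp: listed_rep_iff[OF assms])
qed

end

section \<open>Weight vectors\<close>

text \<open>The conditions that the first coordinate vector of the listed representation satisfies under the
  centraliser of its degree. For a non-central rotation the centraliser is generated by \<open>\<sigma>\<close>, for the
  reflections \<open>\<tau>\<close> and \<open>\<sigma> \<tau>\<close> by \<open>\<sigma>\<^bsup>n/2\<^esup>\<close> and the reflection itself. For a central rotation it is the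
  whole group, whose two-dimensional representations are recognised by an eigenvector of \<open>\<sigma>\<close>.\<close>

fun weight_equations :: "nat \<Rightarrow> complex mat \<Rightarrow> complex mat \<Rightarrow> irrep_label \<Rightarrow> complex vec \<Rightarrow> bool" where
  "weight_equations n S T (Id_One a b) v \<longleftrightarrow> S *\<^sub>v v = (-1) ^ a \<cdot>\<^sub>v v \<and> T *\<^sub>v v = (-1) ^ b \<cdot>\<^sub>v v"
| "weight_equations n S T (Id_Two k) v \<longleftrightarrow> S *\<^sub>v v = omega n ^ k \<cdot>\<^sub>v v"
| "weight_equations n S T (Mid_One a b) v \<longleftrightarrow> S *\<^sub>v v = (-1) ^ a \<cdot>\<^sub>v v \<and> T *\<^sub>v v = (-1) ^ b \<cdot>\<^sub>v v"
| "weight_equations n S T (Mid_Two k) v \<longleftrightarrow> S *\<^sub>v v = omega n ^ k \<cdot>\<^sub>v v"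
| "weight_equations n S T (Rot i k) v \<longleftrightarrow> S *\<^sub>v v = omega n ^ i \<cdot>\<^sub>v v"
| "weight_equations n S T (Refl_Even a b) v \<longleftrightarrow>
     S ^\<^sub>m (n div 2) *\<^sub>v v = (-1) ^ a \<cdot>\<^sub>v v \<and> T *\<^sub>v v = (-1) ^ b \<cdot>\<^sub>v v"
| "weight_equations n S T (Refl_Odd a b) v \<longleftrightarrow>
     S ^\<^sub>m (n div 2) *\<^sub>v v = (-1) ^ a \<cdot>\<^sub>v v \<and> S *\<^sub>v (T *\<^sub>v v) = (-1) ^ b \<cdot>\<^sub>v v"

definition weight_vector ::
  "nat \<Rightarrow> nat \<Rightarrow> complex mat \<Rightarrow> complex mat \<Rightarrow> (nat \<times> bool \<Rightarrow> complex mat) \<Rightarrow>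
    irrep_label \<Rightarrow> complex vec \<Rightarrow> bool" where
  "weight_vector n d S T P l v \<longleftrightarrow>
     v \<in> carrier_vec d \<and> v \<noteq> 0\<^sub>v d \<and> P (label_degree n l 0) *\<^sub>v v = v \<and> weight_equations n S T l v"

lemma weight_vector_intertwine:
  assumes Q: "Q \<in> carrier_mat q p" and S: "S \<in> carrier_mat p p" and S': "S' \<in> carrier_mat q q"
    and T: "T \<in> carrier_mat p p" and T': "T' \<in> carrier_mat q q"
    and P: "P (label_degree n l 0) \<in> carrier_mat p p" and P': "P' (label_degree n l 0) \<in> carrier_mat q q"
    and QS: "Q * S = S' * Q" and QT: "Q * T = T' * Q"
    and QP: "Q * P (label_degree n l 0) = P' (label_degree n l 0) * Q"
    and v: "weight_vector n p S T P l v" and nz: "Q *\<^sub>v v \<noteq> 0\<^sub>v q"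
  shows "weight_vector n q S' T' P' l (Q *\<^sub>v v)"
proof -
  have vc: "v \<in> carrier_vec p" using v by (simp add: weight_vector_def)
  have tr: "B *\<^sub>v (Q *\<^sub>v w) = Q *\<^sub>v (A *\<^sub>v w)"
    if "Q * A = B * Q" "A \<in> carrier_mat p p" "B \<in> carrier_mat q q" "w \<in> carrier_vec p" for A B w
    using assoc_mult_mat_vec[OF that(3) Q that(4)] assoc_mult_mat_vec[OF Q that(2,4)] that(1) by simp
  have Tv: "T *\<^sub>v v \<in> carrier_vec p" using T vc by simp
  have S_pow: "S ^\<^sub>m k \<in> carrier_mat p p" "S' ^\<^sub>m k \<in> carrier_mat q q" for k using S S' by auto
  have "weight_equations n S' T' l (Q *\<^sub>v v)"
    using v
    by (cases l) (simp_all add: weight_vector_def tr[OF QS S S'] tr[OF QT T T'] vc Tv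
        tr[OF intertwines_pow[OF Q S S' QS] S_pow] mult_mat_vec[OF Q])
  then show ?thesis
    using v nz Q vc tr[OF QP P P' vc] by (simp add: weight_vector_def)
qed

text \<open>The vectors that have to correspond to the coordinate vectors of the listed representation once
  \<open>v\<close> corresponds to the first.\<close>

definition weight_orbit :: "irrep_label \<Rightarrow> complex mat \<Rightarrow> complex mat \<Rightarrow> complex vec \<Rightarrow> nat \<Rightarrow> complex vec" where
  "weight_orbit l S T v j = (case l of
      Refl_Even a b \<Rightarrow> S ^\<^sub>m j *\<^sub>v v
    | Refl_Odd a b \<Rightarrow> S ^\<^sub>m j *\<^sub>v v
    | _ \<Rightarrow> if j = 0 then v else T *\<^sub>v v)"

locale even_dihedral_system = dihedral_system n d S T P + even_dihedral n m
  for n d :: nat and S T :: "complex mat" and P :: "nat \<times> bool \<Rightarrow> complex mat" and m :: nat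
begin

definition homogeneous :: "nat \<times> bool \<Rightarrow> complex vec \<Rightarrow> bool" where
  "homogeneous g v \<longleftrightarrow> g \<in> carrier (dihedral n) \<and> v \<in> carrier_vec d \<and> P g *\<^sub>v v = v"

lemma S_vec [simp]: "v \<in> carrier_vec d \<Longrightarrow> S *\<^sub>v v \<in> carrier_vec d"
  and T_vec [simp]: "v \<in> carrier_vec d \<Longrightarrow> T *\<^sub>v v \<in> carrier_vec d"
  and S_pow_vec [simp]: "v \<in> carrier_vec d \<Longrightarrow> S ^\<^sub>m k *\<^sub>v v \<in> carrier_vec d"
  by (simp_all add: mult_mat_vec_carrier[OF S] mult_mat_vec_carrier[OF T] mult_mat_vec_carrier[OF S_pow])

lemma T_T_vec [simp]: "v \<in> carrier_vec d \<Longrightarrow> T *\<^sub>v (T *\<^sub>v v) = v"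
  using mat_mult_vec_assoc[OF T T, of v] by (simp add: T_sq)

lemma S_T_S_vec: "v \<in> carrier_vec d \<Longrightarrow> S *\<^sub>v (T *\<^sub>v (S *\<^sub>v v)) = T *\<^sub>v v"
  using S T STS by (metis S_vec mat_mult_vec_assoc mult_sq)

lemma S_pow_add_vec: "v \<in> carrier_vec d \<Longrightarrow> S ^\<^sub>m i *\<^sub>v (S ^\<^sub>m j *\<^sub>v v) = S ^\<^sub>m (i + j) *\<^sub>v v"
  by (simp add: S_pow_add mat_mult_vec_assoc[OF S_pow S_pow])

lemma S_pow_1: "S ^\<^sub>m 1 = S" using S by simp

lemma S_S_pow_vec: "v \<in> carrier_vec d \<Longrightarrow> S *\<^sub>v (S ^\<^sub>m j *\<^sub>v v) = S ^\<^sub>m Suc j *\<^sub>v v"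
  using S_pow_add_vec[of v 1 j] by (simp only: S_pow_1) simp

lemma S_pow_0_vec [simp]: "v \<in> carrier_vec d \<Longrightarrow> S ^\<^sub>m 0 *\<^sub>v v = v"
  using S by simp

lemma T_S_pow_vec:
  "v \<in> carrier_vec d \<Longrightarrow> j \<le> n \<Longrightarrow> T *\<^sub>v (S ^\<^sub>m j *\<^sub>v v) = S ^\<^sub>m (n - j) *\<^sub>v (T *\<^sub>v v)"
  using T_S_pow[of j] by (metis S_pow T mat_mult_vec_assoc)

lemma S_pow_nonzero:
  assumes "v \<in> carrier_vec d" "v \<noteq> 0\<^sub>v d" shows "S ^\<^sub>m k *\<^sub>v v \<noteq> 0\<^sub>v d"
proof
  assume "S ^\<^sub>m k *\<^sub>v v = 0\<^sub>v d"
  moreover have "S ^\<^sub>m k *\<^sub>v (T *\<^sub>v (S ^\<^sub>m k *\<^sub>v v)) = T *\<^sub>v v"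
    using S_pow_T_S_pow[of k] assms S_pow T by (metis S_pow_vec mat_mult_vec_assoc mult_sq)
  ultimately have "T *\<^sub>v v = 0\<^sub>v d"
    by (simp add: mult_mat_zero_vec[OF T] mult_mat_zero_vec[OF S_pow])
  then have "T *\<^sub>v (T *\<^sub>v v) = 0\<^sub>v d" by (simp add: mult_mat_zero_vec[OF T])
  then show False using assms by simp
qed

lemma T_nonzero:
  assumes "v \<in> carrier_vec d" "v \<noteq> 0\<^sub>v d" shows "T *\<^sub>v v \<noteq> 0\<^sub>v d"
  using assms T_T_vec[of v] mult_mat_zero_vec[OF T] by metis

lemma S_T_eigen:
  assumes v: "v \<in> carrier_vec d" and "S *\<^sub>v v = c \<cdot>\<^sub>v v" "c \<noteq> 0"
  shows "S *\<^sub>v (T *\<^sub>v v) = inverse c \<cdot>\<^sub>v (T *\<^sub>v v)"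
proof -
  have "T *\<^sub>v v = c \<cdot>\<^sub>v (S *\<^sub>v (T *\<^sub>v v))"
    using S_T_S_vec[OF v] assms by (simp add: mult_mat_vec[OF T] mult_mat_vec[OF S])
  then have "inverse c \<cdot>\<^sub>v (T *\<^sub>v v) = inverse c \<cdot>\<^sub>v (c \<cdot>\<^sub>v (S *\<^sub>v (T *\<^sub>v v)))" by simp
  then show ?thesis using assms(3) by (simp add: smult_smult_assoc)
qed

lemma homogeneousD:
  assumes "homogeneous g v"
  shows "g \<in> carrier (dihedral n)" "v \<in> carrier_vec d" "P g *\<^sub>v v = v"
  using assms by (auto simp: homogeneous_def)

lemma homogeneous_S: "homogeneous g v \<Longrightarrow> homogeneous (sigma_conj n g) (S *\<^sub>v v)"
  using PS[of g] conj_in_carrier[OF order_pos, of g] P S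
  unfolding homogeneous_def by (metis S_vec mat_mult_vec_assoc)

lemma homogeneous_T: "homogeneous g v \<Longrightarrow> homogeneous (tau_conj n g) (T *\<^sub>v v)"
  using PT[of g] conj_in_carrier[OF order_pos, of g] P T
  unfolding homogeneous_def by (metis T_vec mat_mult_vec_assoc)

lemma homogeneous_S_pow:
  assumes "homogeneous (i, True) v"
  shows "homogeneous ((i + 2 * k) mod n, True) (S ^\<^sub>m k *\<^sub>v v)"
proof (induction k)
  case 0
  have "i < n" using homogeneousD(1)[OF assms] by (auto simp: dihedral_simps)
  then show ?case using assms homogeneousD(2)[OF assms] by (simp del: pow_mat.simps)
next
  case (Suc k)
  have "((i + 2 * k) mod n + 2) mod n = (i + 2 * Suc k) mod n"
    using mod_add_left_eq[of "i + 2 * k" n 2] by simp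
  then show ?case
    using homogeneous_S[OF Suc] homogeneousD(2)[OF assms]
    by (simp add: sigma_conj_def S_S_pow_vec del: pow_mat.simps)
qed

lemma homogeneous_proj:
  assumes "homogeneous g v" "h \<in> carrier (dihedral n)"
  shows "P h *\<^sub>v v = (if h = g then v else 0\<^sub>v d)"
proof -
  note g = homogeneousD[OF assms(1)]
  have "P h *\<^sub>v v = P h * P g *\<^sub>v v"
    using mat_mult_vec_assoc[OF P[OF assms(2)] P[OF g(1)] g(2)] g(3) by simp
  then show ?thesis using g assms(2) by (simp add: P_mult zero_mat_mult_vec)
qed

lemma weight_vectorD:
  assumes "l \<in> irrep_labels n" "weight_vector n d S T P l v"
  shows "homogeneous (label_degree n l 0) v" "v \<in> carrier_vec d" "v \<noteq> 0\<^sub>v d" "weight_equations n S T l v"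
  using assms label_degree_in_carrier[OF assms(1) label_dim_pos]
  by (auto simp: weight_vector_def homogeneous_def)

lemma weight_orbit_homogeneous:
  assumes l: "l \<in> irrep_labels n" and v: "weight_vector n d S T P l v" and j: "j < label_dim n l"
  shows "homogeneous (label_degree n l j) (weight_orbit l S T v j)"
proof -
  note w = weight_vectorD[OF l v]
  note conj = label_degree_conj[OF l label_dim_pos]
  have T1: "homogeneous (label_degree n l (tau_pos n l 0)) (T *\<^sub>v v)"
    using homogeneous_T[OF w(1)] by (simp add: conj)
  have even: "homogeneous (2 * j, True) (S ^\<^sub>m j *\<^sub>v v)" if "j < m" "homogeneous (0, True) v" for j
    using homogeneous_S_pow[OF that(2), of j] that(1) n_eq by simp
  have odd: "homogeneous (Suc (2 * j), True) (S ^\<^sub>m j *\<^sub>v v)" if "j < m" "homogeneous (Suc 0, True) v" for j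
    using homogeneous_S_pow[OF that(2), of j] that(1) n_eq by simp
  show ?thesis
    using l w(1) T1 j
    by (cases rule: irrep_label_cases) (auto simp: weight_orbit_def less_2_cases_iff intro: even odd)
qed

lemma weight_orbit_S:
  assumes l: "l \<in> irrep_labels n" and v: "weight_vector n d S T P l v" and j: "j < label_dim n l"
  shows "S *\<^sub>v weight_orbit l S T v j = sigma_coef n l j \<cdot>\<^sub>v weight_orbit l S T v (sigma_pos n l j)"
proof -
  note w = weight_vectorD[OF l v]
  have refl: "S *\<^sub>v (S ^\<^sub>m j *\<^sub>v v) = (if Suc j = m then (-1) ^ a else 1) \<cdot>\<^sub>v (S ^\<^sub>m (if Suc j = m then 0 else Suc j) *\<^sub>v v)"
    if "S ^\<^sub>m m *\<^sub>v v = (-1) ^ a \<cdot>\<^sub>v v" for a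
    using w(2) that by (auto simp: S_S_pow_vec simp del: pow_mat.simps)
  have rot: "S *\<^sub>v (T *\<^sub>v v) = inverse (omega n ^ k) \<cdot>\<^sub>v (T *\<^sub>v v)" if "S *\<^sub>v v = omega n ^ k \<cdot>\<^sub>v v" for k
    using S_T_eigen[OF w(2) that] by simp
  show ?thesis
    using l
    by (cases rule: irrep_label_cases)
      (use w(4) j rot refl in \<open>auto simp: weight_orbit_def less_2_cases_iff simp del: pow_mat.simps\<close>)
qed

text \<open>Moving \<open>T\<close> past \<open>S ^\<^sub>m j\<close> produces exponents between \<open>m\<close> and \<open>n\<close>; reducing them below \<open>m\<close> costs the
  sign by which \<open>S ^\<^sub>m m\<close> acts on \<open>v\<close>, and this is the sign in the matrices for \<open>\<tau>\<close>.\<close>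

lemma weight_orbit_T:
  assumes l: "l \<in> irrep_labels n" and v: "weight_vector n d S T P l v" and j: "j < label_dim n l"
  shows "T *\<^sub>v weight_orbit l S T v j = tau_coef n l j \<cdot>\<^sub>v weight_orbit l S T v (tau_pos n l j)"
proof -
  note w = weight_vectorD[OF l v]
  have half: "S ^\<^sub>m (k + m) *\<^sub>v v = (-1) ^ a \<cdot>\<^sub>v (S ^\<^sub>m k *\<^sub>v v)" if "S ^\<^sub>m m *\<^sub>v v = (-1) ^ a \<cdot>\<^sub>v v" for a k
    using w(2) that by (simp add: S_pow_add_vec[symmetric] mult_mat_vec[OF S_pow])
  have even: "T *\<^sub>v (S ^\<^sub>m j *\<^sub>v v) = (-1) ^ (a + b) * (if j = 0 then (-1) ^ a else 1) \<cdot>\<^sub>v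
      (S ^\<^sub>m (if j = 0 then 0 else m - j) *\<^sub>v v)"
    if "S ^\<^sub>m m *\<^sub>v v = (-1) ^ a \<cdot>\<^sub>v v" "T *\<^sub>v v = (-1) ^ b \<cdot>\<^sub>v v" "j < m" for a b
  proof (cases "j = 0")
    case True
    then show ?thesis using w(2) that by (simp add: power_add mult_ac minus_one_power_cancel del: pow_mat.simps)
  next
    case False
    have "T *\<^sub>v (S ^\<^sub>m j *\<^sub>v v) = S ^\<^sub>m (n - j) *\<^sub>v (T *\<^sub>v v)"
      using w(2) that(3) n_eq by (intro T_S_pow_vec) auto
    also have "\<dots> = (-1) ^ b \<cdot>\<^sub>v (S ^\<^sub>m ((m - j) + m) *\<^sub>v v)"
      using w(2) that n_eq by (simp add: mult_mat_vec[OF S_pow] mult_2)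
    also have "\<dots> = (-1) ^ (a + b) \<cdot>\<^sub>v (S ^\<^sub>m (m - j) *\<^sub>v v)"
      by (simp add: half[OF that(1)] smult_smult_assoc power_add mult.commute)
    finally show ?thesis using False by simp
  qed
  have odd: "T *\<^sub>v (S ^\<^sub>m j *\<^sub>v v) = (-1) ^ (a + b) \<cdot>\<^sub>v (S ^\<^sub>m (m - Suc j) *\<^sub>v v)"
    if "S ^\<^sub>m m *\<^sub>v v = (-1) ^ a \<cdot>\<^sub>v v" "S *\<^sub>v (T *\<^sub>v v) = (-1) ^ b \<cdot>\<^sub>v v" "j < m" for a b
  proof -
    have "T *\<^sub>v (S ^\<^sub>m j *\<^sub>v v) = S ^\<^sub>m (n - j) *\<^sub>v (T *\<^sub>v v)"
      using w(2) that(3) n_eq by (intro T_S_pow_vec) auto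
    also have "n - j = (n - Suc j) + 1" using that(3) n_eq by simp
    also have "S ^\<^sub>m (n - Suc j + 1) *\<^sub>v (T *\<^sub>v v) = S ^\<^sub>m (n - Suc j) *\<^sub>v (S *\<^sub>v (T *\<^sub>v v))"
      using w(2) by (simp only: S_pow_add_vec[symmetric] T_vec S_pow_1)
    also have "\<dots> = (-1) ^ b \<cdot>\<^sub>v (S ^\<^sub>m ((m - Suc j) + m) *\<^sub>v v)"
      using w(2) that n_eq by (simp add: mult_mat_vec[OF S_pow] mult_2)
    also have "\<dots> = (-1) ^ (a + b) \<cdot>\<^sub>v (S ^\<^sub>m (m - Suc j) *\<^sub>v v)"
      by (simp add: half[OF that(1)] smult_smult_assoc power_add mult.commute)
    finally show ?thesis .
  qed
  show ?thesis
    using l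
    by (cases rule: irrep_label_cases)
      (use w(2,4) j even odd in \<open>auto simp: weight_orbit_def less_2_cases_iff simp del: pow_mat.simps\<close>)
qed

text \<open>The intertwiner has the orbit of the weight vector as its columns. It is nonzero because the first
  column is \<open>v\<close>.\<close>

lemma weight_vector_intertwiner:
  assumes l: "l \<in> irrep_labels n" and v: "weight_vector n d S T P l v"
  obtains Q where "Q \<in> carrier_mat d (label_dim n l)" "Q \<noteq> 0\<^sub>m d (label_dim n l)"
    "Q * label_sigma n l = S * Q" "Q * label_tau n l = T * Q"
    "\<forall>g\<in>carrier (dihedral n). Q * degree_proj n l g = P g * Q"
proof -
  let ?p = "label_dim n l"
  let ?u = "weight_orbit l S T v"
  define Q where "Q = mat d ?p (\<lambda>(i, j). ?u j $ i)"
  have Q: "Q \<in> carrier_mat d ?p" by (simp add: Q_def)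
  have u: "?u j \<in> carrier_vec d" if "j < ?p" for j
    using weight_orbit_homogeneous[OF l v that] by (rule homogeneousD)
  have Qu: "Q *\<^sub>v unit_vec ?p j = ?u j" if "j < ?p" for j
  proof -
    have "dim_vec (?u j) = d" using u[OF that] by auto
    then show ?thesis
      using that by (intro eq_vecI) (auto simp: mult_unit_vec_eq_col[OF Q] Q_def)
  qed
  show ?thesis
  proof (rule that[OF Q])
    show "Q \<noteq> 0\<^sub>m d ?p"
    proof
      assume "Q = 0\<^sub>m d ?p"
      then have "?u 0 = 0\<^sub>v d"
        using Qu[OF label_dim_pos] by (simp add: zero_mat_mult_vec)
      then show False
        using weight_vectorD[OF l v] S by (auto simp: weight_orbit_def split: irrep_label.splits)
    qed
    show "Q * label_sigma n l = S * Q"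
      unfolding label_sigma_eq_monomial
      by (rule intertwines_monomial[OF Q S]) (simp_all add: label_pos_less Qu weight_orbit_S[OF l v])
    show "Q * label_tau n l = T * Q"
      unfolding label_tau_eq_monomial
      by (rule intertwines_monomial[OF Q T]) (simp_all add: label_pos_less Qu weight_orbit_T[OF l v])
    have zero: "0 \<cdot>\<^sub>v ?u j = 0\<^sub>v d" if "j < ?p" for j using u[OF that] by (auto simp: vec_eq_iff)
    show "\<forall>g\<in>carrier (dihedral n). Q * degree_proj n l g = P g * Q"
    proof
      fix g assume g: "g \<in> carrier (dihedral n)"
      show "Q * degree_proj n l g = P g * Q"
        unfolding degree_proj_def
        by (rule intertwines_monomial[OF Q P[OF g]])
          (auto simp: Qu zero homogeneous_proj[OF weight_orbit_homogeneous[OF l v] g])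
    qed
  qed
qed

end

section \<open>Every representation contains a weight vector\<close>

context even_dihedral
begin

lemma omega_pow_m: "omega n ^ m = -1"
proof -
  have "(omega n ^ m)\<^sup>2 = 1"
    using omega_pow_n[OF n_pos] n_eq by (simp add: power_mult[symmetric] mult.commute)
  moreover have "omega n ^ m \<noteq> 1"
    using omega_pow_inject[of m n 0] n_eq m_pos by auto
  ultimately show ?thesis by (auto simp: power2_eq_1_iff)
qed

lemma inverse_omega_pow: "k \<le> n \<Longrightarrow> inverse (omega n ^ k) = omega n ^ (n - k)"
  by (simp add: power_diff omega_pow_n[OF n_pos] inverse_eq_divide)

end

context even_dihedral_system
begin

lemma sign_cases:
  assumes "j < 2" obtains a where "a \<in> {0, 1::nat}" "omega 2 ^ j = (-1) ^ a"
  using assms that[of j] by (auto simp: omega_2 less_2_cases_iff)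

lemma exists_homogeneous:
  assumes "d > 0"
  obtains g v where "homogeneous g v" "v \<noteq> 0\<^sub>v d"
proof -
  have "(\<Sum>h\<in>carrier (dihedral n). P h $$ (0, 0)) \<noteq> 0"
    using P_sum[of 0 0] assms by simp
  then obtain h where h: "h \<in> carrier (dihedral n)" "P h $$ (0, 0) \<noteq> 0"
    by (rule sum.not_neutral_contains_not_neutral)
  let ?v = "P h *\<^sub>v unit_vec d 0"
  have "?v = col (P h) 0" using mult_unit_vec_eq_col[OF P[OF h(1)] assms] .
  then have "?v $ 0 \<noteq> 0" using h P[OF h(1)] assms by simp
  then have "?v \<noteq> 0\<^sub>v d" using assms by auto
  moreover have "P h *\<^sub>v ?v = ?v"
    using mat_mult_vec_assoc[OF P[OF h(1)] P[OF h(1)], of "unit_vec d 0"] h by (simp add: P_mult)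
  then have "homogeneous h ?v"
    using h mult_mat_vec_carrier[OF P[OF h(1)], of "unit_vec d 0"] by (simp add: homogeneous_def)
  ultimately show ?thesis using that by blast
qed

text \<open>The homogeneous vectors of degree \<open>g\<close> on which \<open>B\<close> acts as \<open>b\<close> form a subspace invariant under \<open>A\<close>.
  With \<open>B\<close> the identity this produces a first eigenvector; with \<open>B\<close> an operator already
  diagonalised it produces a common eigenvector.\<close>

lemma homogeneous_eigenvector:
  assumes A: "A \<in> carrier_mat d d" and B: "B \<in> carrier_mat d d" and N: "N > 0"
    and w: "homogeneous g w" "w \<noteq> 0\<^sub>v d" "B *\<^sub>v w = b \<cdot>\<^sub>v w"
    and inv: "\<And>v. homogeneous g v \<Longrightarrow> homogeneous g (A *\<^sub>v v)"
    and commute: "\<And>v. homogeneous g v \<Longrightarrow> B *\<^sub>v v = b \<cdot>\<^sub>v v \<Longrightarrow> B *\<^sub>v (A *\<^sub>v v) = b \<cdot>\<^sub>v (A *\<^sub>v v)"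
    and order: "A ^\<^sub>m N *\<^sub>v w = w"
  obtains j v where "j < N" "homogeneous g v" "v \<noteq> 0\<^sub>v d" "B *\<^sub>v v = b \<cdot>\<^sub>v v" "A *\<^sub>v v = omega N ^ j \<cdot>\<^sub>v v"
proof -
  note g = homogeneousD[OF w(1)]
  let ?W = "{v \<in> carrier_vec d. P g *\<^sub>v v = 1 \<cdot>\<^sub>v v \<and> B *\<^sub>v v = b \<cdot>\<^sub>v v}"
  have W: "v \<in> ?W \<longleftrightarrow> homogeneous g v \<and> B *\<^sub>v v = b \<cdot>\<^sub>v v" for v
    using g by (auto simp: homogeneous_def)
  have "subspace class_ring ?W (module_vec TYPE(complex) d)"
    by (rule subspace_common_eigenvectors[OF P[OF g(1)] B])
  then obtain j v where "j < N" "v \<in> ?W" "v \<noteq> 0\<^sub>v d" "A *\<^sub>v v = omega N ^ j \<cdot>\<^sub>v v"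
    by (rule cyclic_eigenvector[OF A N _ _ _ w(2) order]) (use w inv commute in \<open>auto simp only: W\<close>)
  then show ?thesis using that unfolding W by blast
qed

text \<open>For an eigenvector \<open>v\<close> of \<open>\<sigma>\<close> with eigenvalue \<open>\<omega>\<^sup>j\<close> the vector \<open>\<tau> v\<close> has the same degree and the
  inverse eigenvalue. If \<open>\<omega>\<^sup>j\<close> is not real, one of the two has its exponent between 1 and \<open>m - 1\<close>. If
  it is \<open>1\<close> or \<open>-1\<close>, the eigenspace is invariant under the involution \<open>\<tau>\<close> and contains a common
  eigenvector.\<close>

lemma weight_vector_central:
  assumes g: "g = (0, False) \<or> g = (m, False)" and w: "homogeneous g w" "w \<noteq> 0\<^sub>v d"
  obtains v where "homogeneous g v" "v \<noteq> 0\<^sub>v d"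
    "(\<exists>a\<in>{0, 1::nat}. \<exists>b\<in>{0, 1::nat}. S *\<^sub>v v = (-1) ^ a \<cdot>\<^sub>v v \<and> T *\<^sub>v v = (-1) ^ b \<cdot>\<^sub>v v)
     \<or> (\<exists>k. 1 \<le> k \<and> k < m \<and> S *\<^sub>v v = omega n ^ k \<cdot>\<^sub>v v)"
proof -
  have fixed: "sigma_conj n g = g" "tau_conj n g = g"
    using g n_eq m_pos by (auto simp: sigma_conj_def tau_conj_def)
  have T_inv: "homogeneous g (T *\<^sub>v v)" if "homogeneous g v" for v
    using homogeneous_T[OF that] fixed by simp
  have S_inv: "homogeneous g (S *\<^sub>v v)" if "homogeneous g v" for v
    using homogeneous_S[OF that] fixed by simp
  obtain j v where j: "j < n" and v: "homogeneous g v" "v \<noteq> 0\<^sub>v d" "S *\<^sub>v v = omega n ^ j \<cdot>\<^sub>v v"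
    using homogeneous_eigenvector[OF S one_carrier_mat n_pos w, of 1] S_inv homogeneousD(2)[OF w(1)]
    by (auto simp: S_pow_n homogeneousD(2) simp del: pow_mat.simps)
  note vc = homogeneousD(2)[OF v(1)]
  consider (mid) "j = 0 \<or> j = m" | (low) "1 \<le> j" "j < m" | (high) "m < j" by linarith
  then show ?thesis
  proof cases
    case mid
    then obtain a where a: "a \<in> {0, 1::nat}" "omega n ^ j = (-1) ^ a"
      using omega_pow_m by force
    have S_T: "S *\<^sub>v (T *\<^sub>v u) = (-1) ^ a \<cdot>\<^sub>v (T *\<^sub>v u)"
      if "homogeneous g u" "S *\<^sub>v u = (-1) ^ a \<cdot>\<^sub>v u" for u
      using S_T_eigen[OF homogeneousD(2)[OF that(1)] that(2)] a(1) by auto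
    have "T ^\<^sub>m 2 *\<^sub>v v = v"
      using T vc by (simp add: numeral_2_eq_2 T_sq)
    then obtain i u where u: "i < 2" "homogeneous g u" "u \<noteq> 0\<^sub>v d" "S *\<^sub>v u = (-1) ^ a \<cdot>\<^sub>v u"
      "T *\<^sub>v u = omega 2 ^ i \<cdot>\<^sub>v u"
      using homogeneous_eigenvector[OF T S, of 2 g v "(-1) ^ a"] v a T_inv S_T by auto
    obtain b where "b \<in> {0, 1::nat}" "omega 2 ^ i = (-1) ^ b" using sign_cases[OF u(1)] .
    then show ?thesis using that[OF u(2,3)] u a by metis
  next
    case low
    then show ?thesis using that v by blast
  next
    case high
    have "S *\<^sub>v (T *\<^sub>v v) = omega n ^ (n - j) \<cdot>\<^sub>v (T *\<^sub>v v)"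
      using S_T_eigen[OF vc v(3)] j by (simp add: inverse_omega_pow)
    moreover have "1 \<le> n - j" "n - j < m" using high j n_eq by auto
    ultimately show ?thesis using that[OF T_inv[OF v(1)] T_nonzero[OF vc v(2)]] by blast
  qed
qed

lemma weight_vectorI:
  assumes "homogeneous (label_degree n l 0) v" "v \<noteq> 0\<^sub>v d" "weight_equations n S T l v"
  shows "weight_vector n d S T P l v"
  using assms by (simp add: weight_vector_def homogeneous_def)

lemma label_in_irrep_labels:
  "a \<in> {0, 1} \<Longrightarrow> b \<in> {0, 1} \<Longrightarrow> Id_One a b \<in> irrep_labels n"
  "a \<in> {0, 1} \<Longrightarrow> b \<in> {0, 1} \<Longrightarrow> Mid_One a b \<in> irrep_labels n"
  "a \<in> {0, 1} \<Longrightarrow> b \<in> {0, 1} \<Longrightarrow> Refl_Even a b \<in> irrep_labels n"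
  "a \<in> {0, 1} \<Longrightarrow> b \<in> {0, 1} \<Longrightarrow> Refl_Odd a b \<in> irrep_labels n"
  "1 \<le> k \<Longrightarrow> k < m \<Longrightarrow> Id_Two k \<in> irrep_labels n"
  "1 \<le> k \<Longrightarrow> k < m \<Longrightarrow> Mid_Two k \<in> irrep_labels n"
  "i < n \<Longrightarrow> 1 \<le> k \<Longrightarrow> k < m \<Longrightarrow> Rot i k \<in> irrep_labels n"
  by (auto simp: irrep_labels_def one_dim_labels_def half_dim_labels_def two_dim_labels_def)

text \<open>Passing from \<open>v\<close> to \<open>\<tau> v\<close> replaces the degree \<open>\<sigma>\<^sup>k\<close> by its inverse, so the exponent of the degree
  may be assumed to be below \<open>m\<close>.\<close>

lemma weight_vector_rotation:
  assumes k: "k \<noteq> 0" "k \<noteq> m" and w: "homogeneous (k, False) w" "w \<noteq> 0\<^sub>v d"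
  shows "\<exists>l\<in>irrep_labels n. \<exists>v. weight_vector n d S T P l v"
proof -
  have kn: "k < n" using homogeneousD(1)[OF w(1)] by (auto simp: dihedral_simps)
  have S_inv: "homogeneous (k, False) (S *\<^sub>v v)" if "homogeneous (k, False) v" for v
    using homogeneous_S[OF that] by (simp add: sigma_conj_def)
  obtain j v where j: "j < n" and v: "homogeneous (k, False) v" "v \<noteq> 0\<^sub>v d" "S *\<^sub>v v = omega n ^ j \<cdot>\<^sub>v v"
    using homogeneous_eigenvector[OF S one_carrier_mat n_pos w, of 1] S_inv homogeneousD(2)[OF w(1)]
    by (auto simp: S_pow_n homogeneousD(2) simp del: pow_mat.simps)
  note vc = homogeneousD(2)[OF v(1)]
  show ?thesis
  proof (cases "k < m")
    case True
    then show ?thesis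
      using v j k by (intro bexI[of _ "Rot j k"] exI[of _ v] weight_vectorI label_in_irrep_labels) auto
  next
    case False
    let ?j = "if j = 0 then 0 else n - j"
    have "inverse (omega n ^ j) = omega n ^ ?j" using inverse_omega_pow[of j] j by auto
    then have "S *\<^sub>v (T *\<^sub>v v) = omega n ^ ?j \<cdot>\<^sub>v (T *\<^sub>v v)"
      using S_T_eigen[OF vc v(3)] by simp
    moreover have "homogeneous (n - k, False) (T *\<^sub>v v)"
      using homogeneous_T[OF v(1)] k kn by (simp add: tau_conj_def)
    ultimately show ?thesis
      using T_nonzero[OF vc v(2)] j k kn False n_eq
      by (intro bexI[of _ "Rot ?j (n - k)"] exI[of _ "T *\<^sub>v v"] weight_vectorI label_in_irrep_labels)
        auto
  qed
qed

text \<open>\<open>\<sigma>\<^sup>m\<close> and the reflection whose degree is considered act on this degree as commuting involutions.\<close>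

lemma reflection_eigenvector:
  assumes r: "r < 2" and w: "homogeneous (r, True) w" "w \<noteq> 0\<^sub>v d"
    and A: "A \<in> carrier_mat d d" "A * A = 1\<^sub>m d"
    and inv: "\<And>v. homogeneous (r, True) v \<Longrightarrow> homogeneous (r, True) (A *\<^sub>v v)"
    and commute: "\<And>v. v \<in> carrier_vec d \<Longrightarrow> S ^\<^sub>m m *\<^sub>v (A *\<^sub>v v) = A *\<^sub>v (S ^\<^sub>m m *\<^sub>v v)"
  obtains a b v where "a \<in> {0, 1::nat}" "b \<in> {0, 1::nat}" "homogeneous (r, True) v" "v \<noteq> 0\<^sub>v d"
    "S ^\<^sub>m m *\<^sub>v v = (-1) ^ a \<cdot>\<^sub>v v" "A *\<^sub>v v = (-1) ^ b \<cdot>\<^sub>v v"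
proof -
  have square: "B ^\<^sub>m 2 = B * B" if "B \<in> carrier_mat d d" for B :: "complex mat"
    using that by (simp add: numeral_2_eq_2)
  have S_inv: "homogeneous (r, True) (S ^\<^sub>m m *\<^sub>v v)" if "homogeneous (r, True) v" for v
    using homogeneous_S_pow[OF that, of m] r n_eq m_pos by simp
  have "S ^\<^sub>m m * S ^\<^sub>m m = 1\<^sub>m d"
    by (metis S_pow_add S_pow_n n_eq mult_2)
  then have "(S ^\<^sub>m m) ^\<^sub>m 2 *\<^sub>v w = w"
    using homogeneousD(2)[OF w(1)] by (simp add: square[OF S_pow])
  then obtain i u where u: "i < 2" "homogeneous (r, True) u" "u \<noteq> 0\<^sub>v d" "S ^\<^sub>m m *\<^sub>v u = omega 2 ^ i \<cdot>\<^sub>v u"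
    using homogeneous_eigenvector[OF S_pow[of m] one_carrier_mat, of 2 "(r, True)" w 1]
      w S_inv homogeneousD(2) by auto
  obtain a where a: "a \<in> {0, 1::nat}" "omega 2 ^ i = (-1) ^ a" using sign_cases[OF u(1)] .
  have "A ^\<^sub>m 2 *\<^sub>v u = u"
    using homogeneousD(2)[OF u(2)] by (simp add: square[OF A(1)] A(2))
  moreover have "S ^\<^sub>m m *\<^sub>v (A *\<^sub>v v) = (-1) ^ a \<cdot>\<^sub>v (A *\<^sub>v v)"
    if "homogeneous (r, True) v" "S ^\<^sub>m m *\<^sub>v v = (-1) ^ a \<cdot>\<^sub>v v" for v
    using that homogeneousD(2)[OF that(1)] by (simp add: commute mult_mat_vec[OF A(1)])
  ultimately obtain j v where v: "j < 2" "homogeneous (r, True) v" "v \<noteq> 0\<^sub>v d"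
      "S ^\<^sub>m m *\<^sub>v v = (-1) ^ a \<cdot>\<^sub>v v" "A *\<^sub>v v = omega 2 ^ j \<cdot>\<^sub>v v"
    using homogeneous_eigenvector[OF A(1) S_pow[of m], of 2 "(r, True)" u "(-1) ^ a"] u a inv by auto
  obtain b where "b \<in> {0, 1::nat}" "omega 2 ^ j = (-1) ^ b" using sign_cases[OF v(1)] .
  then show ?thesis using that[OF a(1)] v by metis
qed

text \<open>A power of \<open>\<sigma>\<close> moves the degree to \<open>\<tau>\<close> or to \<open>\<sigma> \<tau>\<close>, according to the parity of \<open>i\<close>.\<close>

lemma weight_vector_reflection:
  assumes w: "homogeneous (i, True) w" "w \<noteq> 0\<^sub>v d"
  shows "\<exists>l\<in>irrep_labels n. \<exists>v. weight_vector n d S T P l v"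
proof -
  note wc = homogeneousD(2)[OF w(1)]
  have i: "i < n" using homogeneousD(1)[OF w(1)] by (auto simp: dihedral_simps)
  let ?u = "S ^\<^sub>m (m - i div 2) *\<^sub>v w"
  have q: "i div 2 < m" using i n_eq by simp
  have "(i + 2 * (m - i div 2)) mod n = i mod 2"
  proof -
    have "i + 2 * (m - i div 2) = i mod 2 + n"
      using q n_eq by presburger
    moreover have "i mod 2 < n" using n_eq m_pos by presburger
    ultimately show ?thesis by simp
  qed
  then have u: "homogeneous (i mod 2, True) ?u" "?u \<noteq> 0\<^sub>v d"
    using homogeneous_S_pow[OF w(1), of "m - i div 2"] S_pow_nonzero[OF wc w(2)] by simp_all
  have comm_T: "S ^\<^sub>m m *\<^sub>v (T *\<^sub>v v) = T *\<^sub>v (S ^\<^sub>m m *\<^sub>v v)" if "v \<in> carrier_vec d" for v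
    using T_S_pow_vec[OF that, of m] n_eq by simp
  have comm_S: "S ^\<^sub>m m *\<^sub>v (S *\<^sub>v v) = S *\<^sub>v (S ^\<^sub>m m *\<^sub>v v)" if "v \<in> carrier_vec d" for v
    using S_pow_add_vec[OF that, of m 1] S_pow_add_vec[OF that, of 1 m]
    by (simp only: S_pow_1 add.commute)
  have ST: "S * T *\<^sub>v v = S *\<^sub>v (T *\<^sub>v v)" if "v \<in> carrier_vec d" for v
    using mat_mult_vec_assoc[OF S T that] .
  consider "i mod 2 = 0" | "i mod 2 = 1" by linarith
  then show ?thesis
  proof cases
    case 1
    have inv: "homogeneous (0, True) (T *\<^sub>v v)" if "homogeneous (0, True) v" for v
      using homogeneous_T[OF that] by (simp add: tau_conj_def)
    obtain a b v where "a \<in> {0, 1::nat}" "b \<in> {0, 1::nat}" "homogeneous (0, True) v" "v \<noteq> 0\<^sub>v d"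
        "S ^\<^sub>m m *\<^sub>v v = (-1) ^ a \<cdot>\<^sub>v v" "T *\<^sub>v v = (-1) ^ b \<cdot>\<^sub>v v"
      using reflection_eigenvector[of 0 ?u T] u 1 T T_sq inv comm_T by auto
    then show ?thesis
      by (intro bexI[of _ "Refl_Even a b"] exI[of _ v] weight_vectorI label_in_irrep_labels) auto
  next
    case 2
    have inv: "homogeneous (1, True) (S * T *\<^sub>v v)" if "homogeneous (1, True) v" for v
    proof -
      have "(n - 1) mod n = n - 1" "(n - 1 + 2) mod n = 1"
        using n_eq m_pos mod_add_self2[of 1 n] by (auto simp: numeral_2_eq_2)
      then show ?thesis
        using homogeneous_S[OF homogeneous_T[OF that]] ST[OF homogeneousD(2)[OF that]]
        by (simp add: tau_conj_def sigma_conj_def)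
    qed
    have sq: "S * T * (S * T) = 1\<^sub>m d"
    proof -
      have "S * T * (S * T) = S * T * S * T" using S T by (simp add: assoc_sq)
      then show ?thesis by (simp add: STS T_sq)
    qed
    have comm: "S ^\<^sub>m m *\<^sub>v (S * T *\<^sub>v v) = S * T *\<^sub>v (S ^\<^sub>m m *\<^sub>v v)" if "v \<in> carrier_vec d" for v
      using that by (simp add: ST comm_S comm_T)
    have u1: "homogeneous (1, True) ?u" using u(1) 2 by simp
    obtain a b v where ab: "a \<in> {0, 1::nat}" "b \<in> {0, 1::nat}"
      and v: "homogeneous (1, True) v" "v \<noteq> 0\<^sub>v d"
        "S ^\<^sub>m m *\<^sub>v v = (-1) ^ a \<cdot>\<^sub>v v" "S * T *\<^sub>v v = (-1) ^ b \<cdot>\<^sub>v v"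
      by (rule reflection_eigenvector[OF _ u1 u(2) mult_sq[OF S T] sq inv comm]) simp
    from ab v show ?thesis
      using ST[OF homogeneousD(2)[OF v(1)]]
      by (intro bexI[of _ "Refl_Odd a b"] exI[of _ v] weight_vectorI label_in_irrep_labels) auto
  qed
qed

lemma weight_vector_exists:
  assumes "d > 0"
  shows "\<exists>l\<in>irrep_labels n. \<exists>v. weight_vector n d S T P l v"
proof -
  obtain g w where w: "homogeneous g w" "w \<noteq> 0\<^sub>v d" using exists_homogeneous[OF assms] .
  obtain i s where g: "g = (i, s)" by force
  consider "s" | "\<not> s" "i \<noteq> 0" "i \<noteq> m" | (central) "\<not> s" "i = 0 \<or> i = m" by auto
  then show ?thesis
  proof cases
    case central
    then obtain v where v: "homogeneous g v" "v \<noteq> 0\<^sub>v d"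
      "(\<exists>a\<in>{0, 1::nat}. \<exists>b\<in>{0, 1::nat}. S *\<^sub>v v = (-1) ^ a \<cdot>\<^sub>v v \<and> T *\<^sub>v v = (-1) ^ b \<cdot>\<^sub>v v)
       \<or> (\<exists>k. 1 \<le> k \<and> k < m \<and> S *\<^sub>v v = omega n ^ k \<cdot>\<^sub>v v)"
      using weight_vector_central[OF _ w] g by auto
    from v(3) show ?thesis
    proof (elim disjE bexE exE)
      fix a b :: nat
      assume ab: "a \<in> {0, 1}" "b \<in> {0, 1}" "S *\<^sub>v v = (-1) ^ a \<cdot>\<^sub>v v \<and> T *\<^sub>v v = (-1) ^ b \<cdot>\<^sub>v v"
      have "weight_vector n d S T P (if i = 0 then Id_One a b else Mid_One a b) v"
        using v ab g central by (intro weight_vectorI) auto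
      then show ?thesis using label_in_irrep_labels(1,2)[OF ab(1,2)] by (auto split: if_splits)
    next
      fix k assume k: "1 \<le> k \<and> k < m \<and> S *\<^sub>v v = omega n ^ k \<cdot>\<^sub>v v"
      have "weight_vector n d S T P (if i = 0 then Id_Two k else Mid_Two k) v"
        using v k g central by (intro weight_vectorI) auto
      then show ?thesis using label_in_irrep_labels(5,6)[of k] k by (auto split: if_splits)
    qed
  qed (use weight_vector_rotation weight_vector_reflection w g in auto)
qed

end

section \<open>The listed representations\<close>

context even_dihedral
begin

lemma omega_coef_distinct:
  assumes "1 \<le> k" "k < m" "1 \<le> k'" "k' < m"
  shows "omega n ^ k = omega n ^ k' \<longleftrightarrow> k = k'" and "inverse (omega n ^ k) \<noteq> omega n ^ k'"
proof -
  show "omega n ^ k = omega n ^ k' \<longleftrightarrow> k = k'"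
    using omega_pow_inject[of k n k'] assms n_eq by auto
  have "inverse (omega n ^ k) = omega n ^ (n - k)"
    using assms n_eq by (intro inverse_omega_pow) simp
  then show "inverse (omega n ^ k) \<noteq> omega n ^ k'"
    using omega_pow_inject[of "n - k" n k'] assms n_eq by auto
qed

lemma label_sigma_unit_vec:
  "j < label_dim n l \<Longrightarrow> label_sigma n l *\<^sub>v unit_vec (label_dim n l) j =
     sigma_coef n l j \<cdot>\<^sub>v unit_vec (label_dim n l) (sigma_pos n l j)"
  unfolding label_sigma_eq_monomial by (rule monomial_mat_unit_vec) (auto intro: label_pos_less)

lemma label_tau_unit_vec:
  "j < label_dim n l \<Longrightarrow> label_tau n l *\<^sub>v unit_vec (label_dim n l) j =
     tau_coef n l j \<cdot>\<^sub>v unit_vec (label_dim n l) (tau_pos n l j)"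
  unfolding label_tau_eq_monomial by (rule monomial_mat_unit_vec) (auto intro: label_pos_less)

lemma label_mat_carrier:
  "label_sigma n l \<in> carrier_mat (label_dim n l) (label_dim n l)"
  "label_tau n l \<in> carrier_mat (label_dim n l) (label_dim n l)"
  "degree_proj n l g \<in> carrier_mat (label_dim n l) (label_dim n l)"
  by (simp_all only: label_sigma_eq_monomial label_tau_eq_monomial degree_proj_def monomial_mat_carrier)

lemma degree_proj_mult_vec:
  assumes "v \<in> carrier_vec (label_dim n l)" "i < label_dim n l"
  shows "(degree_proj n l g *\<^sub>v v) $ i = (if label_degree n l i = g then v $ i else 0)"
  unfolding degree_proj_def by (simp add: diag_mult_vec_index[OF assms])

lemma unit_vec_weight:
  assumes "l \<in> irrep_labels n"
  shows "weight_vector n (label_dim n l) (label_sigma n l) (label_tau n l) (degree_proj n l) l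
    (unit_vec (label_dim n l) 0)"
proof -
  let ?e = "unit_vec (label_dim n l) :: nat \<Rightarrow> complex vec"
  have P: "degree_proj n l (label_degree n l 0) *\<^sub>v ?e 0 = ?e 0"
    unfolding degree_proj_def using label_dim_pos[of l] by (simp add: monomial_mat_unit_vec)
  note sig = label_sigma_unit_vec[OF label_dim_pos, of l]
  note tau = label_tau_unit_vec[OF label_dim_pos, of l]
  have pow: "A_mat m a ^\<^sub>m m *\<^sub>v unit_vec m 0 = (-1) ^ a \<cdot>\<^sub>v unit_vec m 0" for a
    using m_pos by (simp add: A_pow_m scalar_mat_eq_monomial monomial_mat_unit_vec)
  have odd: "S *\<^sub>v (c \<cdot>\<^sub>v unit_vec m (m - Suc 0)) = c \<cdot>\<^sub>v (S *\<^sub>v unit_vec m (m - Suc 0))"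
    if "S \<in> carrier_mat m m" for S and c :: complex
    using that by (simp add: mult_mat_vec)
  have last: "label_sigma n l *\<^sub>v ?e (label_dim n l - 1) = sigma_coef n l (label_dim n l - 1) \<cdot>\<^sub>v
      ?e (sigma_pos n l (label_dim n l - 1))"
    by (rule label_sigma_unit_vec) (use label_dim_pos[of l] in simp)
  have "weight_equations n (label_sigma n l) (label_tau n l) l (?e 0)"
    using assms
  proof (cases rule: irrep_label_cases)
    case (Refl_Even a b)
    then show ?thesis using tau pow by (simp add: power_add mult_ac minus_one_power_cancel)
  next
    case (Refl_Odd a b)
    then show ?thesis
      using tau pow last m_pos odd[OF label_mat_carrier(1)[of l, unfolded Refl_Odd label_dim.simps half_n]]
      by (simp add: power_add mult_ac minus_one_power_cancel smult_smult_assoc)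
  qed (use sig tau in auto)
  then show ?thesis using P label_dim_pos[of l] by (simp add: weight_vector_def)
qed

lemma weight_equations_smult:
  assumes S: "S \<in> carrier_mat d d" and T: "T \<in> carrier_mat d d" and v: "v \<in> carrier_vec d"
    and c: "c \<noteq> 0" and eq: "weight_equations n S T l (c \<cdot>\<^sub>v v)"
  shows "weight_equations n S T l v"
proof -
  have swap: "x \<cdot>\<^sub>v (c \<cdot>\<^sub>v v) = c \<cdot>\<^sub>v (x \<cdot>\<^sub>v v)" for x
    by (simp add: smult_smult_assoc mult.commute)
  have Tv: "T *\<^sub>v v \<in> carrier_vec d" using T v by simp
  have Sm: "S ^\<^sub>m k \<in> carrier_mat d d" for k using S by simp
  show ?thesis
    using eq v Tv
    by (cases l) (simp_all only: weight_equations.simps mult_mat_vec[OF S] mult_mat_vec[OF T]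
        mult_mat_vec[OF Sm] swap smult_vec_cancel_left[OF c])
qed

lemma unit_vec_scalar_eq:
  "d > 0 \<Longrightarrow> a \<cdot>\<^sub>v unit_vec d 0 = b \<cdot>\<^sub>v unit_vec d 0 \<Longrightarrow> a = (b :: complex)"
  by (auto simp: vec_eq_iff)

text \<open>The degrees occurring in a listed representation form a conjugacy class of the group, so one common
  degree determines the class; among the labels of the same class the dimension separates the
  one-dimensional from the two-dimensional ones over a central element.\<close>

lemma same_degree_cases:
  assumes l: "l \<in> irrep_labels n" and l': "l' \<in> irrep_labels n"
    and dim: "label_dim n l = label_dim n l'" and i: "i < label_dim n l'"
    and deg: "label_degree n l' i = label_degree n l 0"
  obtains a b a' b' where "l = Id_One a b" "l' = Id_One a' b'"
  | k k' where "l = Id_Two k" "l' = Id_Two k'"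
  | a b a' b' where "l = Mid_One a b" "l' = Mid_One a' b'"
  | k k' where "l = Mid_Two k" "l' = Mid_Two k'"
  | j j' k where "l = Rot j k" "l' = Rot j' k"
  | a b a' b' where "l = Refl_Even a b" "l' = Refl_Even a' b'"
  | a b a' b' where "l = Refl_Odd a b" "l' = Refl_Odd a' b'"
proof -
  have odd: "2 * i \<noteq> Suc 0" by presburger
  show ?thesis
    using l'
  proof (cases rule: irrep_label_cases)
    case Id_One
    from l show ?thesis
      by (cases rule: irrep_label_cases) (use Id_One that dim i deg m_pos n_eq in \<open>auto split: if_splits\<close>)
  next
    case Id_Two
    from l show ?thesis
      by (cases rule: irrep_label_cases) (use Id_Two that dim i deg m_pos n_eq in \<open>auto split: if_splits\<close>)
  next
    case Mid_One
    from l show ?thesis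
      by (cases rule: irrep_label_cases) (use Mid_One that dim i deg m_pos n_eq in \<open>auto split: if_splits\<close>)
  next
    case Mid_Two
    from l show ?thesis
      by (cases rule: irrep_label_cases) (use Mid_Two that dim i deg m_pos n_eq in \<open>auto split: if_splits\<close>)
  next
    case Rot
    from l show ?thesis
      by (cases rule: irrep_label_cases) (use Rot that dim i deg m_pos n_eq in \<open>auto split: if_splits\<close>)
  next
    case Refl_Even
    from l show ?thesis
      by (cases rule: irrep_label_cases) (use Refl_Even that dim i deg m_pos n_eq odd in \<open>auto split: if_splits\<close>)
  next
    case Refl_Odd
    from l show ?thesis
      by (cases rule: irrep_label_cases) (use Refl_Odd that dim i deg m_pos n_eq in \<open>auto split: if_splits\<close>)
  qed
qed

text \<open>Outside the two-dimensional representations with central degree, the degree of the weight vector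
  occurs in the first coordinate only. So the weight vector is a multiple of the first coordinate
  vector, which also satisfies the equations of its own label, and the eigenvalues can be compared.
  In the exceptional case the eigenvalue of \<open>\<sigma>\<close> is \<open>\<omega>\<close> to the power \<open>k\<close> or \<open>-k\<close>, and \<open>k < n/2\<close> excludes
  the second possibility for another label.\<close>

lemma weight_label_unique:
  assumes l: "l \<in> irrep_labels n" and l': "l' \<in> irrep_labels n"
    and dim: "label_dim n l = label_dim n l'"
    and v: "weight_vector n (label_dim n l') (label_sigma n l') (label_tau n l') (degree_proj n l') l v"
  shows "l = l'"
proof -
  let ?d = "label_dim n l'" and ?S = "label_sigma n l'" and ?T = "label_tau n l'"
  have vc: "v \<in> carrier_vec ?d" and v0: "v \<noteq> 0\<^sub>v ?d"
    and vP: "degree_proj n l' (label_degree n l 0) *\<^sub>v v = v" and eqs: "weight_equations n ?S ?T l v"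
    using v by (auto simp: weight_vector_def)
  have support: "label_degree n l' i = label_degree n l 0" if "i < ?d" "v $ i \<noteq> 0" for i
    using degree_proj_mult_vec[OF vc that(1), of "label_degree n l 0"] vP that(2) by (auto split: if_splits)
  obtain i where i: "i < ?d" "v $ i \<noteq> 0"
    using v0 vc by (auto simp: vec_eq_iff)
  have diag: "sigma_coef n l' i = c"
    if "?S = monomial_mat ?d (\<lambda>j. j) (sigma_coef n l')" "?S *\<^sub>v v = c \<cdot>\<^sub>v v" for c
  proof -
    have "sigma_coef n l' i * v $ i = (?S *\<^sub>v v) $ i"
      unfolding that(1) by (rule diag_mult_vec_index[OF vc i(1), symmetric])
    also have "\<dots> = c * v $ i" unfolding that(2) using vc i(1) by simp
    finally show ?thesis using i(2) by simp
  qed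
  have own: "weight_equations n ?S ?T l' (unit_vec ?d 0)"
    using unit_vec_weight[OF l'] by (simp add: weight_vector_def)
  have conc: "weight_equations n ?S ?T l (unit_vec ?d 0)"
    if "\<And>j. j < ?d \<Longrightarrow> label_degree n l' j = label_degree n l 0 \<Longrightarrow> j = 0"
  proof -
    have "v $ j = 0" if "j < ?d" "j \<noteq> 0" for j
      using support[of j] \<open>\<And>j. j < ?d \<Longrightarrow> label_degree n l' j = label_degree n l 0 \<Longrightarrow> j = 0\<close> that by blast
    then have "v = v $ 0 \<cdot>\<^sub>v unit_vec ?d 0"
      using vc label_dim_pos[of l'] by (intro eq_vecI) auto
    moreover have "v $ 0 \<noteq> 0" using i that support by metis
    ultimately show ?thesis
      using weight_equations_smult[OF label_mat_carrier(1,2) unit_vec_carrier, of "v $ 0" l' l 0] eqs by simp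
  qed
  have sign: "a = b" if "a \<in> {0, 1}" "b \<in> {0, 1}" "(-1) ^ a \<cdot>\<^sub>v unit_vec ?d 0 = (-1) ^ b \<cdot>\<^sub>v (unit_vec ?d 0 :: complex vec)" for a b :: nat
    using unit_vec_scalar_eq[OF label_dim_pos that(3)] that(1,2) by auto
  have root: "j = k" if "j < n" "k < n" "omega n ^ j \<cdot>\<^sub>v unit_vec ?d 0 = omega n ^ k \<cdot>\<^sub>v unit_vec ?d 0" for j k
    using unit_vec_scalar_eq[OF label_dim_pos that(3)] omega_pow_inject[OF that(1,2)] by simp
  note range = irrep_labels_def one_dim_labels_def half_dim_labels_def two_dim_labels_def
  show ?thesis
  proof (rule same_degree_cases[OF l l' dim i(1) support[OF i]])
    fix a b a' b' assume c: "l = Id_One a b" "l' = Id_One a' b'"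
    have "weight_equations n ?S ?T l (unit_vec ?d 0)" by (rule conc) (use c in simp)
    then have "a = a' \<and> b = b'"
      using own l l' sign[of a a'] sign[of b b'] unfolding c by (auto simp: range)
    then show "l = l'" using c by simp
  next
    fix a b a' b' assume c: "l = Mid_One a b" "l' = Mid_One a' b'"
    have "weight_equations n ?S ?T l (unit_vec ?d 0)" by (rule conc) (use c in simp)
    then have "a = a' \<and> b = b'"
      using own l l' sign[of a a'] sign[of b b'] unfolding c by (auto simp: range)
    then show "l = l'" using c by simp
  next
    fix a b a' b' assume c: "l = Refl_Even a b" "l' = Refl_Even a' b'"
    have "weight_equations n ?S ?T l (unit_vec ?d 0)" by (rule conc) (use c in simp)
    then have "a = a' \<and> b = b'"
      using own l l' sign[of a a'] sign[of b b'] unfolding c by (auto simp: range)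
    then show "l = l'" using c by simp
  next
    fix a b a' b' assume c: "l = Refl_Odd a b" "l' = Refl_Odd a' b'"
    have "weight_equations n ?S ?T l (unit_vec ?d 0)" by (rule conc) (use c in simp)
    then have "a = a' \<and> b = b'"
      using own l l' sign[of a a'] sign[of b b'] unfolding c by (auto simp: range)
    then show "l = l'" using c by simp
  next
    fix j j' k assume c: "l = Rot j k" "l' = Rot j' k"
    then have r: "j < n" "j' < n" "k < m" using l l' by (auto simp: range)
    have "weight_equations n ?S ?T l (unit_vec ?d 0)"
      by (rule conc) (use c r n_eq in \<open>auto split: if_splits\<close>)
    then show "l = l'" using own root[of j j'] r unfolding c by simp
  next
    fix k k' assume c: "l = Id_Two k" "l' = Id_Two k'"
    then have r: "1 \<le> k" "k < m" "1 \<le> k'" "k' < m" using l l' by (auto simp: range)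
    have "sigma_coef n l' i = omega n ^ k"
      by (rule diag) (use eqs c label_sigma_eq_monomial[of l'] in \<open>auto intro!: monomial_mat_cong\<close>)
    then show "l = l'"
      using omega_coef_distinct[OF r(3,4,1,2)] unfolding c by (auto split: if_splits)
  next
    fix k k' assume c: "l = Mid_Two k" "l' = Mid_Two k'"
    then have r: "1 \<le> k" "k < m" "1 \<le> k'" "k' < m" using l l' by (auto simp: range)
    have "sigma_coef n l' i = omega n ^ k"
      by (rule diag) (use eqs c label_sigma_eq_monomial[of l'] in \<open>auto intro!: monomial_mat_cong\<close>)
    then show "l = l'"
      using omega_coef_distinct[OF r(3,4,1,2)] unfolding c by (auto split: if_splits)
  qed
qed

text \<open>An invariant subspace that is not zero contains a coordinate vector: the projections onto degrees
  cut one out of any nonzero vector, except over a central degree, where the two distinct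
  eigenvalues of \<open>\<sigma>\<close> do so. From there \<open>\<sigma>\<close> or \<open>\<tau>\<close> leads to the next coordinate vector, cyclically.\<close>

lemma invariant_subspace_trivial:
  assumes l: "l \<in> irrep_labels n"
    and W: "subspace class_ring W (module_vec TYPE(complex) (label_dim n l))"
    and S: "\<And>w. w \<in> W \<Longrightarrow> label_sigma n l *\<^sub>v w \<in> W"
    and T: "\<And>w. w \<in> W \<Longrightarrow> label_tau n l *\<^sub>v w \<in> W"
    and P: "\<And>g w. g \<in> carrier (dihedral n) \<Longrightarrow> w \<in> W \<Longrightarrow> degree_proj n l g *\<^sub>v w \<in> W"
  shows "W = {0\<^sub>v (label_dim n l)} \<or> W = carrier_vec (label_dim n l)"
proof (cases "W = {0\<^sub>v (label_dim n l)}")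
  case False
  let ?d = "label_dim n l" and ?e = "unit_vec (label_dim n l) :: nat \<Rightarrow> complex vec"
  have W': "W \<subseteq> carrier_vec ?d" "0\<^sub>v ?d \<in> W" "\<And>v w. v \<in> W \<Longrightarrow> w \<in> W \<Longrightarrow> v + w \<in> W"
    "\<And>c v. v \<in> W \<Longrightarrow> c \<cdot>\<^sub>v v \<in> W"
    using W by (auto simp: subspace_module_vec_iff)
  obtain w where w: "w \<in> W" "w \<noteq> 0\<^sub>v ?d" using False W' by blast
  then have wc: "w \<in> carrier_vec ?d" using W' by auto
  obtain i where i: "i < ?d" "w $ i \<noteq> 0" using w wc by (auto simp: vec_eq_iff)
  have scale: "v \<in> W" if "c \<cdot>\<^sub>v v \<in> W" "c \<noteq> 0" for c :: complex and v
    using W'(4)[OF that(1), of "inverse c"] that(2) by (simp add: smult_smult_assoc)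
  have rot: "?e i \<in> W"
    if d: "?d = 2" and sig: "label_sigma n l = monomial_mat 2 (\<lambda>j. j) \<alpha>" and ne: "\<alpha> 0 \<noteq> \<alpha> 1" for \<alpha>
  proof -
    \<comment> \<open>Subtracting the other eigenvalue kills the other coordinate.\<close>
    let ?u = "label_sigma n l *\<^sub>v w + (- \<alpha> (1 - i)) \<cdot>\<^sub>v w"
    have "?u = ((\<alpha> i - \<alpha> (1 - i)) * w $ i) \<cdot>\<^sub>v ?e i"
    proof (rule eq_vecI)
      fix j assume "j < dim_vec (((\<alpha> i - \<alpha> (1 - i)) * w $ i) \<cdot>\<^sub>v ?e i)"
      then have "j < 2" using d by simp
      then show "?u $ j = (((\<alpha> i - \<alpha> (1 - i)) * w $ i) \<cdot>\<^sub>v ?e i) $ j"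
        using diag_mult_vec_index[of w 2 j \<alpha>] wc i(1) unfolding d sig
        by (auto simp: less_2_cases_iff algebra_simps simp del: index_mult_mat_vec)
    qed (use wc in simp)
    moreover have "?u \<in> W" using W' S w by blast
    moreover have "\<alpha> i \<noteq> \<alpha> (1 - i)" using i(1) ne d by (auto simp: less_2_cases_iff)
    ultimately show ?thesis using scale i(2) by simp
  qed
  have proj: "?e i \<in> W"
    if inj: "\<And>j. j < ?d \<Longrightarrow> label_degree n l j = label_degree n l i \<Longrightarrow> j = i"
  proof -
    have "degree_proj n l (label_degree n l i) *\<^sub>v w = w $ i \<cdot>\<^sub>v ?e i"
    proof (rule eq_vecI)
      fix j assume "j < dim_vec (w $ i \<cdot>\<^sub>v ?e i)"
      then show "(degree_proj n l (label_degree n l i) *\<^sub>v w) $ j = (w $ i \<cdot>\<^sub>v ?e i) $ j"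
        using degree_proj_mult_vec[OF wc, of j "label_degree n l i"] inj[of j] i
        by (auto simp del: index_mult_mat_vec)
    qed (simp add: degree_proj_def)
    then show ?thesis using P[OF label_degree_in_carrier[OF l i(1)] w(1)] scale i(2) by simp
  qed
  have coef: "omega n ^ k \<noteq> inverse (omega n ^ k)" if "1 \<le> k" "k < m" for k
    using omega_coef_distinct(2)[OF that that] by metis
  have start: "?e i \<in> W"
    using l
  proof (cases rule: irrep_label_cases)
    case (Id_Two k)
    show ?thesis
      by (rule rot[of "\<lambda>j. if j = 0 then omega n ^ k else inverse (omega n ^ k)"])
        (use Id_Two coef in \<open>auto simp: rot_mat_eq_monomial\<close>)
  next
    case (Mid_Two k)
    show ?thesis
      by (rule rot[of "\<lambda>j. if j = 0 then omega n ^ k else inverse (omega n ^ k)"])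
        (use Mid_Two coef in \<open>auto simp: rot_mat_eq_monomial\<close>)
  qed (rule proj; use i n_eq in \<open>auto split: if_splits\<close>)+
  have step: "?e (Suc j mod ?d) \<in> W" if j: "j < ?d" and e: "?e j \<in> W" for j
  proof -
    have "sigma_coef n l j \<noteq> 0" "tau_coef n l j \<noteq> 0" by (cases l; simp)+
    then have "?e (sigma_pos n l j) \<in> W" "?e (tau_pos n l j) \<in> W"
      using S[OF e] T[OF e] scale by (simp_all add: label_sigma_unit_vec label_tau_unit_vec j)
    moreover have "Suc j mod ?d = sigma_pos n l j \<or> Suc j mod ?d = tau_pos n l j"
      using l j by (cases rule: irrep_label_cases) (auto simp: less_2_cases_iff mod_Suc)
    ultimately show ?thesis by auto
  qed
  have walk: "?e ((i + t) mod ?d) \<in> W" for t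
  proof (induction t)
    case (Suc t)
    then show ?case
      using step[of "(i + t) mod ?d"] label_dim_pos[of l] by (simp add: mod_Suc_eq)
  qed (use i start in simp)
  have "?e j \<in> W" if "j < ?d" for j
    using walk[of "?d - i + j"] i(1) that by simp
  then show ?thesis using subspace_eq_carrier_vecI[OF W] by blast
qed simp

lemma listed_rep_irreducible:
  assumes l: "l \<in> irrep_labels n" and \<rho>: "listed_rep n l \<rho>"
  shows "irreducible_rep (quantum_double (dihedral n)) (label_dim n l) \<rho>"
proof -
  note r = \<rho>[unfolded listed_rep_iff[OF l]]
  note gen = dih_generators_in_carrier[OF n_pos, THEN qd_group_in_carrier[OF finite_dihedral]]
  note dual = qd_dual_in_carrier[OF group_dihedral[OF n_pos]]
  show ?thesis
    unfolding irreducible_rep_def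
  proof (intro conjI allI impI)
    fix W
    assume W: "subspace class_ring W (module_vec TYPE(complex) (label_dim n l)) \<and>
      (\<forall>x\<in>carrier (quantum_double (dihedral n)). \<forall>w\<in>W. \<rho> x *\<^sub>v w \<in> W)"
    show "W = {0\<^sub>v (label_dim n l)} \<or> W = carrier_vec (label_dim n l)"
    proof (rule invariant_subspace_trivial[OF l])
      fix w assume w: "w \<in> W"
      show "label_sigma n l *\<^sub>v w \<in> W" "label_tau n l *\<^sub>v w \<in> W"
        using W w gen r by metis+
      show "degree_proj n l g *\<^sub>v w \<in> W" if "g \<in> carrier (dihedral n)" for g
        using W w dual[OF that] r that by metis
    qed (use W in blast)
  qed (use r label_dim_pos in auto)
qed

lemma intertwines_listed:
  assumes l: "l \<in> irrep_labels n" and \<rho>: "listed_rep n l \<rho>"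
    and \<rho>': "matrix_rep (quantum_double (dihedral n)) d \<rho>'"
    and Q: "Q \<in> carrier_mat d (label_dim n l)"
    and "Q * label_sigma n l = \<rho>' (qd_group (dihedral n) (dih_sigma n)) * Q"
    and "Q * label_tau n l = \<rho>' (qd_group (dihedral n) (dih_tau n)) * Q"
    and "\<And>g. g \<in> carrier (dihedral n) \<Longrightarrow> Q * degree_proj n l g = \<rho>' (qd_dual (dihedral n) g) * Q"
    and x: "x \<in> carrier (quantum_double (dihedral n))"
  shows "Q * \<rho> x = \<rho>' x * Q"
  using \<rho> assms(5-7)
  by (intro intertwines_if_on_generators[OF n_pos _ \<rho>' Q _ _ _ x]) (auto simp: listed_rep_iff[OF l])

text \<open>An isomorphism carries the first coordinate vector to a weight vector of the same label.\<close>

lemma isomorphic_listed_iff: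
  assumes l: "l \<in> irrep_labels n" and l': "l' \<in> irrep_labels n"
    and \<rho>: "listed_rep n l \<rho>" and \<rho>': "listed_rep n l' \<rho>'"
  shows "isomorphic_reps (quantum_double (dihedral n)) (label_dim n l) \<rho> (label_dim n l') \<rho>'
     \<longleftrightarrow> l = l'"
proof
  let ?D = "quantum_double (dihedral n)"
  note r = \<rho>[unfolded listed_rep_iff[OF l]] and r' = \<rho>'[unfolded listed_rep_iff[OF l']]
  note gen = dih_generators_in_carrier[OF n_pos, THEN qd_group_in_carrier[OF finite_dihedral]]
  note dual = qd_dual_in_carrier[OF group_dihedral[OF n_pos]]
  {
    assume "isomorphic_reps ?D (label_dim n l) \<rho> (label_dim n l') \<rho>'"
    then obtain Q where dim: "label_dim n l = label_dim n l'"
      and Q: "Q \<in> carrier_mat (label_dim n l') (label_dim n l)" and inv: "invertible_mat Q"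
      and QR: "\<And>x. x \<in> carrier ?D \<Longrightarrow> Q * \<rho> x = \<rho>' x * Q"
      by (auto simp: isomorphic_reps_def)
    let ?e = "unit_vec (label_dim n l) 0 :: complex vec"
    have "Q *\<^sub>v ?e \<noteq> 0\<^sub>v (label_dim n l')"
    proof
      assume zero: "Q *\<^sub>v ?e = 0\<^sub>v (label_dim n l')"
      obtain R where R: "R * Q = 1\<^sub>m (dim_row R)" "Q * R = 1\<^sub>m (label_dim n l')"
        using inv Q by (auto simp: invertible_mat_def inverts_mat_def)
      have "dim_row R = label_dim n l"
        using R(1) Q by (metis carrier_matD(2) index_mult_mat(3) index_one_mat(3))
      moreover have "dim_col R = label_dim n l'"
        using R(2) by (metis index_mult_mat(3) index_one_mat(3))
      ultimately have Rc: "R \<in> carrier_mat (label_dim n l) (label_dim n l')" by auto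
      have "?e = R *\<^sub>v (Q *\<^sub>v ?e)"
        using assoc_mult_mat_vec[OF Rc Q unit_vec_carrier, of 0] R(1) Rc by simp
      also have "\<dots> = 0\<^sub>v (label_dim n l)" by (simp add: zero mult_mat_zero_vec[OF Rc])
      finally show False using label_dim_pos[of l] by simp
    qed
    then have "weight_vector n (label_dim n l') (label_sigma n l') (label_tau n l') (degree_proj n l') l (Q *\<^sub>v ?e)"
      using QR[OF gen(1)] QR[OF gen(2)] QR[OF dual, of "label_degree n l 0"] r r'
        label_degree_in_carrier[OF l label_dim_pos]
      by (intro weight_vector_intertwine[OF Q _ _ _ _ _ _ _ _ _ unit_vec_weight[OF l]])
        (auto simp: label_mat_carrier)
    then show "l = l'" by (rule weight_label_unique[OF l l' dim])
  }
  assume eq: "l = l'"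
  have "1\<^sub>m (label_dim n l) * \<rho> x = \<rho>' x * 1\<^sub>m (label_dim n l)" if "x \<in> carrier ?D" for x
    by (intro intertwines_listed[OF l \<rho>, where d = "label_dim n l"] that)
      (use r' eq in \<open>simp_all add: left_mult_one_mat[OF label_mat_carrier(1)]
        left_mult_one_mat[OF label_mat_carrier(2)] left_mult_one_mat[OF label_mat_carrier(3)]
        right_mult_one_mat[OF label_mat_carrier(1)] right_mult_one_mat[OF label_mat_carrier(2)]
        right_mult_one_mat[OF label_mat_carrier(3)]\<close>)
  then show "isomorphic_reps ?D (label_dim n l) \<rho> (label_dim n l') \<rho>'"
    unfolding isomorphic_reps_def invertible_mat_def inverts_mat_def using eq
    by (intro conjI bexI[of _ "1\<^sub>m (label_dim n l)"] exI[of _ "1\<^sub>m (label_dim n l)"]) auto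
qed

text \<open>A weight vector yields a nonzero intertwiner from a listed representation.\<close>

lemma irreducible_rep_is_listed:
  assumes \<rho>: "irreducible_rep (quantum_double (dihedral n)) d \<rho>"
  shows "\<exists>l\<in>irrep_labels n. \<exists>\<rho>'. listed_rep n l \<rho>' \<and>
    isomorphic_reps (quantum_double (dihedral n)) d \<rho> (label_dim n l) \<rho>'"
proof -
  let ?S = "\<rho> (qd_group (dihedral n) (dih_sigma n))" and ?T = "\<rho> (qd_group (dihedral n) (dih_tau n))"
  let ?P = "\<lambda>g. \<rho> (qd_dual (dihedral n) g)"
  have rep: "matrix_rep (quantum_double (dihedral n)) d \<rho>" and d: "d > 0"
    using \<rho> by (auto simp: irreducible_rep_def)
  interpret even_dihedral_system n d ?S ?T ?P m
    using dihedral_system_of_rep[OF n_pos rep] even_dihedral_axioms by (rule even_dihedral_system.intro)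
  obtain l v where l: "l \<in> irrep_labels n" and v: "weight_vector n d ?S ?T ?P l v"
    using weight_vector_exists[OF d] by blast
  obtain \<rho>' where \<rho>': "listed_rep n l \<rho>'" using listed_rep_exists[OF l] by blast
  obtain Q where Q: "Q \<in> carrier_mat d (label_dim n l)" "Q \<noteq> 0\<^sub>m d (label_dim n l)"
    "Q * label_sigma n l = ?S * Q" "Q * label_tau n l = ?T * Q"
    "\<forall>g\<in>carrier (dihedral n). Q * degree_proj n l g = ?P g * Q"
    by (rule weight_vector_intertwiner[OF l v])
  have "isomorphic_reps (quantum_double (dihedral n)) d \<rho> (label_dim n l) \<rho>'"
    using intertwines_listed[OF l \<rho>' rep Q(1,3,4) bspec[OF Q(5)]]
    by (intro schur[OF listed_rep_irreducible[OF l \<rho>'] \<rho> Q(1,2)])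
  then show ?thesis using l \<rho>' by blast
qed

lemma card_labels:
  "card one_dim_labels = 8" "card half_dim_labels = 8"
  "card (two_dim_labels n) = (n + 2) * (m - 1)"
proof -
  have one: "one_dim_labels = {Id_One 0 0, Id_One 0 1, Id_One 1 0, Id_One 1 1,
      Mid_One 0 0, Mid_One 0 1, Mid_One 1 0, Mid_One 1 1}"
    by (auto simp: one_dim_labels_def)
  show "card one_dim_labels = 8" unfolding one by simp
  have half: "half_dim_labels = {Refl_Even 0 0, Refl_Even 0 1, Refl_Even 1 0, Refl_Even 1 1,
      Refl_Odd 0 0, Refl_Odd 0 1, Refl_Odd 1 0, Refl_Odd 1 1}"
    by (auto simp: half_dim_labels_def)
  show "card half_dim_labels = 8" unfolding half by simp
  let ?A = "Id_Two ` {1..<m}" and ?B = "Mid_Two ` {1..<m}" and ?C = "(\<lambda>(j, k). Rot j k) ` ({..<n} \<times> {1..<m})"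
  have "two_dim_labels n = ?A \<union> ?B \<union> ?C"
    by (auto simp: two_dim_labels_def)
  moreover have "card (?A \<union> ?B \<union> ?C) = card ?A + card ?B + card ?C"
    by (subst card_Un_disjoint; auto)+
  moreover have "card ?A = m - 1" "card ?B = m - 1" "card ?C = n * (m - 1)"
    by (auto simp: card_image inj_on_def card_cartesian_product)
  ultimately show "card (two_dim_labels n) = (n + 2) * (m - 1)"
    by (simp add: add_mult_distrib mult_2)
qed

lemma label_dim_of_class:
  "l \<in> one_dim_labels \<Longrightarrow> label_dim n l = 1"
  "l \<in> half_dim_labels \<Longrightarrow> label_dim n l = m"
  "l \<in> two_dim_labels n \<Longrightarrow> label_dim n l = 2"
  by (auto simp: one_dim_labels_def half_dim_labels_def two_dim_labels_def)

end

section \<open>The classification\<close>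

theorem mainTheorem1:
  fixes n :: nat
  assumes "even n" and "n > 0"
  shows
    "(\<forall>l\<in>irrep_labels n. \<exists>\<rho>. listed_rep n l \<rho>) \<and>
     (\<forall>l\<in>irrep_labels n. \<forall>\<rho>. listed_rep n l \<rho> \<longrightarrow>
        irreducible_rep (quantum_double (dihedral n)) (label_dim n l) \<rho>) \<and>
     (\<forall>l\<in>irrep_labels n. \<forall>l'\<in>irrep_labels n. \<forall>\<rho> \<rho>'.
        listed_rep n l \<rho> \<and> listed_rep n l' \<rho>' \<longrightarrow>
        (isomorphic_reps (quantum_double (dihedral n)) (label_dim n l) \<rho> (label_dim n l') \<rho>'
           \<longleftrightarrow> l = l')) \<and>
     (\<forall>d \<rho>. irreducible_rep (quantum_double (dihedral n)) d \<rho> \<longrightarrow>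
        (\<exists>l\<in>irrep_labels n. \<exists>\<rho>'. listed_rep n l \<rho>' \<and>
           isomorphic_reps (quantum_double (dihedral n)) d \<rho> (label_dim n l) \<rho>')) \<and>
     irrep_labels n = one_dim_labels \<union> half_dim_labels \<union> two_dim_labels n \<and>
     (\<forall>l\<in>one_dim_labels. label_dim n l = 1) \<and> card one_dim_labels = 8 \<and>
     (\<forall>l\<in>half_dim_labels. label_dim n l = n div 2) \<and> card half_dim_labels = 8 \<and>
     (\<forall>l\<in>two_dim_labels n. label_dim n l = 2) \<and>
     card (two_dim_labels n) = (n + 2) * (n div 2 - 1)"
proof -
  interpret even_dihedral n "n div 2"
    using assms by unfold_locales auto
  show ?thesis
    using listed_rep_exists listed_rep_irreducible isomorphic_listed_iff irreducible_rep_is_listed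
      card_labels label_dim_of_class irrep_labels_def[of n]
    by blast
qed

end
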